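(* Let $M$ be a $C^\infty$-manifold, $\pi$ a nondegenerate $2$-vector field on $M$, $N$ a Nijenhuis structure on $M$ compatible with $\pi$, and $\Phi$ a $3$-vector field on $M$. Suppose that $$[\pi,\Phi]=0\qquad\text{and}\qquad \tfrac12\iota_{\alpha\wedge\beta}[\pi,\pi]=N\iota_{\alpha\wedge\beta}\Phi\quad\text{for all }\alpha,\beta\in\Omega^1(M).$$ Then $(\pi,N,\Phi)$ is a pseudo-Poisson Nijenhuis structure, i.e. it also satisfies $$N\iota_{\alpha\wedge\beta}\mathcal L_X\Phi-\iota_{\alpha\wedge\beta}\mathcal L_{NX}\Phi-\iota_{(\mathcal L_XN^* )(\alpha\wedge\beta)}\Phi=0$$ for all $X\in\mathfrak X(M)$ and $\alpha,\beta\in\Omega^1(M)$.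
   Context: Notation: $\Omega^1(M)$ denotes the one-forms, $\mathfrak{X}^*(M)=\Gamma(\Lambda^*TM)$, $\mathfrak X(M)=\mathfrak X^1(M)$; $\langle\cdot,\cdot\rangle$ is the pairing of vectors and covectors; $\mathcal L$ is the usual Lie derivative. $\pi^\sharp:T^*M\to TM$ is defined by $\langle\pi^\sharp\alpha,\beta\rangle=\pi(\alpha,\beta)$; $\pi$ is nondegenerate if $\pi^\sharp$ is a bundle isomorphism. A $(1,1)$-tensor $N$ is viewed as a bundle map $N:TM\to TM$ with dual $N^*:T^*M\to T^*M$. Interior product: $\iota_\alpha D=D(\alpha,\dots)$, $\iota_{\alpha\wedge\beta}=\iota_\beta\iota_\alpha$, so $\iota_{\alpha\wedge\beta}\Phi=\Phi(\alpha,\beta,\cdot)$ is a vector field. Also $\iota_{(\mathcal L_XN^* )(\alpha\wedge\beta)}:=\iota_{(\mathcal L_XN^* )\alpha\wedge\beta}+\iota_{\alpha\wedge(\mathcal L_XN^* )\beta}$ with $(\mathcal L_XN^* )\alpha=\mathcal L_X(N^*\alpha)-N^*\mathcal L_X\alpha$. $[\cdot,\cdot]$ on $\mathfrak X^*(M)$ is the usual Schouten bracket: bilinear of degree $-1$, $[f,g]=0$, $[X,f]=Xf$, the Lie bracket on vector fields, $[D_1,D_2\wedge D_3]=[D_1,D_2]\wedge D_3+(-1)^{(\deg D_1+1)\deg D_2}D_2\wedge[D_1,D_3]$, $[D_1,D_2]=-(-1)^{(\deg D_1-1)(\deg D_2-1)}[D_2,D_1]$. For $X,Y\in\mathfrak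 X(M)$ put $[X,Y]_N=[NX,Y]+[X,NY]-N[X,Y]$; $N$ is a Nijenhuis structure if $[NX,NY]=N[X,Y]_N$ for all $X,Y$. For $\alpha,\beta\in\Omega^1(M)$ put $[\alpha,\beta]_\pi=\mathcal L_{\pi^\sharp\alpha}\beta-\mathcal L_{\pi^\sharp\beta}\alpha-d\langle\pi^\sharp\alpha,\beta\rangle$; $\pi$ and $N$ are compatible if $N\circ\pi^\sharp=\pi^\sharp\circ N^*$ and for all $\alpha,\beta\in\Omega^1(M)$ $$\mathcal L_{N\pi^\sharp\alpha}\beta-\mathcal L_{N\pi^\sharp\beta}\alpha-d\langle N\pi^\sharp\alpha,\beta\rangle=[N^*\alpha,\beta]_\pi+[\alpha,N^*\beta]_\pi-N^*[\alpha,\beta]_\pi.$$ A pseudo-Poisson Nijenhuis structure on $M$ is a triple $(\pi,N,\Phi)$ of a $2$-vector field $\pi$, a Nijenhuis structure $N$ compatible with $\pi$ and a $3$-vector field $\Phi$ satisfying the three displayed conditions of the claim (the two hypotheses and the conclusion). *)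

theory Defs
  imports
    "HOL-Analysis.Analysis"
    "HOL-Combinatorics.Permutations"
    "HOL-Library.Function_Algebras"
begin

section \<open>Smooth manifolds\<close>

primrec higher_differentiable_on ::
  "'e::euclidean_space set \<Rightarrow> ('e \<Rightarrow> 'f::euclidean_space) \<Rightarrow> nat \<Rightarrow> bool" where
  "higher_differentiable_on S f 0 \<longleftrightarrow> continuous_on S f"
| "higher_differentiable_on S f (Suc n) \<longleftrightarrow>
     (\<forall>x\<in>S. f differentiable (at x)) \<and>
     (\<forall>v. higher_differentiable_on S (\<lambda>x. frechet_derivative f (at x) v) n)"

text \<open>Only used on open sets \<^term>\<open>S\<close>.\<close>

definition smooth_on ::
  "'e::euclidean_space set \<Rightarrow> ('e \<Rightarrow> 'f::euclidean_space) \<Rightarrow> bool" where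
  "smooth_on S f \<longleftrightarrow> (\<forall>n. higher_differentiable_on S f n)"

text \<open>The manifold is the whole type \<open>'m\<close>; charts are pairs of a domain and a coordinate map
  into \<open>'e\<close>. The atlas need not be maximal.\<close>

type_synonym ('m, 'e) atlas = "('m set \<times> ('m \<Rightarrow> 'e)) set"

definition smooth_atlas ::
  "('m::{t2_space,second_countable_topology}, 'e::euclidean_space) atlas \<Rightarrow> bool" where
  "smooth_atlas A \<longleftrightarrow>
     (\<Union>(U, \<phi>)\<in>A. U) = UNIV \<and>
     (\<forall>(U, \<phi>)\<in>A. open U \<and> open (\<phi> ` U) \<and> (\<exists>\<psi>. homeomorphism U (\<phi> ` U) \<phi> \<psi>)) \<and>
     (\<forall>(U, \<phi>)\<in>A. \<forall>(V, \<psi>)\<in>A. smooth_on (\<phi> ` (U \<inter> V)) (\<psi> \<circ> inv_into U \<phi>))"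

definition smooth_funs ::
  "('m::topological_space, 'e::euclidean_space) atlas \<Rightarrow> ('m \<Rightarrow> real) set" where
  "smooth_funs A = {f. \<forall>(U, \<phi>)\<in>A. smooth_on (\<phi> ` U) (f \<circ> inv_into U \<phi>)}"


section \<open>Tangent and cotangent vectors, multivectors\<close>

text \<open>A tangent vector at \<open>p\<close> is a derivation of the smooth functions at \<open>p\<close>. Tangent vectors are
  totalised by \<open>0\<close> on non-smooth functions, covectors by \<open>0\<close> off the tangent space, and
  \<open>k\<close>-vectors by \<open>0\<close> off the lists of \<open>k\<close> covectors, so that each of these objects is a unique
  HOL function. Sums of vectors and of fields are the pointwise ones.\<close>

type_synonym 'm tvec = "('m \<Rightarrow> real) \<Rightarrow> real"
type_synonym 'm covec = "'m tvec \<Rightarrow> real"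
type_synonym 'm mvec = "'m covec list \<Rightarrow> real"

definition tangent_space ::
  "('m::topological_space, 'e::euclidean_space) atlas \<Rightarrow> 'm \<Rightarrow> 'm tvec set" where
  "tangent_space A p = {v.
     (\<forall>f. f \<notin> smooth_funs A \<longrightarrow> v f = 0) \<and>
     (\<forall>f\<in>smooth_funs A. \<forall>g\<in>smooth_funs A. \<forall>a b.
        v (\<lambda>x. a * f x + b * g x) = a * v f + b * v g) \<and>
     (\<forall>f\<in>smooth_funs A. \<forall>g\<in>smooth_funs A.
        v (\<lambda>x. f x * g x) = v f * g p + f p * v g)}"

definition cotangent_space ::
  "('m::topological_space, 'e::euclidean_space) atlas \<Rightarrow> 'm \<Rightarrow> 'm covec set" where
  "cotangent_space A p = {\<xi>.
     (\<forall>v. v \<notin> tangent_space A p \<longrightarrow> \<xi> v = 0) \<and>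
     (\<forall>v\<in>tangent_space A p. \<forall>w\<in>tangent_space A p. \<forall>a b.
        \<xi> (\<lambda>f. a * v f + b * w f) = a * \<xi> v + b * \<xi> w)}"

text \<open>The fibre of \<open>\<Lambda>\<^sup>k TM\<close> at \<open>p\<close>, as alternating \<open>k\<close>-linear forms on the cotangent space.\<close>

definition multivectors ::
  "('m::topological_space, 'e::euclidean_space) atlas \<Rightarrow> nat \<Rightarrow> 'm \<Rightarrow> 'm mvec set" where
  "multivectors A k p = {D.
     (\<forall>\<xi>s. \<not> (length \<xi>s = k \<and> set \<xi>s \<subseteq> cotangent_space A p) \<longrightarrow> D \<xi>s = 0) \<and>
     (\<forall>\<xi>s. length \<xi>s = k \<and> set \<xi>s \<subseteq> cotangent_space A p \<longrightarrow>
        (\<forall>i<k. \<forall>\<eta>\<in>cotangent_space A p. \<forall>\<zeta>\<in>cotangent_space A p. \<forall>a b.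
           D (\<xi>s[i := (\<lambda>v. a * \<eta> v + b * \<zeta> v)]) = a * D (\<xi>s[i := \<eta>]) + b * D (\<xi>s[i := \<zeta>])) \<and>
        (\<forall>i<k. \<forall>j<k. i \<noteq> j \<and> \<xi>s ! i = \<xi>s ! j \<longrightarrow> D \<xi>s = 0))}"

text \<open>The canonical identification of the bidual of the tangent space with the tangent space.\<close>

definition vector_of ::
  "('m::topological_space, 'e::euclidean_space) atlas \<Rightarrow> 'm \<Rightarrow> ('m covec \<Rightarrow> real) \<Rightarrow> 'm tvec" where
  "vector_of A p L = (THE v. v \<in> tangent_space A p \<and> (\<forall>\<xi>\<in>cotangent_space A p. \<xi> v = L \<xi>))"


section \<open>Smooth sections\<close>

definition vector_fields ::
  "('m::topological_space, 'e::euclidean_space) atlas \<Rightarrow> ('m \<Rightarrow> 'm tvec) set" where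
  "vector_fields A = {X. (\<forall>p. X p \<in> tangent_space A p) \<and>
     (\<forall>f\<in>smooth_funs A. (\<lambda>p. X p f) \<in> smooth_funs A)}"

definition one_forms ::
  "('m::topological_space, 'e::euclidean_space) atlas \<Rightarrow> ('m \<Rightarrow> 'm covec) set" where
  "one_forms A = {\<alpha>. (\<forall>p. \<alpha> p \<in> cotangent_space A p) \<and>
     (\<forall>X\<in>vector_fields A. (\<lambda>p. \<alpha> p (X p)) \<in> smooth_funs A)}"

definition mv_eval :: "('m \<Rightarrow> 'm mvec) \<Rightarrow> ('m \<Rightarrow> 'm covec) list \<Rightarrow> 'm \<Rightarrow> real" where
  "mv_eval D \<alpha>s = (\<lambda>p. D p (map (\<lambda>\<alpha>. \<alpha> p) \<alpha>s))"

definition multivector_fields ::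
  "('m::topological_space, 'e::euclidean_space) atlas \<Rightarrow> nat \<Rightarrow> ('m \<Rightarrow> 'm mvec) set" where
  "multivector_fields A k = {D. (\<forall>p. D p \<in> multivectors A k p) \<and>
     (\<forall>\<alpha>s. length \<alpha>s = k \<and> set \<alpha>s \<subseteq> one_forms A \<longrightarrow> mv_eval D \<alpha>s \<in> smooth_funs A)}"

definition endomorphism_fields ::
  "('m::topological_space, 'e::euclidean_space) atlas \<Rightarrow> ('m \<Rightarrow> 'm tvec \<Rightarrow> 'm tvec) set" where
  "endomorphism_fields A = {N.
     (\<forall>p. \<forall>v\<in>tangent_space A p. N p v \<in> tangent_space A p) \<and>
     (\<forall>p. \<forall>v\<in>tangent_space A p. \<forall>w\<in>tangent_space A p. \<forall>a b.
        N p (\<lambda>f. a * v f + b * w f) = (\<lambda>f. a * N p v f + b * N p w f)) \<and>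
     (\<forall>X\<in>vector_fields A. (\<lambda>p. N p (X p)) \<in> vector_fields A)}"

text \<open>Functions and vector fields as multivector fields of degree \<open>0\<close> and \<open>1\<close>.\<close>

definition mv_fun :: "('m \<Rightarrow> real) \<Rightarrow> 'm \<Rightarrow> 'm mvec" where
  "mv_fun f = (\<lambda>p \<xi>s. if \<xi>s = [] then f p else 0)"

definition mv_vec ::
  "('m::topological_space, 'e::euclidean_space) atlas \<Rightarrow> ('m \<Rightarrow> 'm tvec) \<Rightarrow> 'm \<Rightarrow> 'm mvec" where
  "mv_vec A X = (\<lambda>p \<xi>s. case \<xi>s of
     [\<xi>] \<Rightarrow> (if \<xi> \<in> cotangent_space A p then \<xi> (X p) else 0) | _ \<Rightarrow> 0)"

definition mv_scale :: "real \<Rightarrow> ('m \<Rightarrow> 'm mvec) \<Rightarrow> 'm \<Rightarrow> 'm mvec" where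
  "mv_scale c D = (\<lambda>p \<xi>s. c * D p \<xi>s)"

text \<open>Wedge product of fields of degrees \<open>k\<close> and \<open>l\<close>, normalised such that
  \<open>(X \<and> Y)(\<alpha>, \<beta>) = \<alpha>(X) \<beta>(Y) - \<beta>(X) \<alpha>(Y)\<close>.\<close>

definition mv_wedge ::
  "nat \<Rightarrow> nat \<Rightarrow> ('m \<Rightarrow> 'm mvec) \<Rightarrow> ('m \<Rightarrow> 'm mvec) \<Rightarrow> 'm \<Rightarrow> 'm mvec" where
  "mv_wedge k l D E = (\<lambda>p \<xi>s. if length \<xi>s = k + l then
     (\<Sum>\<sigma> | \<sigma> permutes {..<k + l}. of_int (sign \<sigma>) *
        D p (map (\<lambda>i. \<xi>s ! \<sigma> i) [0..<k]) * E p (map (\<lambda>i. \<xi>s ! \<sigma> i) [k..<k + l]))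
       / (fact k * fact l)
     else 0)"


section \<open>Lie bracket, differential, Lie derivatives\<close>

definition lie_bracket :: "('m \<Rightarrow> 'm tvec) \<Rightarrow> ('m \<Rightarrow> 'm tvec) \<Rightarrow> 'm \<Rightarrow> 'm tvec" where
  "lie_bracket X Y = (\<lambda>p f. X p (\<lambda>q. Y q f) - Y p (\<lambda>q. X q f))"

definition differential ::
  "('m::topological_space, 'e::euclidean_space) atlas \<Rightarrow> ('m \<Rightarrow> real) \<Rightarrow> 'm \<Rightarrow> 'm covec" where
  "differential A f = (\<lambda>p v. if v \<in> tangent_space A p then v f else 0)"

text \<open>\<open>\<langle>L\<^sub>X \<alpha>, Y\<rangle> = X \<langle>\<alpha>, Y\<rangle> - \<langle>\<alpha>, [X, Y]\<rangle>\<close>\<close>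

definition lie_form ::
  "('m::topological_space, 'e::euclidean_space) atlas \<Rightarrow> ('m \<Rightarrow> 'm tvec) \<Rightarrow>
    ('m \<Rightarrow> 'm covec) \<Rightarrow> 'm \<Rightarrow> 'm covec" where
  "lie_form A X \<alpha> = (THE \<beta>. \<beta> \<in> one_forms A \<and>
     (\<forall>Y\<in>vector_fields A. \<forall>p.
        \<beta> p (Y p) = X p (\<lambda>q. \<alpha> q (Y q)) - \<alpha> p (lie_bracket X Y p)))"

text \<open>\<open>(L\<^sub>X D)(\<alpha>\<^sub>1, \<dots>, \<alpha>\<^sub>k) = X (D(\<alpha>\<^sub>1, \<dots>, \<alpha>\<^sub>k)) - \<Sum>\<^sub>i D(\<alpha>\<^sub>1, \<dots>, L\<^sub>X \<alpha>\<^sub>i, \<dots>, \<alpha>\<^sub>k)\<close>\<close>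

definition lie_mv ::
  "('m::topological_space, 'e::euclidean_space) atlas \<Rightarrow> nat \<Rightarrow> ('m \<Rightarrow> 'm tvec) \<Rightarrow>
    ('m \<Rightarrow> 'm mvec) \<Rightarrow> 'm \<Rightarrow> 'm mvec" where
  "lie_mv A k X D = (THE E. E \<in> multivector_fields A k \<and>
     (\<forall>\<alpha>s. length \<alpha>s = k \<and> set \<alpha>s \<subseteq> one_forms A \<longrightarrow>
        (\<forall>p. mv_eval E \<alpha>s p =
           X p (mv_eval D \<alpha>s) - (\<Sum>i<k. mv_eval D (\<alpha>s[i := lie_form A X (\<alpha>s ! i)]) p))))"


section \<open>The Schouten bracket\<close>

text \<open>The axioms that characterise the Schouten bracket uniquely on multivector fields. The sign
  exponents \<open>k - 1\<close> are replaced by \<open>k + 1\<close>, and the degree \<open>k + l - 1\<close> is truncated in the case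
  \<open>k = l = 0\<close>, where the bracket vanishes.\<close>

definition schouten_bracket ::
  "('m::topological_space, 'e::euclidean_space) atlas \<Rightarrow>
    (('m \<Rightarrow> 'm mvec) \<Rightarrow> ('m \<Rightarrow> 'm mvec) \<Rightarrow> 'm \<Rightarrow> 'm mvec) \<Rightarrow> bool" where
  "schouten_bracket A br \<longleftrightarrow>
     (\<forall>k l. \<forall>D\<in>multivector_fields A k. \<forall>E\<in>multivector_fields A l.
        br D E \<in> multivector_fields A (k + l - 1)) \<and>
     (\<forall>k l. \<forall>D\<in>multivector_fields A k. \<forall>D'\<in>multivector_fields A k.
        \<forall>E\<in>multivector_fields A l. \<forall>a b.
          br (mv_scale a D + mv_scale b D') E = mv_scale a (br D E) + mv_scale b (br D' E) \<and>
          br E (mv_scale a D + mv_scale b D') = mv_scale a (br E D) + mv_scale b (br E D')) \<and>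
     (\<forall>f\<in>smooth_funs A. \<forall>g\<in>smooth_funs A. br (mv_fun f) (mv_fun g) = 0) \<and>
     (\<forall>X\<in>vector_fields A. \<forall>f\<in>smooth_funs A.
        br (mv_vec A X) (mv_fun f) = mv_fun (\<lambda>p. X p f)) \<and>
     (\<forall>X\<in>vector_fields A. \<forall>Y\<in>vector_fields A.
        br (mv_vec A X) (mv_vec A Y) = mv_vec A (lie_bracket X Y)) \<and>
     (\<forall>k l m. \<forall>D\<in>multivector_fields A k. \<forall>E\<in>multivector_fields A l.
        \<forall>F\<in>multivector_fields A m.
          br D (mv_wedge l m E F) =
            mv_wedge (k + l - 1) m (br D E) F
            + mv_scale ((-1) ^ ((k + 1) * l)) (mv_wedge l (k + m - 1) E (br D F))) \<and>
     (\<forall>k l. \<forall>D\<in>multivector_fields A k. \<forall>E\<in>multivector_fields A l.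
        br D E = mv_scale (- ((-1) ^ ((k + 1) * (l + 1)))) (br E D))"


section \<open>Pseudo-Poisson Nijenhuis structures\<close>

text \<open>\<open>\<langle>\<pi>\<^sup>\<sharp> \<xi>, \<eta>\<rangle> = \<pi>(\<xi>, \<eta>)\<close>\<close>

definition sharp ::
  "('m::topological_space, 'e::euclidean_space) atlas \<Rightarrow> ('m \<Rightarrow> 'm mvec) \<Rightarrow>
    'm \<Rightarrow> 'm covec \<Rightarrow> 'm tvec" where
  "sharp A P p \<xi> = vector_of A p (\<lambda>\<eta>. P p [\<xi>, \<eta>])"

definition nondegenerate ::
  "('m::topological_space, 'e::euclidean_space) atlas \<Rightarrow> ('m \<Rightarrow> 'm mvec) \<Rightarrow> bool" where
  "nondegenerate A P \<longleftrightarrow>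
     (\<forall>p. bij_betw (sharp A P p) (cotangent_space A p) (tangent_space A p))"

definition dual_map ::
  "('m::topological_space, 'e::euclidean_space) atlas \<Rightarrow> ('m \<Rightarrow> 'm tvec \<Rightarrow> 'm tvec) \<Rightarrow>
    'm \<Rightarrow> 'm covec \<Rightarrow> 'm covec" where
  "dual_map A N p \<xi> = (\<lambda>v. if v \<in> tangent_space A p then \<xi> (N p v) else 0)"

text \<open>The map on sections induced by a bundle map.\<close>

definition on_sections :: "('m \<Rightarrow> 'a \<Rightarrow> 'b) \<Rightarrow> ('m \<Rightarrow> 'a) \<Rightarrow> 'm \<Rightarrow> 'b" where
  "on_sections S s = (\<lambda>p. S p (s p))"

definition bracket_N ::
  "('m \<Rightarrow> 'm tvec \<Rightarrow> 'm tvec) \<Rightarrow> ('m \<Rightarrow> 'm tvec) \<Rightarrow> ('m \<Rightarrow> 'm tvec) \<Rightarrow> 'm \<Rightarrow> 'm tvec" where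
  "bracket_N N X Y = lie_bracket (on_sections N X) Y + lie_bracket X (on_sections N Y)
     - on_sections N (lie_bracket X Y)"

definition nijenhuis ::
  "('m::topological_space, 'e::euclidean_space) atlas \<Rightarrow> ('m \<Rightarrow> 'm tvec \<Rightarrow> 'm tvec) \<Rightarrow> bool" where
  "nijenhuis A N \<longleftrightarrow> N \<in> endomorphism_fields A \<and>
     (\<forall>X\<in>vector_fields A. \<forall>Y\<in>vector_fields A.
        lie_bracket (on_sections N X) (on_sections N Y) = on_sections N (bracket_N N X Y))"

text \<open>\<open>L\<^sub>S\<^sub>\<alpha> \<beta> - L\<^sub>S\<^sub>\<beta> \<alpha> - d\<langle>S\<alpha>, \<beta>\<rangle>\<close> for a bundle map \<open>S\<close> from the cotangent to the tangent bundle.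
  For \<open>S = \<pi>\<^sup>\<sharp>\<close> this is \<open>[\<alpha>, \<beta>]\<^sub>\<pi>\<close>.\<close>

definition bracket_form ::
  "('m::topological_space, 'e::euclidean_space) atlas \<Rightarrow> ('m \<Rightarrow> 'm covec \<Rightarrow> 'm tvec) \<Rightarrow>
    ('m \<Rightarrow> 'm covec) \<Rightarrow> ('m \<Rightarrow> 'm covec) \<Rightarrow> 'm \<Rightarrow> 'm covec" where
  "bracket_form A S \<alpha> \<beta> =
     lie_form A (on_sections S \<alpha>) \<beta> - lie_form A (on_sections S \<beta>) \<alpha>
     - differential A (\<lambda>p. \<beta> p (S p (\<alpha> p)))"

definition compatible ::
  "('m::topological_space, 'e::euclidean_space) atlas \<Rightarrow> ('m \<Rightarrow> 'm mvec) \<Rightarrow>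
    ('m \<Rightarrow> 'm tvec \<Rightarrow> 'm tvec) \<Rightarrow> bool" where
  "compatible A P N \<longleftrightarrow>
     (\<forall>p. \<forall>\<xi>\<in>cotangent_space A p. N p (sharp A P p \<xi>) = sharp A P p (dual_map A N p \<xi>)) \<and>
     (\<forall>\<alpha>\<in>one_forms A. \<forall>\<beta>\<in>one_forms A.
        bracket_form A (\<lambda>p \<xi>. N p (sharp A P p \<xi>)) \<alpha> \<beta> =
          bracket_form A (sharp A P) (on_sections (dual_map A N) \<alpha>) \<beta>
          + bracket_form A (sharp A P) \<alpha> (on_sections (dual_map A N) \<beta>)
          - on_sections (dual_map A N) (bracket_form A (sharp A P) \<alpha> \<beta>))"

text \<open>\<open>\<iota>\<^bsub>\<alpha>\<and>\<beta>\<^esub> \<Phi> = \<Phi>(\<alpha>, \<beta>, \<cdot>)\<close>\<close>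

definition contract ::
  "('m::topological_space, 'e::euclidean_space) atlas \<Rightarrow> ('m \<Rightarrow> 'm covec) \<Rightarrow> ('m \<Rightarrow> 'm covec) \<Rightarrow>
    ('m \<Rightarrow> 'm mvec) \<Rightarrow> 'm \<Rightarrow> 'm tvec" where
  "contract A \<alpha> \<beta> D = (\<lambda>p. vector_of A p (\<lambda>\<xi>. D p [\<alpha> p, \<beta> p, \<xi>]))"

definition lie_dual ::
  "('m::topological_space, 'e::euclidean_space) atlas \<Rightarrow> ('m \<Rightarrow> 'm tvec) \<Rightarrow>
    ('m \<Rightarrow> 'm tvec \<Rightarrow> 'm tvec) \<Rightarrow> ('m \<Rightarrow> 'm covec) \<Rightarrow> 'm \<Rightarrow> 'm covec" where
  "lie_dual A X N \<alpha> =
     lie_form A X (on_sections (dual_map A N) \<alpha>) - on_sections (dual_map A N) (lie_form A X \<alpha>)"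

text \<open>The parameter \<open>br\<close> is the Schouten bracket.\<close>

definition pseudo_poisson_nijenhuis ::
  "('m::topological_space, 'e::euclidean_space) atlas \<Rightarrow>
    (('m \<Rightarrow> 'm mvec) \<Rightarrow> ('m \<Rightarrow> 'm mvec) \<Rightarrow> 'm \<Rightarrow> 'm mvec) \<Rightarrow>
    ('m \<Rightarrow> 'm mvec) \<Rightarrow> ('m \<Rightarrow> 'm tvec \<Rightarrow> 'm tvec) \<Rightarrow> ('m \<Rightarrow> 'm mvec) \<Rightarrow> bool" where
  "pseudo_poisson_nijenhuis A br P N \<Phi> \<longleftrightarrow>
     P \<in> multivector_fields A 2 \<and> nijenhuis A N \<and> compatible A P N \<and>
     \<Phi> \<in> multivector_fields A 3 \<and>
     br P \<Phi> = 0 \<and>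
     (\<forall>\<alpha>\<in>one_forms A. \<forall>\<beta>\<in>one_forms A.
        contract A \<alpha> \<beta> (mv_scale (1/2) (br P P)) = on_sections N (contract A \<alpha> \<beta> \<Phi>)) \<and>
     (\<forall>X\<in>vector_fields A. \<forall>\<alpha>\<in>one_forms A. \<forall>\<beta>\<in>one_forms A.
        on_sections N (contract A \<alpha> \<beta> (lie_mv A 3 X \<Phi>))
        - contract A \<alpha> \<beta> (lie_mv A 3 (on_sections N X) \<Phi>)
        - (contract A (lie_dual A X N \<alpha>) \<beta> \<Phi> + contract A \<alpha> (lie_dual A X N \<beta>) \<Phi>) = 0)"

end

theory Submission
  imports Defs
begin

text \<open>Write $\{f,g\} = \pi(df,dg)$ and $\Psi = \frac12[\pi,\pi]$. The second hypothesis says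
  $\Psi(\alpha,\beta,\gamma) = \Phi(\alpha,\beta,N^*\gamma)$; as $\Psi$ is alternating, $N^*$ may sit in
  any slot of $\Phi$. After pairing with a one-form $\gamma$ the left-hand side of the conclusion
  becomes
  \[ C(X;\alpha,\beta,\gamma) = X\,\Psi(\alpha,\beta,\gamma) - (NX)\,\Phi(\alpha,\beta,\gamma)
     + \Phi(D_X\alpha,\beta,\gamma) + \Phi(\alpha,D_X\beta,\gamma) + \Phi(\alpha,\beta,D_X\gamma), \]
  with $D_X\alpha = \mathcal L_{NX}\alpha - \mathcal L_X N^*\alpha$ (\<open>defect\<close>, \<open>third_condition\<close>).
  This is linear over the smooth functions in all four arguments, so its value at a point depends on
  the values of the arguments there. Since $\pi$ is nondegenerate and every covector is the
  differential of a function, it suffices to treat $X = \pi^\sharp dh$ and exact forms.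

  For these, put $\theta = N^*dh$. Compatibility of $\pi$ and $N$, evaluated on exact forms, gives
  $D_X df = -N^*d\{h,f\} - \mathcal L_{\pi^\sharp df}\theta$ (\<open>DN_Psharp\<close>). The equation
  $[\pi,\Phi]=0$ is an identity on exact forms, and one of its four slots can be filled with an
  arbitrary one-form by tensoriality (\<open>closedness_zero\<close>); filling it with $\theta$ eliminates the terms
  containing $\mathcal L\theta$, and what is left of $C$ is $[\pi,\Psi](dh,df,dg,dk)$. This vanishes
  because $\Psi$ is the Jacobiator of the bracket $\{\cdot,\cdot\}$ (\<open>coboundary_\<Psi>\<close>).

  Two foundations are needed. First, the Schouten bracket is given by its axioms alone, and is
  evaluated from them: near a point a multivector field is a sum of wedge products of vector fields, so
  the Leibniz rule determines $[\pi,\cdot]$ from its values on functions and vector fields. The result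
  is a Chevalley--Eilenberg type coboundary (\<open>br_bivector_bivector\<close>, \<open>br_bivector_trivector\<close>).
  Secondly, all of the tensor calculus rests on one property of a smooth manifold, the existence
  around each point of globally defined functions and vector fields in which tangent vectors can be
  expanded up to a bump factor (\<open>smooth_atlas_framed_space\<close>); it comes from Hadamard's lemma.\<close>

section \<open>Smooth functions on Euclidean spaces\<close>

lemma higher_differentiable_on_cong:
  assumes "open S" "\<And>x. x \<in> S \<Longrightarrow> f x = g x"
  shows "higher_differentiable_on S f n \<longleftrightarrow> higher_differentiable_on S g n"
  using assms(2)
proof (induction n arbitrary: f g)
  case 0
  then show ?case by (simp cong: continuous_on_cong)
next
  case (Suc n)
  have der: "(f has_derivative D) (at x) \<longleftrightarrow> (g has_derivative D) (at x)" if "x \<in> S" for x D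
    using has_derivative_transform_within_open[OF _ assms(1) that] Suc.prems by metis
  then have fd: "frechet_derivative f (at x) = frechet_derivative g (at x)" if "x \<in> S" for x
    using that by (simp add: frechet_derivative_def)
  have "higher_differentiable_on S (\<lambda>x. frechet_derivative f (at x) v) n \<longleftrightarrow>
      higher_differentiable_on S (\<lambda>x. frechet_derivative g (at x) v) n" for v
    by (rule Suc.IH) (simp add: fd)
  then show ?case using der by (simp add: differentiable_def)
qed

text \<open>The recursion behind the definition, stated for derivatives that are given by a formula; all
  closure properties below are inductions that apply this rule to the appropriate differentiation
  rule.\<close>

lemma higher_differentiable_on_SucI:
  assumes "open S" "\<And>x. x \<in> S \<Longrightarrow> (f has_derivative D x) (at x)"
    and "\<And>v. higher_differentiable_on S (\<lambda>x. D x v) n"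
  shows "higher_differentiable_on S f (Suc n)"
proof -
  have "frechet_derivative f (at x) = D x" if "x \<in> S" for x
    using frechet_derivative_at[OF assms(2)[OF that]] by (rule sym)
  then have "higher_differentiable_on S (\<lambda>x. frechet_derivative f (at x) v) n" for v
    by (intro iffD1[OF higher_differentiable_on_cong[OF assms(1)] assms(3)[of v]]) simp
  moreover have "f differentiable (at x)" if "x \<in> S" for x
    using assms(2)[OF that] by (rule differentiableI)
  ultimately show ?thesis by simp
qed

lemma higher_differentiable_on_SucD:
  assumes "higher_differentiable_on S f (Suc n)"
  shows "higher_differentiable_on S f n"
  using assms
proof (induction n arbitrary: f)
  case 0
  then show ?case
    by (auto intro!: continuous_at_imp_continuous_on differentiable_imp_continuous_within)
next
  case (Suc n)
  have "higher_differentiable_on S (\<lambda>x. frechet_derivative f (at x) v) n" for v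
    by (rule Suc.IH) (use Suc.prems in \<open>subst (asm) higher_differentiable_on.simps(2), blast\<close>)
  then show ?case using Suc.prems by simp
qed

lemma higher_differentiable_on_subset:
  assumes "higher_differentiable_on S f n" "T \<subseteq> S"
  shows "higher_differentiable_on T f n"
  using assms(1)
proof (induction n arbitrary: f)
  case 0
  then show ?case using assms(2) by (auto intro: continuous_on_subset)
next
  case (Suc n)
  have "higher_differentiable_on T (\<lambda>x. frechet_derivative f (at x) v) n" for v
    by (rule Suc.IH) (use Suc.prems in simp)
  then show ?case using Suc.prems assms(2) by auto
qed

lemma higher_differentiable_on_Union:
  assumes "\<And>T. T \<in> \<T> \<Longrightarrow> open T" "\<And>T. T \<in> \<T> \<Longrightarrow> higher_differentiable_on T f n"
  shows "higher_differentiable_on (\<Union>\<T>) f n"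
  using assms
proof (induction n arbitrary: f)
  case 0
  then show ?case using continuous_on_open_Union[of \<T> f] by simp
next
  case (Suc n)
  have "higher_differentiable_on (\<Union>\<T>) (\<lambda>x. frechet_derivative f (at x) v) n" for v
    by (rule Suc.IH) (use Suc.prems in \<open>simp_all only: higher_differentiable_on.simps simp_thms\<close>)
  moreover have "\<forall>x\<in>\<Union>\<T>. f differentiable (at x)"
    using Suc.prems(2) by (simp only: higher_differentiable_on.simps) blast
  ultimately show ?case by (simp only: higher_differentiable_on.simps simp_thms)
qed

lemma higher_differentiable_on_has_derivative:
  assumes "higher_differentiable_on S f (Suc n)" "x \<in> S"
  shows "(f has_derivative frechet_derivative f (at x)) (at x)"
  using assms by (auto simp: frechet_derivative_works)

lemma higher_differentiable_on_const:
  assumes "open S"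
  shows "higher_differentiable_on S (\<lambda>x. c) n"
proof (induction n arbitrary: c)
  case (Suc n)
  show ?case by (rule higher_differentiable_on_SucI[OF assms, where D="\<lambda>x v. 0"]) (simp, rule Suc.IH)
qed simp

lemma higher_differentiable_on_linear:
  assumes "open S" "bounded_linear L"
  shows "higher_differentiable_on S L n"
proof (cases n)
  case 0
  then show ?thesis using assms by (simp add: linear_continuous_on)
next
  case (Suc m)
  show ?thesis unfolding Suc
    by (rule higher_differentiable_on_SucI[OF assms(1), where D="\<lambda>x. L"])
      (rule bounded_linear_imp_has_derivative[OF assms(2)], rule higher_differentiable_on_const[OF assms(1)])
qed

lemma higher_differentiable_on_linear_compose:
  assumes "open S" "bounded_linear L" "higher_differentiable_on S f n"
  shows "higher_differentiable_on S (\<lambda>x. L (f x)) n"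
  using assms(3)
proof (induction n arbitrary: f)
  case 0
  then show ?case
    using continuous_on_compose2[OF linear_continuous_on[OF assms(2), of UNIV]] by auto
next
  case (Suc n)
  show ?case
    by (rule higher_differentiable_on_SucI[OF assms(1)],
        rule bounded_linear.has_derivative[OF assms(2)
          higher_differentiable_on_has_derivative[OF Suc.prems]], assumption)
      (rule Suc.IH, use Suc.prems in auto)
qed

lemma higher_differentiable_on_add:
  assumes "open S" "higher_differentiable_on S f n" "higher_differentiable_on S g n"
  shows "higher_differentiable_on S (\<lambda>x. f x + g x) n"
  using assms(2,3)
proof (induction n arbitrary: f g)
  case 0
  then show ?case by (auto intro: continuous_on_add)
next
  case (Suc n)
  show ?case
    by (rule higher_differentiable_on_SucI[OF assms(1)],
        rule has_derivative_add[OF higher_differentiable_on_has_derivative[OF Suc.prems(1)]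
          higher_differentiable_on_has_derivative[OF Suc.prems(2)]], assumption, assumption)
      (rule Suc.IH, use Suc.prems in auto)
qed

lemma higher_differentiable_on_sum:
  assumes "open S" "\<And>i. i \<in> I \<Longrightarrow> higher_differentiable_on S (f i) n"
  shows "higher_differentiable_on S (\<lambda>x. \<Sum>i\<in>I. f i x) n"
  using assms(2)
  by (induction I rule: infinite_finite_induct)
     (auto intro: higher_differentiable_on_add assms higher_differentiable_on_const)

lemma higher_differentiable_on_mult:
  fixes f g :: "'e::euclidean_space \<Rightarrow> real"
  assumes "open S" "higher_differentiable_on S f n" "higher_differentiable_on S g n"
  shows "higher_differentiable_on S (\<lambda>x. f x * g x) n"
  using assms(2,3)
proof (induction n arbitrary: f g)
  case 0
  then show ?case by (auto intro: continuous_on_mult)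
next
  case (Suc n)
  show ?case
    by (rule higher_differentiable_on_SucI[OF assms(1)],
        rule has_derivative_mult[OF higher_differentiable_on_has_derivative[OF Suc.prems(1)]
          higher_differentiable_on_has_derivative[OF Suc.prems(2)]], assumption, assumption)
      (rule higher_differentiable_on_add[OF assms(1)]; rule Suc.IH,
        use Suc.prems higher_differentiable_on_SucD in auto)
qed

lemma frechet_derivative_eq_sum_Basis:
  assumes "f differentiable (at x)"
  shows "frechet_derivative f (at x) v = (\<Sum>i\<in>Basis. (v \<bullet> i) *\<^sub>R frechet_derivative f (at x) i)"
proof -
  interpret linear "frechet_derivative f (at x)"
    using assms by (rule linear_frechet_derivative)
  show ?thesis
    by (subst (1) euclidean_representation[symmetric, of v]) (simp only: sum scaleR)
qed

lemma smooth_onD: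
  assumes "smooth_on S f" "open S"
  shows "\<And>x. x \<in> S \<Longrightarrow> f differentiable (at x)" "smooth_on S (\<lambda>x. frechet_derivative f (at x) v)"
    "continuous_on S f"
proof -
  have "higher_differentiable_on S f (Suc n)" for n
    using assms(1) unfolding smooth_on_def by blast
  then show "\<And>x. x \<in> S \<Longrightarrow> f differentiable (at x)" "smooth_on S (\<lambda>x. frechet_derivative f (at x) v)"
    by (auto simp: smooth_on_def)
  show "continuous_on S f" using assms(1) higher_differentiable_on.simps(1) smooth_on_def by metis
qed

lemma smooth_on_cong:
  assumes "open S" "\<And>x. x \<in> S \<Longrightarrow> f x = g x"
  shows "smooth_on S f \<longleftrightarrow> smooth_on S g"
  using higher_differentiable_on_cong[OF assms(1), of f g] assms(2) by (simp add: smooth_on_def)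

text \<open>By the chain rule the derivative of a composition is a sum of products of a component of the
  derivative of \<open>f\<close> with a partial derivative of \<open>g\<close> composed with \<open>f\<close>. The induction hypothesis
  therefore has to range over all smooth \<open>g\<close>.\<close>

lemma higher_differentiable_on_compose:
  fixes f :: "'a::euclidean_space \<Rightarrow> 'b::euclidean_space" and g :: "'b \<Rightarrow> real"
  assumes S: "open S" and T: "open T" and fT: "f ` S \<subseteq> T"
    and f: "smooth_on S f" and g: "smooth_on T g"
  shows "higher_differentiable_on S (\<lambda>x. g (f x)) n"
  using g
proof (induction n arbitrary: g)
  case 0
  then show ?case
    using continuous_on_compose2[OF smooth_onD(3)[OF 0 T] smooth_onD(3)[OF f S] fT] by simp
next
  case (Suc n)
  note dg = smooth_onD(1)[OF Suc.prems T] and df = smooth_onD(1)[OF f S]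
  have "((\<lambda>x. g (f x)) has_derivative
      (\<lambda>v. \<Sum>i\<in>Basis. (frechet_derivative f (at x) v \<bullet> i) * frechet_derivative g (at (f x)) i)) (at x)"
    if "x \<in> S" for x
  proof -
    have "f x \<in> T" using fT that by auto
    then have "((\<lambda>x. g (f x)) has_derivative
        (\<lambda>v. frechet_derivative g (at (f x)) (frechet_derivative f (at x) v))) (at x)"
      using has_derivative_compose[of f "frechet_derivative f (at x)" x UNIV g "frechet_derivative g (at (f x))"]
       df[OF that] dg by (simp add: frechet_derivative_works)
    then show ?thesis
      by (subst (asm) frechet_derivative_eq_sum_Basis) (auto simp: dg[OF \<open>f x \<in> T\<close>])
  qed
  moreover have "higher_differentiable_on S
     (\<lambda>x. \<Sum>i\<in>Basis. (frechet_derivative f (at x) v \<bullet> i) * frechet_derivative g (at (f x)) i) n" for v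
    by (intro higher_differentiable_on_sum higher_differentiable_on_mult S
          higher_differentiable_on_linear_compose[OF S bounded_linear_inner_left] Suc.IH
          smooth_onD(2)[OF Suc.prems T])
       (use smooth_onD(2)[OF f S] in \<open>auto simp: smooth_on_def\<close>)
  ultimately show ?case by (rule higher_differentiable_on_SucI[OF S])
qed

lemma smooth_on_compose:
  fixes f :: "'a::euclidean_space \<Rightarrow> 'b::euclidean_space" and g :: "'b \<Rightarrow> real"
  assumes "open S" "open T" "f ` S \<subseteq> T" "smooth_on S f" "smooth_on T g"
  shows "smooth_on S (\<lambda>x. g (f x))"
  using higher_differentiable_on_compose[OF assms] by (simp add: smooth_on_def)

lemma smooth_on_subset: "smooth_on S f \<Longrightarrow> T \<subseteq> S \<Longrightarrow> smooth_on T f"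
  by (auto simp: smooth_on_def intro: higher_differentiable_on_subset)

lemma smooth_on_Un:
  assumes "open S" "open T" "smooth_on S f" "smooth_on T f"
  shows "smooth_on (S \<union> T) f"
  using higher_differentiable_on_Union[of "{S, T}" f] assms by (auto simp: smooth_on_def)

lemma smooth_on_const: "open S \<Longrightarrow> smooth_on S (\<lambda>x. c)"
  by (simp add: smooth_on_def higher_differentiable_on_const)

lemma smooth_on_linear: "open S \<Longrightarrow> bounded_linear L \<Longrightarrow> smooth_on S L"
  by (simp add: smooth_on_def higher_differentiable_on_linear)

lemma smooth_on_add:
  "open S \<Longrightarrow> smooth_on S f \<Longrightarrow> smooth_on S g \<Longrightarrow> smooth_on S (\<lambda>x. f x + g x)"
  by (simp add: smooth_on_def higher_differentiable_on_add)

lemma smooth_on_mult: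
  fixes f g :: "'e::euclidean_space \<Rightarrow> real"
  shows "open S \<Longrightarrow> smooth_on S f \<Longrightarrow> smooth_on S g \<Longrightarrow> smooth_on S (\<lambda>x. f x * g x)"
  by (simp add: smooth_on_def higher_differentiable_on_mult)

lemma smooth_on_sum:
  assumes "open S" "\<And>i. i \<in> I \<Longrightarrow> smooth_on S (f i)"
  shows "smooth_on S (\<lambda>x. \<Sum>i\<in>I. f i x)"
  using assms by (simp add: smooth_on_def higher_differentiable_on_sum)

lemma smooth_on_diff:
  fixes f g :: "'e::euclidean_space \<Rightarrow> real"
  assumes "open S" "smooth_on S f" "smooth_on S g"
  shows "smooth_on S (\<lambda>x. f x - g x)"
  using smooth_on_add[OF assms(1,2) smooth_on_mult[OF assms(1) smooth_on_const[OF assms(1), of "-1"] assms(3)]]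
  by simp

section \<open>Bump functions and Hadamard's lemma\<close>

text \<open>The functions $t^{-k}e^{-1/t}$, extended by zero. They are closed under differentiation, which
  gives the smoothness of the case \<open>k = 0\<close>.\<close>

definition flat_exp :: "nat \<Rightarrow> real \<Rightarrow> real" where
  "flat_exp k t = (if t \<le> 0 then 0 else exp (- inverse t) * inverse t ^ k)"

lemma DERIV_flat_exp:
  "(flat_exp k has_real_derivative flat_exp (k + 2) t - k * flat_exp (k + 1) t) (at t)"
proof -
  consider "t < 0" | "t > 0" | "t = 0" by linarith
  then show ?thesis
  proof cases
    case 1
    have "((\<lambda>t. 0) has_real_derivative 0) (at t)" by simp
    then have "(flat_exp k has_real_derivative 0) (at t)"
      by (rule has_field_derivative_transform_within_open[where S="{..<0}"]) (use 1 in \<open>auto simp: flat_exp_def\<close>)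
    then show ?thesis using 1 by (simp add: flat_exp_def)
  next
    case 2
    have e: "((\<lambda>t. exp (- inverse t)) has_real_derivative exp (- inverse t) * (inverse t)\<^sup>2) (at t)"
      using 2 by (auto intro!: derivative_eq_intros simp: power2_eq_square)
    have p: "((\<lambda>t. inverse t ^ k) has_real_derivative k * inverse t ^ (k - 1) * - ((inverse t)\<^sup>2)) (at t)"
      using 2 by (auto intro!: derivative_eq_intros simp: power2_eq_square)
    have "((\<lambda>t. exp (- inverse t) * inverse t ^ k) has_real_derivative
      flat_exp (k + 2) t - k * flat_exp (k + 1) t) (at t)"
      using DERIV_mult[OF e p] 2
      by (cases k) (simp_all add: flat_exp_def power2_eq_square algebra_simps)
    then show ?thesis
      by (rule has_field_derivative_transform_within_open[where S="{0<..}"]) (use 2 in \<open>auto simp: flat_exp_def\<close>)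
  next
    case 3
    have r: "((\<lambda>h. flat_exp (Suc k) h) \<longlongrightarrow> 0) (at_right 0)"
    proof (rule Lim_transform_eventually)
      \<comment> \<open>The difference quotient of \<open>flat_exp k\<close> at \<open>0\<close> is \<open>flat_exp (k + 1)\<close>, which tends to \<open>0\<close>.\<close>
      show "((\<lambda>h. exp (- inverse h) * inverse h ^ Suc k) \<longlongrightarrow> (0::real)) (at_right 0)"
        using filterlim_compose[OF tendsto_power_div_exp_0[of "Suc k"] filterlim_inverse_at_top_right]
        by (simp add: exp_minus field_simps)
      show "\<forall>\<^sub>F h in at_right 0. exp (- inverse h) * inverse h ^ Suc k = flat_exp (Suc k) h"
        by (simp add: flat_exp_def eventually_at_right_less eventually_at_filter)
    qed
    have l: "((\<lambda>h. flat_exp (Suc k) h) \<longlongrightarrow> 0) (at_left 0)"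
      by (rule tendsto_eventually) (simp add: flat_exp_def eventually_at_filter)
    have "((\<lambda>h. flat_exp (Suc k) h) \<longlongrightarrow> 0) (at 0)"
      using r l by (simp add: filterlim_split_at_real)
    moreover have "flat_exp (Suc k) h = flat_exp k h / h" for h
      by (simp add: flat_exp_def field_simps)
    ultimately have "(flat_exp k has_real_derivative 0) (at 0)"
      by (simp add: has_field_derivative_iff) (simp add: flat_exp_def)
    then show ?thesis using 3 by (simp add: flat_exp_def)
  qed
qed

lemma smooth_on_flat_exp: "smooth_on UNIV (flat_exp k)"
proof -
  have "higher_differentiable_on UNIV (flat_exp k) n" for n
  proof (induction n arbitrary: k)
    case 0
    show ?case using DERIV_flat_exp[of k] DERIV_isCont
      by (auto intro!: continuous_at_imp_continuous_on)
  next
    case (Suc n)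
    show ?case
    proof (rule higher_differentiable_on_SucI)
      show "(flat_exp k has_derivative (\<lambda>v. (flat_exp (k + 2) t + (- real k) * flat_exp (k + 1) t) * v)) (at t)" for t
        using DERIV_flat_exp[of k t] by (simp add: has_field_derivative_def)
      show "higher_differentiable_on UNIV
          (\<lambda>t. (flat_exp (k + 2) t + (- real k) * flat_exp (k + 1) t) * v) n" for v
        by (intro higher_differentiable_on_mult higher_differentiable_on_add
            higher_differentiable_on_const Suc.IH open_UNIV)
    qed auto
  qed
  then show ?thesis by (simp add: smooth_on_def)
qed

lemma smooth_on_inner_left: "open S \<Longrightarrow> smooth_on S (\<lambda>x. x \<bullet> i)"
  by (rule smooth_on_linear) (auto simp: bounded_linear_inner_left)

text \<open>The function $e^{-1/q}$ with $q(x) = r^2 - |x-c|^2$, extended by zero to the set where $q \le 0$.\<close>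

lemma exists_smooth_bump:
  fixes c :: "'e::euclidean_space"
  assumes "r > 0"
  obtains b :: "'e \<Rightarrow> real" where "smooth_on UNIV b" "\<And>x. x \<in> ball c r \<longleftrightarrow> b x \<noteq> 0"
proof -
  define q where "q = (\<lambda>x. r\<^sup>2 - (\<Sum>i\<in>Basis. (x \<bullet> i - c \<bullet> i) * (x \<bullet> i - c \<bullet> i)))"
  have "(dist c x)\<^sup>2 = (\<Sum>i\<in>Basis. (c \<bullet> i - x \<bullet> i) * (c \<bullet> i - x \<bullet> i))" for x
    unfolding dist_norm power2_norm_eq_inner by (subst euclidean_inner) (simp add: inner_diff_left)
  then have q: "q x = r\<^sup>2 - (dist c x)\<^sup>2" for x
    by (simp add: q_def algebra_simps)
  have "smooth_on UNIV q" unfolding q_def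
    by (intro smooth_on_diff smooth_on_const smooth_on_sum smooth_on_mult smooth_on_inner_left open_UNIV)
  then have "smooth_on UNIV (\<lambda>x. flat_exp 0 (q x))"
    by (rule smooth_on_compose[OF open_UNIV open_UNIV subset_UNIV _ smooth_on_flat_exp])
  moreover have "x \<in> ball c r \<longleftrightarrow> flat_exp 0 (q x) \<noteq> 0" for x
  proof -
    have "dist c x < r \<longleftrightarrow> (dist c x)\<^sup>2 < r\<^sup>2"
      using assms power2_less_imp_less[of "dist c x" r] power_strict_mono[of "dist c x" r 2] by force
    then show ?thesis by (simp add: flat_exp_def q)
  qed
  ultimately show ?thesis using that by blast
qed

text \<open>Differentiation under the integral sign in the direction \<open>v\<close> replaces $F$ by
  $\partial_v F$ and raises the power of \<open>t\<close> by one, so the family of these integrals is closed under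
  differentiation.\<close>

lemma smooth_on_ray_integral:
  fixes F :: "'e::euclidean_space \<Rightarrow> real"
  assumes S: "open S" "convex S" "a \<in> S" and F: "smooth_on S F"
  shows "smooth_on S (\<lambda>x. integral {0..1} (\<lambda>t. t ^ k * F (a + t *\<^sub>R (x - a))))"
proof -
  have inS: "a + t *\<^sub>R (x - a) \<in> S" if "x \<in> S" "t \<in> {0..1}" for x t
    using convexD_alt[OF S(2,3) that(1), of t] that(2) by (simp add: algebra_simps)
  have cont: "continuous_on (S \<times> {0..1}) (\<lambda>(x, t). t ^ k * G (a + t *\<^sub>R (x - a)))"
    if "continuous_on S G" for G :: "'e \<Rightarrow> real" and k
  proof -
    have "continuous_on (S \<times> {0..1}) (\<lambda>p. G (a + snd p *\<^sub>R (fst p - a)))"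
      by (rule continuous_on_compose2[OF that]) (auto intro!: continuous_intros inS)
    then show ?thesis by (auto simp: split_beta intro!: continuous_intros)
  qed
  have cont1: "continuous_on {0..1} (\<lambda>t. t ^ k * G (a + t *\<^sub>R (x - a)))"
    if "continuous_on S G" "x \<in> S" for G :: "'e \<Rightarrow> real" and k x
    by (intro continuous_intros continuous_on_compose2[OF that(1)]) (auto intro!: inS that(2))
  have "higher_differentiable_on S (\<lambda>x. integral {0..1} (\<lambda>t. t ^ k * F (a + t *\<^sub>R (x - a)))) n" for n
    using F
  proof (induction n arbitrary: k F)
    case 0
    have "continuous_on S F" using 0 S(1) by (rule smooth_onD)
    then show ?case
      using integral_continuous_on_param[of S 0 "1::real", unfolded cbox_interval, OF cont] by simp
  next
    case (Suc n)
    note dF = smooth_onD(1)[OF Suc.prems S(1)] and sF = smooth_onD(2)[OF Suc.prems S(1)]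
    define L where "L x t = (\<Sum>i\<in>Basis. (t ^ Suc k * frechet_derivative F (at (a + t *\<^sub>R (x - a))) i) *\<^sub>R
        blinfun_inner_left i)" for x t
    have L: "blinfun_apply (L x t) v = t ^ Suc k * frechet_derivative F (at (a + t *\<^sub>R (x - a))) v"
      if "x \<in> S" "t \<in> {0..1}" for x t v
      by (subst frechet_derivative_eq_sum_Basis[OF dF[OF inS[OF that]]])
        (simp add: L_def blinfun.sum_left sum_distrib_left mult_ac inner_commute blinfun.scaleR_left)
    have contL: "continuous_on (S \<times> {0..1}) (\<lambda>(x, t). L x t)"
      unfolding L_def split_beta
      by (intro continuous_on_sum continuous_on_scaleR continuous_on_const
            cont[unfolded split_beta, OF smooth_onD(3)[OF sF S(1)]])
    have der: "((\<lambda>x. t ^ k * F (a + t *\<^sub>R (x - a))) has_derivative blinfun_apply (L x t)) (at x within S)"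
      if "x \<in> S" "t \<in> {0..1}" for x t
    proof -
      have F': "(F has_derivative frechet_derivative F (at (a + t *\<^sub>R (x - a)))) (at (a + t *\<^sub>R (x - a)))"
        using dF[OF inS[OF that]] by (simp add: frechet_derivative_works)
      have ray: "((\<lambda>x. a + t *\<^sub>R (x - a)) has_derivative (\<lambda>v. t *\<^sub>R v)) (at x within S)"
        by (auto intro!: derivative_eq_intros)
      have "((\<lambda>x. F (a + t *\<^sub>R (x - a))) has_derivative
          (\<lambda>v. frechet_derivative F (at (a + t *\<^sub>R (x - a))) (t *\<^sub>R v))) (at x within S)"
        by (rule has_derivative_compose[OF ray F'])
      from has_derivative_mult_right[OF this, of "t ^ k"] show ?thesis
        by (rule has_derivative_eq_rhs)
          (auto simp: L[OF that] linear_scale[OF linear_frechet_derivative[OF dF[OF inS[OF that]]]])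
    qed
    have int: "(\<lambda>t. t ^ k * F (a + t *\<^sub>R (x - a))) integrable_on {0..1}" if "x \<in> S" for x
      using cont1[OF smooth_onD(3)[OF Suc.prems S(1)] that] by (rule integrable_continuous_real)
    show ?case
    proof (rule higher_differentiable_on_SucI[OF S(1)])
      fix x assume x: "x \<in> S"
      have "((\<lambda>x. integral (cbox 0 1) (\<lambda>t. t ^ k * F (a + t *\<^sub>R (x - a)))) has_derivative
         integral (cbox 0 1) (L x)) (at x within S)"
      proof (rule leibniz_rule[where fx=L and U=S])
        show "((\<lambda>x. t ^ k * F (a + t *\<^sub>R (x - a))) has_derivative blinfun_apply (L x t)) (at x within S)"
          if "x \<in> S" "t \<in> cbox 0 1" for x t
          using that by (intro der) simp_all
        show "continuous_on (S \<times> cbox 0 1) (\<lambda>(x, t). L x t)"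
          using contL by (simp only: cbox_interval)
        show "(\<lambda>t. t ^ k * F (a + t *\<^sub>R (x - a))) integrable_on cbox 0 1" if "x \<in> S" for x
          using int[OF that] by (simp only: cbox_interval)
      qed (rule x S(2))+
      then show "((\<lambda>x. integral {0..1} (\<lambda>t. t ^ k * F (a + t *\<^sub>R (x - a)))) has_derivative
         integral {0..1} (L x)) (at x)"
        by (simp only: cbox_interval at_within_open[OF x S(1)])
    next
      fix v
      have "blinfun_apply (integral {0..1} (L x)) v =
         integral {0..1} (\<lambda>t. t ^ Suc k * frechet_derivative F (at (a + t *\<^sub>R (x - a))) v)"
        if "x \<in> S" for x
      proof -
        have "continuous_on {0..1} (\<lambda>t. (\<lambda>(x, t). L x t) (x, t))"
          by (rule continuous_on_compose2[OF contL]) (auto intro!: continuous_intros that)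
        then have "continuous_on {0..1} (L x)" by simp
        then have "blinfun_apply (integral {0..1} (L x)) v = integral {0..1} (\<lambda>t. blinfun_apply (L x t) v)"
          by (intro blinfun_apply_integral integrable_continuous_real)
        also have "\<dots> = integral {0..1} (\<lambda>t. t ^ Suc k * frechet_derivative F (at (a + t *\<^sub>R (x - a))) v)"
          by (rule integral_cong) (simp add: L that)
        finally show ?thesis .
      qed
      then show "higher_differentiable_on S (\<lambda>x. blinfun_apply (integral {0..1} (L x)) v) n"
        by (intro iffD2[OF higher_differentiable_on_cong[OF S(1)] Suc.IH[OF sF, of "Suc k" v]])
    qed
  qed
  then show ?thesis by (simp add: smooth_on_def)
qed

text \<open>With $g_i(x) = \int_0^1 \partial_i F(a + t(x-a))\,dt$ this is the fundamental theorem of calculus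
  along the segment from \<open>a\<close> to \<open>x\<close>.\<close>

lemma hadamard_lemma:
  fixes F :: "'e::euclidean_space \<Rightarrow> real"
  assumes S: "open S" "convex S" "a \<in> S" and F: "smooth_on S F"
  obtains g :: "'e \<Rightarrow> 'e \<Rightarrow> real" where "\<And>i. smooth_on S (g i)"
    "\<And>i. g i a = frechet_derivative F (at a) i"
    "\<And>x. x \<in> S \<Longrightarrow> F x - F a = (\<Sum>i\<in>Basis. ((x - a) \<bullet> i) * g i x)"
proof
  define g where "g i x = integral {0..1} (\<lambda>t. t ^ 0 * frechet_derivative F (at (a + t *\<^sub>R (x - a))) i)" for i x
  note dF = smooth_onD(1)[OF F S(1)] and sF = smooth_onD(2)[OF F S(1)]
  show "smooth_on S (g i)" for i
    unfolding g_def by (rule smooth_on_ray_integral[OF S sF])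
  show "g i a = frechet_derivative F (at a) i" for i by (simp add: g_def)
  fix x assume x: "x \<in> S"
  have inS: "a + t *\<^sub>R (x - a) \<in> S" if "t \<in> {0..1}" for t
    using convexD_alt[OF S(2,3) x, of t] that by (simp add: algebra_simps)
  have ftc: "((\<lambda>t. frechet_derivative F (at (a + t *\<^sub>R (x - a))) (x - a)) has_integral
     (F (a + 1 *\<^sub>R (x - a)) - F (a + 0 *\<^sub>R (x - a)))) {0..1}"
  proof (rule fundamental_theorem_of_calculus)
    fix t :: real assume t: "t \<in> {0..1}"
    have d: "F differentiable (at (a + t *\<^sub>R (x - a)))" by (rule dF[OF inS[OF t]])
    then have F': "(F has_derivative frechet_derivative F (at (a + t *\<^sub>R (x - a)))) (at (a + t *\<^sub>R (x - a)))"
      by (simp add: frechet_derivative_works)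
    have ray: "((\<lambda>t. a + t *\<^sub>R (x - a)) has_derivative (\<lambda>s. s *\<^sub>R (x - a))) (at t within {0..1})"
      by (auto intro!: derivative_eq_intros)
    have "((\<lambda>t. F (a + t *\<^sub>R (x - a))) has_derivative
       (\<lambda>s. frechet_derivative F (at (a + t *\<^sub>R (x - a))) (s *\<^sub>R (x - a)))) (at t within {0..1})"
      by (rule has_derivative_compose[OF ray F'])
    then show "((\<lambda>t. F (a + t *\<^sub>R (x - a))) has_vector_derivative
       frechet_derivative F (at (a + t *\<^sub>R (x - a))) (x - a)) (at t within {0..1})"
      unfolding has_vector_derivative_def
      by (simp add: linear_scale[OF linear_frechet_derivative[OF d]])
  qed simp
  have c: "continuous_on {0..1} (\<lambda>t. frechet_derivative F (at (a + t *\<^sub>R (x - a))) i)" for i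
    by (rule continuous_on_compose2[OF smooth_onD(3)[OF sF S(1)], of _ "\<lambda>t. a + t *\<^sub>R (x - a)"])
      (intro continuous_intros, rule image_subsetI, rule inS)
  have i: "((\<lambda>t. frechet_derivative F (at (a + t *\<^sub>R (x - a))) i) has_integral g i x) {0..1}" for i
    using integrable_integral[OF integrable_continuous_real[OF c[of i]]] by (simp add: g_def)
  have s: "((\<lambda>t. \<Sum>i\<in>Basis. ((x - a) \<bullet> i) * frechet_derivative F (at (a + t *\<^sub>R (x - a))) i) has_integral
     (\<Sum>i\<in>Basis. ((x - a) \<bullet> i) * g i x)) {0..1}"
    by (rule has_integral_sum[OF finite_Basis]) (rule has_integral_mult_right[OF i])
  have e: "frechet_derivative F (at (a + t *\<^sub>R (x - a))) (x - a) =
      (\<Sum>i\<in>Basis. ((x - a) \<bullet> i) * frechet_derivative F (at (a + t *\<^sub>R (x - a))) i)" if "t \<in> {0..1}" for t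
    using frechet_derivative_eq_sum_Basis[OF dF[OF inS[OF that]], of "x - a"] by (simp only: real_scaleR_def)
  have sum: "((\<lambda>t. frechet_derivative F (at (a + t *\<^sub>R (x - a))) (x - a)) has_integral
     (\<Sum>i\<in>Basis. ((x - a) \<bullet> i) * g i x)) {0..1}"
    by (rule has_integral_eq[OF _ s]) (rule e[symmetric])
  show "F x - F a = (\<Sum>i\<in>Basis. ((x - a) \<bullet> i) * g i x)"
    using has_integral_unique[OF ftc sum] by simp
qed

section \<open>Tangent vectors and local frames\<close>

lemma sum_fun_apply: "(\<Sum>i\<in>I. F i) x = (\<Sum>i\<in>I. F i x)"
  for F :: "'i \<Rightarrow> 'a \<Rightarrow> 'b::comm_monoid_add"
  by (induction I rule: infinite_finite_induct) simp_all

text \<open>Derivations at a point are studied over any atlas whose smooth functions form an algebra that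
  contains the constants.\<close>

locale smooth_algebra =
  fixes A :: "('m::topological_space, 'e::euclidean_space) atlas"
  assumes smooth_const: "(\<lambda>_. c) \<in> smooth_funs A"
    and smooth_add: "f \<in> smooth_funs A \<Longrightarrow> g \<in> smooth_funs A \<Longrightarrow> f + g \<in> smooth_funs A"
    and smooth_mult: "f \<in> smooth_funs A \<Longrightarrow> g \<in> smooth_funs A \<Longrightarrow> f * g \<in> smooth_funs A"
begin

abbreviation "SF \<equiv> smooth_funs A"
abbreviation "TS \<equiv> tangent_space A"
abbreviation "CS \<equiv> cotangent_space A"
abbreviation "VF \<equiv> vector_fields A"
abbreviation "OF \<equiv> one_forms A"
abbreviation "MV \<equiv> multivector_fields A"

lemma smooth_0: "0 \<in> SF"
  using smooth_const[of 0] by (simp add: func_zero)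

lemma smooth_minus: "f \<in> SF \<Longrightarrow> - f \<in> SF"
  using smooth_mult[OF smooth_const[of "-1"], of f] by (simp add: func_times fun_Compl_def)

lemma smooth_diff: "f \<in> SF \<Longrightarrow> g \<in> SF \<Longrightarrow> f - g \<in> SF"
  using smooth_add[OF _ smooth_minus, of f g] by simp

lemma smooth_sum: "(\<And>i. i \<in> I \<Longrightarrow> F i \<in> SF) \<Longrightarrow> (\<Sum>i\<in>I. F i) \<in> SF"
  by (induction I rule: infinite_finite_induct) (auto intro: smooth_0 smooth_add)

lemma smooth_scale: "f \<in> SF \<Longrightarrow> (\<lambda>q. c * f q) \<in> SF"
  using smooth_mult[OF smooth_const[of c], of f] by (simp add: func_times)

lemmas smooth_intros = smooth_const smooth_0 smooth_add smooth_mult smooth_minus smooth_diff smooth_sum smooth_scale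

lemma tangent_lincomb:
  assumes "v \<in> TS p" "f \<in> SF" "g \<in> SF"
  shows "v (\<lambda>x. a * f x + b * g x) = a * v f + b * v g"
  using assms by (simp add: tangent_space_def)

lemma tangent_outside: "v \<in> TS p \<Longrightarrow> f \<notin> SF \<Longrightarrow> v f = 0"
  by (simp add: tangent_space_def)

lemma tangent_add: "v \<in> TS p \<Longrightarrow> f \<in> SF \<Longrightarrow> g \<in> SF \<Longrightarrow> v (f + g) = v f + v g"
  using tangent_lincomb[of v p f g 1 1] by (simp add: func_plus)

lemma tangent_scale: "v \<in> TS p \<Longrightarrow> f \<in> SF \<Longrightarrow> v (\<lambda>x. a * f x) = a * v f"
  using tangent_lincomb[of v p f f a 0] by simp

lemma tangent_minus: "v \<in> TS p \<Longrightarrow> f \<in> SF \<Longrightarrow> v (- f) = - v f"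
  using tangent_scale[of v p f "-1"] by (simp add: fun_Compl_def)

lemma tangent_diff: "v \<in> TS p \<Longrightarrow> f \<in> SF \<Longrightarrow> g \<in> SF \<Longrightarrow> v (f - g) = v f - v g"
  using tangent_add[of v p f "- g"] tangent_minus[of v p g] smooth_minus[of g] by simp

lemma tangent_mult: "v \<in> TS p \<Longrightarrow> f \<in> SF \<Longrightarrow> g \<in> SF \<Longrightarrow> v (f * g) = v f * g p + f p * v g"
  by (simp add: tangent_space_def func_times)

lemma tangent_const: assumes "v \<in> TS p" shows "v (\<lambda>_. c) = 0"
proof -
  have "v (\<lambda>_. 1) = 0"
    using tangent_mult[OF assms smooth_const smooth_const, of 1 1] by (simp add: func_times)
  then show ?thesis using tangent_scale[OF assms smooth_const, of c 1] by simp
qed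

lemma tangent_0: assumes "v \<in> TS p" shows "v 0 = 0"
  using tangent_const[OF assms, of 0] by (simp add: func_zero)

lemma tangent_sum:
  assumes "v \<in> TS p"
  shows "(\<And>i. i \<in> I \<Longrightarrow> F i \<in> SF) \<Longrightarrow> v (\<Sum>i\<in>I. F i) = (\<Sum>i\<in>I. v (F i))"
  by (induction I rule: infinite_finite_induct)
    (auto simp: tangent_0[OF assms] tangent_add[OF assms _ smooth_sum])

lemma tangent_space_lincomb:
  assumes "v \<in> TS p" "w \<in> TS p"
  shows "(\<lambda>f. a * v f + b * w f) \<in> TS p"
  using assms by (simp add: tangent_space_def algebra_simps)

lemma tangent_space_0: "(\<lambda>_. 0) \<in> TS p"
  by (simp add: tangent_space_def)

lemma tangent_space_sum:
  "(\<And>i. i \<in> I \<Longrightarrow> V i \<in> TS p) \<Longrightarrow> (\<lambda>f. \<Sum>i\<in>I. c i * V i f) \<in> TS p"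
proof (induction I rule: infinite_finite_induct)
  case (insert i I)
  then show ?case using tangent_space_lincomb[of "V i" p "\<lambda>f. \<Sum>i\<in>I. c i * V i f" "c i" 1] by simp
qed (simp_all add: tangent_space_0)

end

text \<open>The tangent spaces near \<open>p\<close> are spanned by globally defined fields, with differentials of globally defined
  functions as coefficients; being global costs the bump factor \<open>\<rho>\<close>. In contrast to a frame in the strict
  sense, the spanning family may have more elements than the dimension.\<close>

definition local_frame :: "('m::topological_space, 'e::euclidean_space) atlas \<Rightarrow> 'm \<Rightarrow> 'e set \<Rightarrow>
    ('m \<Rightarrow> real) \<Rightarrow> ('e \<Rightarrow> 'm \<Rightarrow> real) \<Rightarrow> ('e \<Rightarrow> 'm \<Rightarrow> 'm tvec) \<Rightarrow> bool" where
  "local_frame A p I \<rho> x e \<longleftrightarrow> finite I \<and> \<rho> \<in> smooth_funs A \<and> \<rho> p = 1 \<and>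
     (\<forall>i\<in>I. x i \<in> smooth_funs A \<and> e i \<in> vector_fields A) \<and>
     (\<forall>q. \<forall>v\<in>tangent_space A q. \<forall>f\<in>smooth_funs A. \<rho> q * v f = (\<Sum>i\<in>I. v (x i) * e i q f))"

text \<open>The only property of a smooth manifold on which everything after this section depends.\<close>

locale framed_space = smooth_algebra A
  for A :: "('m::topological_space, 'e::euclidean_space) atlas" +
  assumes local_frame_exists: "\<exists>I \<rho> x e. local_frame A p I \<rho> x e"

lemma smooth_atlas_open_image:
  assumes "smooth_atlas A" "(U, \<phi>) \<in> A" "open W" "W \<subseteq> U"
  shows "open (\<phi> ` W)"
proof -
  obtain \<psi> where o: "open (\<phi> ` U)" "homeomorphism U (\<phi> ` U) \<phi> \<psi>"
    using assms(1,2) unfolding smooth_atlas_def by blast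
  have "openin (top_of_set (\<phi> ` U)) (\<phi> ` W)"
    by (rule homeomorphism_imp_open_map[OF o(2)]) (use assms(3,4) in \<open>auto intro: open_subset\<close>)
  then show ?thesis using o(1) openin_open_trans by blast
qed

lemma smooth_atlas_smooth_algebra:
  assumes "smooth_atlas A"
  shows "smooth_algebra A"
proof
  have op: "open (\<phi> ` U)" if "(U, \<phi>) \<in> A" for U \<phi>
    using assms that unfolding smooth_atlas_def by blast
  show "(\<lambda>_. c) \<in> smooth_funs A" for c
    using op by (auto simp: smooth_funs_def o_def intro!: smooth_on_const)
  fix f g assume "f \<in> smooth_funs A" "g \<in> smooth_funs A"
  then show "f + g \<in> smooth_funs A" "f * g \<in> smooth_funs A"
    using op by (auto simp: smooth_funs_def o_def func_plus func_times intro!: smooth_on_add smooth_on_mult)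
qed

text \<open>A chart with a bump function \<open>b\<close> supported in a closed ball inside the image of the chart. The
  larger ball \<open>ball c R\<close> is a convex neighbourhood of that support on which functions in the
  chart need to be smooth.\<close>

locale bump_chart =
  fixes A :: "('m::{t2_space,second_countable_topology}, 'e::euclidean_space) atlas"
    and U \<phi> c r R b
  assumes atlas: "smooth_atlas A" and chart: "(U, \<phi>) \<in> A"
    and ballU: "ball c R \<subseteq> \<phi> ` U" and r: "0 < r" "r < R"
    and b: "smooth_on UNIV b" "\<And>x. x \<in> ball c r \<longleftrightarrow> b x \<noteq> (0::real)"
begin

sublocale smooth_algebra A by (rule smooth_atlas_smooth_algebra[OF atlas])

definition cutoff :: "('e \<Rightarrow> real) \<Rightarrow> 'm \<Rightarrow> real" where
  "cutoff g = (\<lambda>q. if q \<in> U then b (\<phi> q) * g (\<phi> q) else 0)"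

lemma inv_chart: "q \<in> U \<Longrightarrow> inv_into U \<phi> (\<phi> q) = q"
proof -
  obtain \<psi> where "homeomorphism U (\<phi> ` U) \<phi> \<psi>"
    using atlas chart unfolding smooth_atlas_def by blast
  then have "inj_on \<phi> U" by (metis homeomorphism_apply1 inj_on_inverseI)
  then show "q \<in> U \<Longrightarrow> inv_into U \<phi> (\<phi> q) = q" by (rule inv_into_f_f)
qed

lemma open_chart: "open U" "open (\<phi> ` U)" "continuous_on U \<phi>"
proof -
  obtain \<psi> where "homeomorphism U (\<phi> ` U) \<phi> \<psi>" and o: "open U" "open (\<phi> ` U)"
    using atlas chart unfolding smooth_atlas_def by blast
  then show "open U" "open (\<phi> ` U)" "continuous_on U \<phi>" by (auto simp: homeomorphism_def)
qed

text \<open>In another chart, the function is the composition of a smooth function with the change of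
  coordinates on the preimage of \<open>ball c R\<close>, and it is zero off the compact support of the bump. The
  support is closed in the manifold because the manifold is Hausdorff, so these two open sets cover the
  chart.\<close>

lemma cutoff_smooth:
  assumes g: "smooth_on (ball c R) g"
  shows "cutoff g \<in> SF"
  unfolding smooth_funs_def
proof (clarsimp)
  fix V \<theta> assume V: "(V, \<theta>) \<in> A"
  let ?inv = "inv_into V \<theta>"
  obtain \<theta>' where \<theta>: "homeomorphism V (\<theta> ` V) \<theta> \<theta>'" and oV: "open V"
    using atlas V unfolding smooth_atlas_def by blast
  have injV: "inj_on \<theta> V" using \<theta> by (metis homeomorphism_apply1 inj_on_inverseI)
  obtain \<psi> where \<psi>: "homeomorphism U (\<phi> ` U) \<phi> \<psi>"
    using atlas chart unfolding smooth_atlas_def by blast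
  define K where "K = \<psi> ` cball c r"
  have cb: "cball c r \<subseteq> \<phi> ` U" using ballU r by force
  have "compact K" unfolding K_def
    by (rule compact_continuous_image[OF continuous_on_subset])
      (use \<psi> cb in \<open>auto simp: homeomorphism_def\<close>)
  then have "closed K" by (rule compact_imp_closed)
  have K: "b (\<phi> q) = 0" if "q \<in> U" "q \<notin> K" for q
  proof (rule ccontr)
    assume "b (\<phi> q) \<noteq> 0"
    then have "\<phi> q \<in> cball c r" using b(2)[of "\<phi> q"] by auto
    then have "\<psi> (\<phi> q) \<in> K" by (auto simp: K_def)
    then show False using that \<psi> by (simp add: homeomorphism_def)
  qed
  have KU: "q \<in> U \<and> \<phi> q \<in> ball c R" if "q \<in> K" for q
    using that cb \<psi> r unfolding K_def homeomorphism_def by force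
  define W where "W = U \<inter> \<phi> -` ball c R"
  have oW: "open W" unfolding W_def
    using open_chart(1,3) continuous_on_open_vimage by (metis Int_commute open_ball)
  have o1: "open (\<theta> ` (V \<inter> W))" and o2: "open (\<theta> ` (V - K))"
    by (rule smooth_atlas_open_image[OF atlas V]; use oV oW \<open>closed K\<close> in auto)+
  have trans: "smooth_on (\<theta> ` (V \<inter> U)) (\<phi> \<circ> ?inv)"
    using atlas V chart unfolding smooth_atlas_def by blast
  have "smooth_on (\<theta> ` (V \<inter> W)) (\<lambda>x. b ((\<phi> \<circ> ?inv) x) * g ((\<phi> \<circ> ?inv) x))"
  proof (rule smooth_on_compose[where g = "\<lambda>x. b x * g x" and T = "ball c R"])
    show "smooth_on (\<theta> ` (V \<inter> W)) (\<phi> \<circ> ?inv)"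
      by (rule smooth_on_subset[OF trans]) (auto simp: W_def)
    show "smooth_on (ball c R) (\<lambda>x. b x * g x)"
      by (intro smooth_on_mult smooth_on_subset[OF b(1)] g) auto
    show "(\<phi> \<circ> ?inv) ` \<theta> ` (V \<inter> W) \<subseteq> ball c R"
      by (auto simp: W_def inv_into_f_f[OF injV])
  qed (use o1 in auto)
  then have s1: "smooth_on (\<theta> ` (V \<inter> W)) (cutoff g \<circ> ?inv)"
    by (rule iffD1[OF smooth_on_cong[OF o1], rotated])
      (auto simp: cutoff_def W_def inv_into_f_f[OF injV])
  have s2: "smooth_on (\<theta> ` (V - K)) (cutoff g \<circ> ?inv)"
    by (rule iffD1[OF smooth_on_cong[OF o2] smooth_on_const[OF o2, of 0]])
      (auto simp: cutoff_def K inv_into_f_f[OF injV])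
  have "\<theta> ` V = \<theta> ` (V \<inter> W) \<union> \<theta> ` (V - K)" using KU by (auto simp: W_def)
  then show "smooth_on (\<theta> ` V) (cutoff g \<circ> ?inv)"
    using smooth_on_Un[OF o1 o2 s1 s2] by simp
qed

text \<open>The vector field with components \<open>w\<close> in the chart, multiplied by the bump. Besides the
  coordinate fields, the radial field is used.\<close>

definition cutoff_field :: "('e \<Rightarrow> 'e) \<Rightarrow> 'm \<Rightarrow> 'm tvec" where
  "cutoff_field w = (\<lambda>q f. if q \<in> U \<and> f \<in> SF
     then b (\<phi> q) * frechet_derivative (f \<circ> inv_into U \<phi>) (at (\<phi> q)) (w (\<phi> q)) else 0)"

lemma smooth_in_chart: "f \<in> SF \<Longrightarrow> smooth_on (\<phi> ` U) (f \<circ> inv_into U \<phi>)"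
  using chart by (auto simp: smooth_funs_def)

lemma differentiable_in_chart:
  "f \<in> SF \<Longrightarrow> q \<in> U \<Longrightarrow> (f \<circ> inv_into U \<phi> has_derivative
     frechet_derivative (f \<circ> inv_into U \<phi>) (at (\<phi> q))) (at (\<phi> q))"
  using smooth_onD(1)[OF smooth_in_chart open_chart(2)] frechet_derivative_works by blast

lemma cutoff_field_tangent: "cutoff_field w q \<in> TS q"
proof (cases "q \<in> U")
  case False
  then show ?thesis by (simp add: cutoff_field_def tangent_space_def)
next
  case q: True
  let ?D = "\<lambda>f. frechet_derivative (f \<circ> inv_into U \<phi>) (at (\<phi> q))"
  have lin: "?D (\<lambda>x. a * f x + b * g x) = (\<lambda>u. a * ?D f u + b * ?D g u)"
    if "f \<in> SF" "g \<in> SF" for f g a b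
    by (rule frechet_derivative_at[symmetric], unfold o_def)
      (intro has_derivative_add has_derivative_mult_right
        differentiable_in_chart[OF that(1) q, unfolded o_def] differentiable_in_chart[OF that(2) q, unfolded o_def])
  have mul: "?D (\<lambda>x. f x * g x) = (\<lambda>u. f q * ?D g u + ?D f u * g q)"
    if "f \<in> SF" "g \<in> SF" for f g
    by (rule frechet_derivative_at[symmetric])
      (use has_derivative_mult[OF differentiable_in_chart[OF that(1) q] differentiable_in_chart[OF that(2) q]]
        in \<open>simp add: o_def inv_chart[OF q]\<close>)
  have "(\<lambda>x. a * f x + b * g x) \<in> SF" "(\<lambda>x. f x * g x) \<in> SF" if "f \<in> SF" "g \<in> SF" for f g a b
    using smooth_add[OF smooth_scale[OF that(1)] smooth_scale[OF that(2)]] smooth_mult[OF that]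
    by (simp_all add: func_plus func_times)
  then show ?thesis
    by (auto simp: cutoff_field_def tangent_space_def lin mul algebra_simps)
qed

lemma cutoff_field_smooth:
  assumes "\<And>f. f \<in> SF \<Longrightarrow>
     smooth_on (ball c R) (\<lambda>x. frechet_derivative (f \<circ> inv_into U \<phi>) (at x) (w x))"
  shows "cutoff_field w \<in> VF"
proof -
  have "(\<lambda>q. cutoff_field w q f) \<in> SF" if "f \<in> SF" for f
    using cutoff_smooth[OF assms[OF that]] that by (simp add: cutoff_field_def cutoff_def)
  then show ?thesis by (simp add: vector_fields_def cutoff_field_tangent)
qed

lemma cutoff_field_partial: "cutoff_field (\<lambda>_. i) \<in> VF"
  by (rule cutoff_field_smooth,
      rule smooth_onD(2)[OF smooth_on_subset[OF smooth_in_chart ballU] open_ball])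

lemma cutoff_field_radial: "cutoff_field (\<lambda>x. k *\<^sub>R x) \<in> VF"
proof (rule cutoff_field_smooth)
  fix f assume f: "f \<in> SF"
  let ?F = "f \<circ> inv_into U \<phi>"
  have sF: "smooth_on (ball c R) ?F" by (rule smooth_on_subset[OF smooth_in_chart[OF f] ballU])
  have "smooth_on (ball c R) (\<lambda>x. \<Sum>i\<in>Basis. (k * (x \<bullet> i)) * frechet_derivative ?F (at x) i)"
    by (intro smooth_on_sum smooth_on_mult smooth_on_const smooth_on_inner_left smooth_onD(2)[OF sF] open_ball)
  then show "smooth_on (ball c R) (\<lambda>x. frechet_derivative ?F (at x) (k *\<^sub>R x))"
    by (rule iffD1[OF smooth_on_cong[OF open_ball], rotated])
      (simp add: frechet_derivative_eq_sum_Basis[OF smooth_onD(1)[OF sF open_ball], of _ "k *\<^sub>R x" for x])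
qed

text \<open>Tangent vectors are abstract derivations, so this is where they are shown to be combinations of
  partial derivatives. Hadamard's lemma writes $f - f(q)$ near \<open>q\<close> as
  $\sum_i (\phi_i - \phi_i(q)) g_i$; multiplied by the square of the bump this becomes an identity
  between global smooth functions, to which \<open>v\<close> can be applied. Both factors $f - f(q)$ and
  $\phi_i - \phi_i(q)$ vanish at \<open>q\<close>, so only one term of each product rule survives.\<close>

lemma tangent_in_chart:
  assumes q: "q \<in> U" "b (\<phi> q) \<noteq> 0" and v: "v \<in> TS q" and f: "f \<in> SF"
  shows "(b (\<phi> q))\<^sup>2 * v f = (\<Sum>i\<in>Basis. (v (cutoff (\<lambda>x. x \<bullet> i)) - (\<phi> q \<bullet> i) * v (cutoff (\<lambda>_. 1))) *
     (b (\<phi> q) * frechet_derivative (f \<circ> inv_into U \<phi>) (at (\<phi> q)) i))"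
proof -
  let ?F = "f \<circ> inv_into U \<phi>" and ?a = "\<phi> q" and ?y = "\<lambda>i. cutoff (\<lambda>x. x \<bullet> i)" and ?z = "cutoff (\<lambda>_. 1)"
  have sF: "smooth_on (ball c R) ?F" by (rule smooth_on_subset[OF smooth_in_chart[OF f] ballU])
  have rR: "x \<in> ball c R" if "b x \<noteq> 0" for x using that b(2)[of x] r by auto
  obtain g where g: "\<And>i. smooth_on (ball c R) (g i)" "\<And>i. g i ?a = frechet_derivative ?F (at ?a) i"
    "\<And>x. x \<in> ball c R \<Longrightarrow> ?F x - ?F ?a = (\<Sum>i\<in>Basis. ((x - ?a) \<bullet> i) * g i x)"
    using hadamard_lemma[OF open_ball convex_ball rR[OF q(2)] sF] by blast
  have y0: "?z \<in> SF" by (rule cutoff_smooth[OF smooth_on_const[OF open_ball]])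
  have y: "?y i \<in> SF" for i by (rule cutoff_smooth[OF smooth_on_inner_left[OF open_ball]])
  have gs: "cutoff (g i) \<in> SF" for i by (rule cutoff_smooth[OF g(1)])
  have z: "?y i - (\<lambda>x. (?a \<bullet> i) * ?z x) \<in> SF" for i by (intro smooth_diff y smooth_scale y0)
  have fq: "f - (\<lambda>_. f q) \<in> SF" by (intro smooth_diff f smooth_const)
  have eq: "?z * (?z * (f - (\<lambda>_. f q))) = (\<Sum>i\<in>Basis. (?y i - (\<lambda>x. (?a \<bullet> i) * ?z x)) * cutoff (g i))"
  proof
    fix q'
    have *: "f q' - f q = (\<Sum>i\<in>Basis. ((\<phi> q' - ?a) \<bullet> i) * g i (\<phi> q'))" if "q' \<in> U" "b (\<phi> q') \<noteq> 0"
      using g(3)[OF rR[OF that(2)]] that(1) q(1) by (simp add: inv_chart)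
    have sa: "(\<Sum>i\<in>Basis. G i) q' = (\<Sum>i\<in>Basis. G i q')" for G :: "'e \<Rightarrow> 'm \<Rightarrow> real"
      by (rule sum_fun_apply)
    show "(?z * (?z * (f - (\<lambda>_. f q)))) q' =
        (\<Sum>i\<in>Basis. (?y i - (\<lambda>x. (?a \<bullet> i) * ?z x)) * cutoff (g i)) q'"
      unfolding sa using *
      by (cases "q' \<in> U \<and> b (\<phi> q') \<noteq> 0")
       (auto simp: cutoff_def sum_distrib_left inner_diff_left algebra_simps)
  qed
  have "v (?z * (?z * (f - (\<lambda>_. f q)))) = (b ?a)\<^sup>2 * v f"
    by (simp add: tangent_mult[OF v y0 smooth_mult[OF y0 fq]] tangent_mult[OF v y0 fq]
        tangent_diff[OF v f smooth_const] tangent_const[OF v])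
      (simp add: cutoff_def q(1) power2_eq_square)
  moreover have "v (\<Sum>i\<in>Basis. (?y i - (\<lambda>x. (?a \<bullet> i) * ?z x)) * cutoff (g i)) =
     (\<Sum>i\<in>Basis. (v (?y i) - (?a \<bullet> i) * v ?z) * (b ?a * g i ?a))"
    by (simp add: tangent_sum[OF v smooth_mult[OF z gs]] tangent_mult[OF v z gs]
        tangent_diff[OF v y smooth_scale[OF y0]] tangent_scale[OF v y0])
      (simp add: cutoff_def q(1))
  ultimately show ?thesis using eq by (simp add: g(2))
qed

end

text \<open>The frame consists of the functions $b\phi_i$ and $b$. With $y_i = b\phi_i$ one has
  $b^2 d\phi_i = b\,dy_i - y_i\,db$, so the field attached to \<open>b\<close> itself is minus the radial field; this
  replaces the usual second bump function that is \<open>1\<close> on the support of the first. The index \<open>0\<close>,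
  which is not in \<open>Basis\<close>, stands for the function \<open>b\<close>.\<close>

theorem smooth_atlas_framed_space:
  fixes A :: "('m::{t2_space,second_countable_topology}, 'e::euclidean_space) atlas"
  assumes A: "smooth_atlas A"
  shows "framed_space A"
proof -
  interpret smooth_algebra A by (rule smooth_atlas_smooth_algebra[OF A])
  show ?thesis
  proof
    fix p :: 'm
    obtain U \<phi> where U: "(U, \<phi>) \<in> A" "p \<in> U" "open (\<phi> ` U)"
    proof -
      have "p \<in> (\<Union>(U, \<phi>)\<in>A. U)" using A by (simp add: smooth_atlas_def)
      then obtain U \<phi> where "(U, \<phi>) \<in> A" "p \<in> U" by auto
      moreover from this have "open (\<phi> ` U)" using A unfolding smooth_atlas_def by blast
      ultimately show ?thesis using that by blast
    qed
    obtain R where R: "R > 0" "ball (\<phi> p) R \<subseteq> \<phi> ` U"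
      using U open_contains_ball by (metis image_eqI)
    obtain b :: "'e \<Rightarrow> real" where b: "smooth_on UNIV b" "\<And>x. x \<in> ball (\<phi> p) (R / 2) \<longleftrightarrow> b x \<noteq> 0"
      using exists_smooth_bump[of "R / 2" "\<phi> p"] R(1) by auto
    interpret bump_chart A U \<phi> "\<phi> p" "R / 2" R b
      by unfold_locales (use A U R b in auto)
    have bp: "b (\<phi> p) \<noteq> 0" using b(2)[of "\<phi> p"] R(1) by simp
    \<comment> \<open>This factor normalises the square of the bump to \<open>1\<close> at \<open>p\<close>.\<close>
    define k where "k = 1 / (b (\<phi> p))\<^sup>2"
    define \<rho> where "\<rho> = (\<lambda>q. k * (cutoff (\<lambda>_. 1) * cutoff (\<lambda>_. 1)) q)"
    define x where "x i = (if i = 0 then cutoff (\<lambda>_. 1) else cutoff (\<lambda>y. y \<bullet> i))" for i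
    define e where "e i = (if i = 0 then cutoff_field (\<lambda>y. (- k) *\<^sub>R y) else cutoff_field (\<lambda>_. k *\<^sub>R i))" for i
    have "\<rho> q * v f = (\<Sum>i\<in>insert 0 Basis. v (x i) * e i q f)" if v: "v \<in> TS q" and f: "f \<in> SF" for q v f
    proof (cases "q \<in> U \<and> b (\<phi> q) \<noteq> 0")
      case False
      then show ?thesis by (auto simp: \<rho>_def e_def cutoff_def cutoff_field_def intro!: sum.neutral)
    next
      case True
      let ?D = "frechet_derivative (f \<circ> inv_into U \<phi>) (at (\<phi> q))"
      have d: "(f \<circ> inv_into U \<phi>) differentiable (at (\<phi> q))"
        using differentiable_in_chart[OF f] True by (auto simp: differentiable_def)
      have lin: "?D (s *\<^sub>R u) = s * ?D u" for s u
        using linear_scale[OF linear_frechet_derivative[OF d]] by simp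
      have rad: "?D (\<phi> q) = (\<Sum>i\<in>Basis. (\<phi> q \<bullet> i) * ?D i)"
        using frechet_derivative_eq_sum_Basis[OF d, of "\<phi> q"] by simp
      have x: "i \<in> Basis \<Longrightarrow> x i = cutoff (\<lambda>y. y \<bullet> i)" "x 0 = cutoff (\<lambda>_. 1)"
        and e: "i \<in> Basis \<Longrightarrow> e i = cutoff_field (\<lambda>_. k *\<^sub>R i)" "e 0 = cutoff_field (\<lambda>y. (- k) *\<^sub>R y)" for i
        by (auto simp: x_def e_def simp del: scaleR_minus_left)
      have "(\<Sum>i\<in>insert 0 Basis. v (x i) * e i q f) =
          k * (\<Sum>i\<in>Basis. v (x i) * (b (\<phi> q) * ?D i)) - k * v (x 0) * (b (\<phi> q) * ?D (\<phi> q))"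
        using True f by (simp add: x e cutoff_field_def lin sum_distrib_left mult_ac del: scaleR_minus_left cong: sum.cong)
      also have "\<dots> = k * (\<Sum>i\<in>Basis. (v (x i) - (\<phi> q \<bullet> i) * v (x 0)) * (b (\<phi> q) * ?D i))"
        unfolding rad by (simp add: left_diff_distrib sum_subtractf sum_distrib_left right_diff_distrib mult_ac)
      also have "\<dots> = k * ((b (\<phi> q))\<^sup>2 * v f)"
        using tangent_in_chart[of q v f] True v f by (simp add: x cong: sum.cong)
      also have "\<dots> = \<rho> q * v f" using True by (simp add: \<rho>_def cutoff_def power2_eq_square)
      finally show ?thesis by simp
    qed
    moreover have "\<rho> p = 1" using bp U by (simp add: \<rho>_def k_def cutoff_def power2_eq_square)
    moreover have "\<rho> \<in> SF" unfolding \<rho>_def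
      by (intro smooth_scale smooth_mult cutoff_smooth smooth_on_const open_ball)
    moreover have "x i \<in> SF" "e i \<in> VF" for i
      by (auto simp: x_def e_def intro!: cutoff_smooth smooth_on_const smooth_on_inner_left open_ball
          cutoff_field_radial cutoff_field_partial simp del: scaleR_minus_left)
    ultimately have "local_frame A p (insert 0 Basis) \<rho> x e" by (simp add: local_frame_def)
    then show "\<exists>I \<rho> x e. local_frame A p I \<rho> x e" by blast
  qed
qed

section \<open>Vector fields, one-forms and tensoriality\<close>

definition smul :: "('m \<Rightarrow> real) \<Rightarrow> ('m \<Rightarrow> 'b \<Rightarrow> real) \<Rightarrow> 'm \<Rightarrow> 'b \<Rightarrow> real" where
  "smul a s = (\<lambda>p v. a p * s p v)"

definition der :: "('m \<Rightarrow> 'm tvec) \<Rightarrow> ('m \<Rightarrow> real) \<Rightarrow> 'm \<Rightarrow> real" where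
  "der X f = (\<lambda>p. X p f)"

definition pairing :: "('m \<Rightarrow> 'm covec) \<Rightarrow> ('m \<Rightarrow> 'm tvec) \<Rightarrow> 'm \<Rightarrow> real" where
  "pairing \<alpha> X = (\<lambda>p. \<alpha> p (X p))"

context smooth_algebra
begin

lemma field_tangent: "X \<in> VF \<Longrightarrow> X p \<in> TS p"
  by (simp add: vector_fields_def)

lemma form_cotangent: "\<alpha> \<in> OF \<Longrightarrow> \<alpha> p \<in> CS p"
  by (simp add: one_forms_def)

lemma der_smooth: "X \<in> VF \<Longrightarrow> f \<in> SF \<Longrightarrow> der X f \<in> SF"
  by (simp add: vector_fields_def der_def)

lemma pairing_smooth: "\<alpha> \<in> OF \<Longrightarrow> X \<in> VF \<Longrightarrow> pairing \<alpha> X \<in> SF"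
  by (simp add: one_forms_def pairing_def)

lemma der_add: "X \<in> VF \<Longrightarrow> f \<in> SF \<Longrightarrow> g \<in> SF \<Longrightarrow> der X (f + g) = der X f + der X g"
  by (rule ext) (simp add: der_def tangent_add[OF field_tangent])

lemma der_minus: "X \<in> VF \<Longrightarrow> f \<in> SF \<Longrightarrow> der X (- f) = - der X f"
  by (rule ext) (simp add: der_def tangent_minus[OF field_tangent])

lemma der_mult: "X \<in> VF \<Longrightarrow> f \<in> SF \<Longrightarrow> g \<in> SF \<Longrightarrow> der X (f * g) = f * der X g + g * der X f"
  by (rule ext) (simp add: der_def tangent_mult[OF field_tangent])

lemma der_0: "X \<in> VF \<Longrightarrow> der X 0 = 0"
  by (rule ext) (simp add: der_def tangent_0[OF field_tangent])

lemma der_const: "X \<in> VF \<Longrightarrow> der X (\<lambda>_. c) = 0"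
  by (rule ext) (simp add: der_def tangent_const[OF field_tangent])

lemma der_sum: "X \<in> VF \<Longrightarrow> (\<And>i. i \<in> I \<Longrightarrow> F i \<in> SF) \<Longrightarrow> der X (\<Sum>i\<in>I. F i) = (\<Sum>i\<in>I. der X (F i))"
  by (rule ext) (simp add: der_def sum_fun_apply tangent_sum[OF field_tangent])

lemma der_field_add: "der (X + Y) f = der X f + der Y f"
  by (rule ext) (simp add: der_def)

lemma der_smul: "der (smul a X) f = a * der X f"
  by (rule ext) (simp add: der_def smul_def)

lemma vector_field_add: "X \<in> VF \<Longrightarrow> Y \<in> VF \<Longrightarrow> X + Y \<in> VF"
  using tangent_space_lincomb[of "X p" p "Y p" 1 1 for p] smooth_add[OF der_smooth der_smooth, of X _ Y]
  by (simp add: vector_fields_def der_def func_plus)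

lemma vector_field_smul: "X \<in> VF \<Longrightarrow> a \<in> SF \<Longrightarrow> smul a X \<in> VF"
  using tangent_space_lincomb[of "X p" p "X p" "a p" 0 for p] smooth_mult[OF _ der_smooth, of a X]
  by (simp add: vector_fields_def der_def func_times smul_def)

lemma vector_field_0: "0 \<in> VF"
  using smooth_const[of 0] tangent_space_0 by (simp add: vector_fields_def zero_fun_def)

lemma vector_field_sum: "(\<And>i. i \<in> I \<Longrightarrow> F i \<in> VF) \<Longrightarrow> (\<Sum>i\<in>I. F i) \<in> VF"
  by (induction I rule: infinite_finite_induct) (auto intro: vector_field_0 vector_field_add)

lemma vector_field_eqI:
  assumes "X \<in> VF" "Y \<in> VF" "\<And>f. f \<in> SF \<Longrightarrow> der X f = der Y f"
  shows "X = Y"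
proof (intro ext)
  fix p f show "X p f = Y p f"
    using assms(3)[of f] tangent_outside[OF field_tangent[OF assms(1)]] tangent_outside[OF field_tangent[OF assms(2)]]
    by (cases "f \<in> SF") (auto simp: der_def dest: fun_cong)
qed

lemma covector_lincomb:
  "\<xi> \<in> CS p \<Longrightarrow> v \<in> TS p \<Longrightarrow> w \<in> TS p \<Longrightarrow> \<xi> (\<lambda>f. a * v f + b * w f) = a * \<xi> v + b * \<xi> w"
  by (simp add: cotangent_space_def)

lemma covector_outside: "\<xi> \<in> CS p \<Longrightarrow> v \<notin> TS p \<Longrightarrow> \<xi> v = 0"
  by (simp add: cotangent_space_def)

lemma covector_sum:
  assumes "\<xi> \<in> CS p"
  shows "(\<And>i. i \<in> I \<Longrightarrow> V i \<in> TS p) \<Longrightarrow> \<xi> (\<lambda>f. \<Sum>i\<in>I. c i * V i f) = (\<Sum>i\<in>I. c i * \<xi> (V i))"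
proof (induction I rule: infinite_finite_induct)
  case (insert i I)
  have "\<xi> (\<lambda>f. c i * V i f + 1 * (\<Sum>i\<in>I. c i * V i f)) = c i * \<xi> (V i) + 1 * \<xi> (\<lambda>f. \<Sum>i\<in>I. c i * V i f)"
    by (rule covector_lincomb[OF assms]) (use insert in \<open>auto intro: tangent_space_sum\<close>)
  then show ?case using insert by simp
qed (use covector_lincomb[OF assms tangent_space_0 tangent_space_0, of 0 0] in simp_all)

lemma covector_scale: "\<xi> \<in> CS p \<Longrightarrow> v \<in> TS p \<Longrightarrow> \<xi> (\<lambda>f. a * v f) = a * \<xi> v"
  using covector_lincomb[of \<xi> p v v a 0] by simp

lemma cotangent_space_lincomb:
  "\<xi> \<in> CS p \<Longrightarrow> \<eta> \<in> CS p \<Longrightarrow> (\<lambda>v. a * \<xi> v + b * \<eta> v) \<in> CS p"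
  by (simp add: cotangent_space_def algebra_simps)

lemma cotangent_space_0: "(\<lambda>_. 0) \<in> CS p"
  by (simp add: cotangent_space_def)

lemma cotangent_space_sum:
  "(\<And>i. i \<in> I \<Longrightarrow> V i \<in> CS p) \<Longrightarrow> (\<lambda>f. \<Sum>i\<in>I. c i * V i f) \<in> CS p"
proof (induction I rule: infinite_finite_induct)
  case (insert i I)
  then show ?case using cotangent_space_lincomb[of "V i" p "\<lambda>f. \<Sum>i\<in>I. c i * V i f" "c i" 1] by simp
qed (simp_all add: cotangent_space_0)

lemma pairing_add: "pairing (\<alpha> + \<beta>) X = pairing \<alpha> X + pairing \<beta> X"
  by (rule ext) (simp add: pairing_def)

lemma pairing_diff: "pairing (\<alpha> - \<beta>) X = pairing \<alpha> X - pairing \<beta> X"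
  by (rule ext) (simp add: pairing_def)

lemma pairing_smul: "pairing (smul a \<alpha>) X = a * pairing \<alpha> X"
  by (rule ext) (simp add: pairing_def smul_def)

lemma pairing_field_add:
  assumes "\<alpha> \<in> OF" "X \<in> VF" "Y \<in> VF" shows "pairing \<alpha> (X + Y) = pairing \<alpha> X + pairing \<alpha> Y"
  using covector_lincomb[OF form_cotangent[OF assms(1)] field_tangent[OF assms(2)] field_tangent[OF assms(3)], where a=1 and b=1]
  by (intro ext) (simp add: pairing_def func_plus)

lemma pairing_field_smul:
  assumes "\<alpha> \<in> OF" "X \<in> VF" shows "pairing \<alpha> (smul a X) = a * pairing \<alpha> X"
  using covector_scale[OF form_cotangent[OF assms(1)] field_tangent[OF assms(2)]]
  by (intro ext) (simp add: pairing_def smul_def)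

lemma one_formI:
  "(\<And>p. \<alpha> p \<in> CS p) \<Longrightarrow> (\<And>X. X \<in> VF \<Longrightarrow> pairing \<alpha> X \<in> SF) \<Longrightarrow> \<alpha> \<in> OF"
  by (simp add: one_forms_def pairing_def)

lemma one_form_add:
  assumes "\<alpha> \<in> OF" "\<beta> \<in> OF" shows "\<alpha> + \<beta> \<in> OF"
  using cotangent_space_lincomb[OF form_cotangent[OF assms(1)] form_cotangent[OF assms(2)], where a=1 and b=1] assms
  by (intro one_formI) (auto simp: func_plus pairing_add[unfolded func_plus]
      intro!: smooth_add[unfolded func_plus] pairing_smooth)

lemma one_form_diff:
  assumes "\<alpha> \<in> OF" "\<beta> \<in> OF" shows "\<alpha> - \<beta> \<in> OF"
  using cotangent_space_lincomb[OF form_cotangent[OF assms(1)] form_cotangent[OF assms(2)], where a=1 and b="-1"] assms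
  by (intro one_formI) (auto simp: fun_diff_def pairing_diff[unfolded fun_diff_def]
      intro!: smooth_diff[unfolded fun_diff_def] pairing_smooth)

lemma one_form_smul:
  assumes "\<alpha> \<in> OF" "a \<in> SF" shows "smul a \<alpha> \<in> OF"
  using cotangent_space_lincomb[OF form_cotangent[OF assms(1)] form_cotangent[OF assms(1)], where a="a p" and b=0 for p] assms
  by (intro one_formI) (simp add: smul_def, simp add: pairing_smul smooth_mult pairing_smooth)

lemma one_form_0: "0 \<in> OF"
  using cotangent_space_0 smooth_const[of 0] by (simp add: one_forms_def zero_fun_def)

abbreviation "d \<equiv> differential A"

lemma differential_apply: "v \<in> TS p \<Longrightarrow> d f p v = v f"
  by (simp add: differential_def)

lemma differential_cotangent: "d f p \<in> CS p"
  by (simp add: cotangent_space_def differential_def tangent_space_lincomb)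

lemma pairing_differential: "X \<in> VF \<Longrightarrow> pairing (d f) X = der X f"
  by (rule ext) (simp add: pairing_def der_def differential_apply field_tangent)

lemma differential_form: "f \<in> SF \<Longrightarrow> d f \<in> OF"
  by (intro one_formI) (auto simp: differential_cotangent pairing_differential der_smooth)

lemma differential_eqI:
  "(\<And>v. v \<in> TS p \<Longrightarrow> d f p v = \<xi> v) \<Longrightarrow> \<xi> \<in> CS p \<Longrightarrow> d f p = \<xi>"
  by (rule ext) (metis covector_outside differential_cotangent)

lemma differential_add: "f \<in> SF \<Longrightarrow> g \<in> SF \<Longrightarrow> d (f + g) = d f + d g"
  by (intro ext) (simp add: differential_def tangent_add)

lemma differential_mult: "f \<in> SF \<Longrightarrow> g \<in> SF \<Longrightarrow> d (f * g) = smul f (d g) + smul g (d f)"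
  by (intro ext) (simp add: differential_def tangent_mult smul_def)

lemma differential_minus: "f \<in> SF \<Longrightarrow> d (- f) = - d f"
  by (intro ext) (simp add: differential_def tangent_minus)

lemma lie_bracket_field:
  assumes X: "X \<in> VF" and Y: "Y \<in> VF"
  shows "lie_bracket X Y \<in> VF"
proof -
  have der_lie: "(\<lambda>p. lie_bracket X Y p f) = der X (der Y f) - der Y (der X f)" for f
    by (rule ext) (simp add: lie_bracket_def der_def)
  have ap: "lie_bracket X Y p f = (der X (der Y f) - der Y (der X f)) p" for p f
    using der_lie by metis
  have lin: "(\<lambda>x. a * f x + b * g x) = (\<lambda>_. a) * f + (\<lambda>_. b) * g" for a b and f g :: "'m \<Rightarrow> real"
    by (simp add: func_plus func_times)
  have mul: "(\<lambda>x. f x * g x) = f * g" for f g :: "'m \<Rightarrow> real" by (simp add: func_times)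
  note rules = der_add der_mult der_const der_smooth X Y smooth_intros
  have out: "der X f = 0" "der Y f = 0" if "f \<notin> SF" for f
    using tangent_outside[OF field_tangent[OF X] that] tangent_outside[OF field_tangent[OF Y] that]
    by (auto simp: der_def zero_fun_def)
  have "lie_bracket X Y p \<in> TS p" for p
    unfolding tangent_space_def mem_Collect_eq ap lin mul
    by (intro conjI allI impI ballI) (simp_all add: rules out der_0 algebra_simps)
  then show ?thesis by (auto simp: vector_fields_def der_lie intro!: smooth_diff der_smooth X Y)
qed

lemma der_lie_bracket: "der (lie_bracket X Y) f = der X (der Y f) - der Y (der X f)"
  by (rule ext) (simp add: lie_bracket_def der_def)

lemma lie_bracket_add_left:
  assumes "X \<in> VF" "X' \<in> VF" "Y \<in> VF"
  shows "lie_bracket (X + X') Y = lie_bracket X Y + lie_bracket X' Y"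
  using assms by (intro vector_field_eqI)
    (auto simp: der_lie_bracket der_field_add der_add der_smooth intro: vector_field_add lie_bracket_field)

lemma lie_bracket_add_right:
  assumes "X \<in> VF" "X' \<in> VF" "Y \<in> VF"
  shows "lie_bracket Y (X + X') = lie_bracket Y X + lie_bracket Y X'"
  using assms by (intro vector_field_eqI)
    (auto simp: der_lie_bracket der_field_add der_add der_smooth intro: vector_field_add lie_bracket_field)

lemma lie_bracket_smul_right:
  assumes "X \<in> VF" "Y \<in> VF" "a \<in> SF"
  shows "lie_bracket X (smul a Y) = smul (der X a) Y + smul a (lie_bracket X Y)"
  using assms by (intro vector_field_eqI)
    (auto simp: der_lie_bracket der_field_add der_mult der_smul der_smooth algebra_simps
      intro: vector_field_add lie_bracket_field vector_field_smul der_smooth)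

lemma lie_bracket_smul_left:
  assumes "X \<in> VF" "Y \<in> VF" "a \<in> SF"
  shows "lie_bracket (smul a X) Y = smul (- der Y a) X + smul a (lie_bracket X Y)"
  using assms by (intro vector_field_eqI)
    (auto simp: der_lie_bracket der_field_add der_mult der_smul der_smooth algebra_simps
      intro: vector_field_add lie_bracket_field vector_field_smul smooth_minus der_smooth)

end

context framed_space
begin

lemma frameE:
  obtains I \<rho> x e where "local_frame A p I \<rho> x e"
  using local_frame_exists by blast

lemma local_frameD:
  assumes "local_frame A p I \<rho> x e"
  shows "finite I" "\<rho> \<in> SF" "\<rho> p = 1" "i \<in> I \<Longrightarrow> x i \<in> SF" "i \<in> I \<Longrightarrow> e i \<in> VF"
    and local_frame_vector: "v \<in> TS q \<Longrightarrow> (\<lambda>f. \<rho> q * v f) = (\<lambda>f. \<Sum>i\<in>I. v (x i) * e i q f)"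
proof -
  show "finite I" "\<rho> \<in> SF" "\<rho> p = 1" "i \<in> I \<Longrightarrow> x i \<in> SF" and e: "\<And>i. i \<in> I \<Longrightarrow> e i \<in> VF"
    using assms by (auto simp: local_frame_def)
  assume v: "v \<in> TS q"
  have "\<rho> q * v f = (\<Sum>i\<in>I. v (x i) * e i q f)" for f
    using assms v tangent_outside[OF v] tangent_outside[OF field_tangent[OF e]]
    by (cases "f \<in> SF") (auto simp: local_frame_def)
  then show "(\<lambda>f. \<rho> q * v f) = (\<lambda>f. \<Sum>i\<in>I. v (x i) * e i q f)" by blast
qed

text \<open>The dual of the expansion of vectors in the frame.\<close>

lemma local_frame_covector:
  assumes F: "local_frame A p I \<rho> x e" and \<xi>: "\<xi> \<in> CS q"
  shows "(\<lambda>v. \<rho> q * \<xi> v) = (\<lambda>v. \<Sum>i\<in>I. \<xi> (e i q) * d (x i) q v)"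
proof
  fix v
  show "\<rho> q * \<xi> v = (\<Sum>i\<in>I. \<xi> (e i q) * d (x i) q v)"
  proof (cases "v \<in> TS q")
    case True
    have "\<rho> q * \<xi> v = \<xi> (\<lambda>f. \<rho> q * v f)" by (simp add: covector_scale[OF \<xi> True])
    also have "\<dots> = (\<Sum>i\<in>I. v (x i) * \<xi> (e i q))"
      unfolding local_frame_vector[OF F True]
      by (rule covector_sum[OF \<xi>]) (rule field_tangent[OF local_frameD(5)[OF F]])
    finally show ?thesis by (simp add: differential_apply[OF True] mult.commute)
  qed (simp add: covector_outside[OF \<xi>] differential_def)
qed

lemma local_frame_field:
  assumes F: "local_frame A p I \<rho> x e" and X: "X \<in> VF"
  shows "smul \<rho> X = (\<Sum>i\<in>I. smul (der X (x i)) (e i))"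
  using local_frame_vector[OF F field_tangent[OF X]]
  by (intro ext) (auto simp: smul_def sum_fun_apply der_def dest: fun_cong)

lemma local_frame_form:
  assumes F: "local_frame A p I \<rho> x e" and \<alpha>: "\<alpha> \<in> OF"
  shows "smul \<rho> \<alpha> = (\<Sum>i\<in>I. smul (pairing \<alpha> (e i)) (d (x i)))"
  using local_frame_covector[OF F form_cotangent[OF \<alpha>]]
  by (intro ext) (auto simp: smul_def sum_fun_apply pairing_def dest: fun_cong)

text \<open>The coefficients in the dual expansion are frozen at \<open>p\<close>, where the bump factor is \<open>1\<close>.\<close>

lemma covector_is_differential:
  assumes "\<xi> \<in> CS p"
  obtains f where "f \<in> SF" "d f p = \<xi>"
proof -
  obtain I \<rho> x e where F: "local_frame A p I \<rho> x e" by (rule frameE)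
  note D = local_frameD[OF F]
  let ?f = "\<Sum>i\<in>I. (\<lambda>q. \<xi> (e i p) * x i q)"
  have "?f \<in> SF" by (intro smooth_sum smooth_scale D)
  moreover have "d ?f p = \<xi>"
  proof (rule differential_eqI[OF _ assms])
    fix v assume v: "v \<in> TS p"
    have "d ?f p v = (\<Sum>i\<in>I. \<xi> (e i p) * d (x i) p v)"
      using v D by (simp add: differential_apply tangent_sum smooth_scale tangent_scale)
    also have "\<dots> = \<xi> v" using fun_cong[OF local_frame_covector[OF F assms], of v] D(3) by simp
    finally show "d ?f p v = \<xi> v" .
  qed
  ultimately show ?thesis using that by blast
qed

lemma tangent_vector_extends:
  assumes "v \<in> TS p"
  obtains X where "X \<in> VF" "X p = v"
proof -
  obtain I \<rho> x e where F: "local_frame A p I \<rho> x e" by (rule frameE)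
  note D = local_frameD[OF F]
  let ?X = "\<Sum>i\<in>I. smul (\<lambda>_. v (x i)) (e i)"
  have "?X \<in> VF" by (intro vector_field_sum vector_field_smul D smooth_const)
  moreover have "?X p = v"
  proof
    fix f
    show "?X p f = v f"
      using fun_cong[OF local_frame_vector[OF F assms], of f] D(3) by (simp add: smul_def sum_fun_apply)
  qed
  ultimately show ?thesis using that by blast
qed

lemma tangent_eqI:
  assumes "v \<in> TS p" "w \<in> TS p" "\<And>\<xi>. \<xi> \<in> CS p \<Longrightarrow> \<xi> v = \<xi> w"
  shows "v = w"
proof
  fix f show "v f = w f"
    using assms(3)[OF differential_cotangent, of f] assms(1,2)
    by (simp add: differential_apply)
qed

lemma one_form_eqI:
  assumes "\<alpha> \<in> OF" "\<beta> \<in> OF" "\<And>X. X \<in> VF \<Longrightarrow> pairing \<alpha> X = pairing \<beta> X"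
  shows "\<alpha> = \<beta>"
proof (intro ext)
  fix p v show "\<alpha> p v = \<beta> p v"
  proof (cases "v \<in> TS p")
    case True
    then obtain X where "X \<in> VF" "X p = v" by (rule tangent_vector_extends)
    then show ?thesis using fun_cong[OF assms(3), of X p] by (simp add: pairing_def)
  qed (simp add: covector_outside[OF form_cotangent[OF assms(1)]] covector_outside[OF form_cotangent[OF assms(2)]])
qed

text \<open>The tangent space has finite dimension because the frame spans it, so it is its own bidual.\<close>

lemma vector_of_spec:
  assumes L: "\<And>\<xi> \<eta> a b. \<xi> \<in> CS p \<Longrightarrow> \<eta> \<in> CS p \<Longrightarrow> L (\<lambda>v. a * \<xi> v + b * \<eta> v) = a * L \<xi> + b * L \<eta>"
  shows "vector_of A p L \<in> TS p" "\<And>\<xi>. \<xi> \<in> CS p \<Longrightarrow> \<xi> (vector_of A p L) = L \<xi>"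
proof -
  obtain I \<rho> x e where F: "local_frame A p I \<rho> x e" by (rule frameE)
  note D = local_frameD[OF F]
  let ?v = "\<lambda>f. \<Sum>i\<in>I. L (d (x i) p) * e i p f"
  have L0: "L (\<lambda>_. 0) = 0" using L[OF cotangent_space_0 cotangent_space_0, of 0 0] by simp
  have Lsum: "L (\<lambda>v. \<Sum>i\<in>J. c i * V i v) = (\<Sum>i\<in>J. c i * L (V i))"
    if "finite J" "\<And>i. i \<in> J \<Longrightarrow> V i \<in> CS p" for J :: "'e set" and c V
    using that
  proof (induction J rule: finite_induct)
    case (insert i J)
    have "L (\<lambda>v. c i * V i v + 1 * (\<Sum>i\<in>J. c i * V i v)) = c i * L (V i) + 1 * L (\<lambda>v. \<Sum>i\<in>J. c i * V i v)"
      by (rule L) (use insert in \<open>auto intro: cotangent_space_sum\<close>)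
    then show ?case using insert by simp
  qed (simp add: L0)
  have v: "?v \<in> TS p" by (rule tangent_space_sum) (rule field_tangent[OF D(5)])
  have ev: "\<xi> ?v = L \<xi>" if \<xi>: "\<xi> \<in> CS p" for \<xi>
  proof -
    have "\<xi> ?v = (\<Sum>i\<in>I. L (d (x i) p) * \<xi> (e i p))"
      by (rule covector_sum[OF \<xi>]) (rule field_tangent[OF D(5)])
    also have "\<dots> = L (\<lambda>v. \<Sum>i\<in>I. \<xi> (e i p) * d (x i) p v)"
      unfolding Lsum[OF D(1) differential_cotangent] by (rule sum.cong[OF refl]) (rule mult.commute)
    also have "\<dots> = L \<xi>" unfolding local_frame_covector[OF F \<xi>, symmetric] D(3) by simp
    finally show ?thesis .
  qed
  have "vector_of A p L = ?v"
    unfolding vector_of_def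
  proof (rule the_equality)
    show "?v \<in> TS p \<and> (\<forall>\<xi>\<in>CS p. \<xi> ?v = L \<xi>)" using v ev by blast
  next
    fix w assume "w \<in> TS p \<and> (\<forall>\<xi>\<in>CS p. \<xi> w = L \<xi>)"
    then show "w = ?v" using v ev by (intro tangent_eqI) auto
  qed
  then show "vector_of A p L \<in> TS p" "\<And>\<xi>. \<xi> \<in> CS p \<Longrightarrow> \<xi> (vector_of A p L) = L \<xi>"
    using v ev by auto
qed

definition tensorial_on :: "('m \<Rightarrow> 'b \<Rightarrow> real) set \<Rightarrow> (('m \<Rightarrow> 'b \<Rightarrow> real) \<Rightarrow> 'm \<Rightarrow> real) \<Rightarrow> bool" where
  "tensorial_on F T \<longleftrightarrow> (\<forall>s\<in>F. \<forall>t\<in>F. T (s + t) = T s + T t) \<and> (\<forall>s\<in>F. \<forall>a\<in>SF. T (smul a s) = a * T s)"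

lemma tensorial_sum:
  assumes T: "tensorial_on F T" and F0: "0 \<in> F" and Fadd: "\<And>s t. s \<in> F \<Longrightarrow> t \<in> F \<Longrightarrow> s + t \<in> F"
    and I: "finite I" "\<And>i. i \<in> I \<Longrightarrow> S i \<in> F"
  shows "T (\<Sum>i\<in>I. S i) = (\<Sum>i\<in>I. T (S i)) \<and> (\<Sum>i\<in>I. S i) \<in> F"
proof -
  have "T 0 = T 0 + T 0" using T F0 unfolding tensorial_on_def by (metis add.right_neutral)
  then have "T 0 = 0" by simp
  with I show ?thesis
    by (induction I rule: finite_induct) (use T F0 Fadd in \<open>auto simp: tensorial_on_def\<close>)
qed

text \<open>The value at \<open>p\<close> is unchanged when the field is multiplied by the bump factor, and then the
  field is a combination of the frame with function coefficients, which can be pulled out.\<close>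

lemma tensorial_fields_pointwise:
  assumes T: "tensorial_on VF T" and X: "X \<in> VF" and Y: "Y \<in> VF" and eq: "X p = Y p"
  shows "T X p = T Y p"
proof -
  obtain I \<rho> x e where F: "local_frame A p I \<rho> x e" by (rule frameE)
  note D = local_frameD[OF F]
  have "T X p = (\<Sum>i\<in>I. X p (x i) * T (e i) p)" if X: "X \<in> VF" for X
  proof -
    have "T X p = T (smul \<rho> X) p" using T X D by (simp add: tensorial_on_def)
    also have "T (smul \<rho> X) = (\<Sum>i\<in>I. T (smul (der X (x i)) (e i)))"
      unfolding local_frame_field[OF F X]
      using tensorial_sum[OF T vector_field_0 vector_field_add D(1)] D X by (simp add: vector_field_smul der_smooth)
    also have "\<dots> = (\<Sum>i\<in>I. der X (x i) * T (e i))"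
      using T D X by (intro sum.cong) (auto simp: tensorial_on_def der_smooth)
    finally show ?thesis by (simp add: sum_fun_apply der_def)
  qed
  then show ?thesis using X Y eq by simp
qed

lemma tensorial_forms_pointwise:
  assumes T: "tensorial_on OF T" and X: "\<alpha> \<in> OF" and Y: "\<beta> \<in> OF" and eq: "\<alpha> p = \<beta> p"
  shows "T \<alpha> p = T \<beta> p"
proof -
  obtain I \<rho> x e where F: "local_frame A p I \<rho> x e" by (rule frameE)
  note D = local_frameD[OF F]
  have "T \<alpha> p = (\<Sum>i\<in>I. \<alpha> p (e i p) * T (d (x i)) p)" if X: "\<alpha> \<in> OF" for \<alpha>
  proof -
    have "T \<alpha> p = T (smul \<rho> \<alpha>) p" using T X D by (simp add: tensorial_on_def)
    also have "T (smul \<rho> \<alpha>) = (\<Sum>i\<in>I. T (smul (pairing \<alpha> (e i)) (d (x i))))"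
      unfolding local_frame_form[OF F X]
      using tensorial_sum[OF T one_form_0 one_form_add D(1)] D X
      by (simp add: one_form_smul pairing_smooth differential_form)
    also have "\<dots> = (\<Sum>i\<in>I. pairing \<alpha> (e i) * T (d (x i)))"
      using T D X by (intro sum.cong) (auto simp: tensorial_on_def pairing_smooth differential_form)
    finally show ?thesis by (simp add: sum_fun_apply pairing_def)
  qed
  then show ?thesis using X Y eq by simp
qed

text \<open>The form of tensoriality in which it is used most: an identity between one-forms that is linear
  over the smooth functions has to be checked on differentials only.\<close>

lemma tensorial_zero_on_exact:
  assumes T: "tensorial_on OF T" and z: "\<And>f. f \<in> SF \<Longrightarrow> T (d f) = 0" and \<alpha>: "\<alpha> \<in> OF"
  shows "T \<alpha> = 0"
proof
  fix p
  obtain f where f: "f \<in> SF" "d f p = \<alpha> p" using covector_is_differential[OF form_cotangent[OF \<alpha>]] by blast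
  then show "T \<alpha> p = 0 p"
    using tensorial_forms_pointwise[OF T \<alpha> differential_form[OF f(1)]] z[OF f(1)] by simp
qed

text \<open>The covector at \<open>p\<close> is evaluated on a tangent vector by extending the latter to a field.\<close>

lemma tensorial_is_form:
  assumes T: "tensorial_on VF T" and S: "\<And>X. X \<in> VF \<Longrightarrow> T X \<in> SF"
  obtains \<beta> where "\<beta> \<in> OF" "\<And>X. X \<in> VF \<Longrightarrow> pairing \<beta> X = T X"
proof -
  define ext where "ext p v = (SOME X. X \<in> VF \<and> X p = v)" for p and v :: "'m tvec"
  have ext: "ext p v \<in> VF" "ext p v p = v" if "v \<in> TS p" for p v
    using someI_ex[of "\<lambda>X. X \<in> VF \<and> X p = v"] tangent_vector_extends[OF that] unfolding ext_def by blast+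
  define \<beta> where "\<beta> p v = (if v \<in> TS p then T (ext p v) p else 0)" for p v
  have eval: "\<beta> p (X p) = T X p" if "X \<in> VF" for X p
    using tensorial_fields_pointwise[OF T ext(1) that ext(2)] that by (simp add: \<beta>_def field_tangent)
  have "\<beta> p \<in> CS p" for p
    unfolding cotangent_space_def mem_Collect_eq
  proof (intro conjI allI impI ballI)
    fix v w a b assume v: "v \<in> TS p" and w: "w \<in> TS p"
    let ?Z = "smul (\<lambda>_. a) (ext p v) + smul (\<lambda>_. b) (ext p w)"
    have Z: "?Z \<in> VF" by (intro vector_field_add vector_field_smul ext v w smooth_const)
    have "?Z p = (\<lambda>f. a * v f + b * w f)" using ext(2)[OF v] ext(2)[OF w] by (auto simp: smul_def)
    then have "\<beta> p (\<lambda>f. a * v f + b * w f) = T ?Z p" using eval[OF Z, of p] by simp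
    also have "\<dots> = a * T (ext p v) p + b * T (ext p w) p"
      using T ext(1)[OF v] ext(1)[OF w] by (simp add: tensorial_on_def vector_field_smul smooth_const)
    finally show "\<beta> p (\<lambda>f. a * v f + b * w f) = a * \<beta> p v + b * \<beta> p w" using v w by (simp add: \<beta>_def)
  qed (simp add: \<beta>_def)
  moreover have "pairing \<beta> X = T X" if "X \<in> VF" for X
    using eval[OF that] by (auto simp: pairing_def)
  ultimately show ?thesis using that S by (metis one_formI)
qed

text \<open>The definite description in the definition of the Lie derivative is justified by the
  tensoriality of its defining formula in \<open>Y\<close>.\<close>

lemma lie_form_spec:
  assumes X: "X \<in> VF" and \<alpha>: "\<alpha> \<in> OF"
  shows lie_form_form: "lie_form A X \<alpha> \<in> OF"
    and pairing_lie_form: "Y \<in> VF \<Longrightarrow>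
      pairing (lie_form A X \<alpha>) Y = der X (pairing \<alpha> Y) - pairing \<alpha> (lie_bracket X Y)"
proof -
  let ?T = "\<lambda>Y. der X (pairing \<alpha> Y) - pairing \<alpha> (lie_bracket X Y)"
  have T: "tensorial_on VF ?T"
    unfolding tensorial_on_def using X \<alpha>
    by (auto simp: pairing_field_add pairing_field_smul lie_bracket_add_right lie_bracket_smul_right
        der_add der_mult pairing_smooth lie_bracket_field vector_field_smul der_smooth algebra_simps)
  have S: "?T Y \<in> SF" if "Y \<in> VF" for Y
    using that X \<alpha> by (intro smooth_diff der_smooth pairing_smooth lie_bracket_field)
  obtain \<beta> where \<beta>: "\<beta> \<in> OF" "\<And>Y. Y \<in> VF \<Longrightarrow> pairing \<beta> Y = ?T Y"
    using tensorial_is_form[OF T S] by blast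
  have "lie_form A X \<alpha> = \<beta>"
    unfolding lie_form_def
  proof (rule the_equality)
    show "\<beta> \<in> OF \<and> (\<forall>Y\<in>VF. \<forall>p. \<beta> p (Y p) = X p (\<lambda>q. \<alpha> q (Y q)) - \<alpha> p (lie_bracket X Y p))"
      using \<beta>(1) fun_cong[OF \<beta>(2)] by (simp add: pairing_def der_def)
  next
    fix \<gamma> assume \<gamma>: "\<gamma> \<in> OF \<and> (\<forall>Y\<in>VF. \<forall>p. \<gamma> p (Y p) = X p (\<lambda>q. \<alpha> q (Y q)) - \<alpha> p (lie_bracket X Y p))"
    then have "pairing \<gamma> Y = pairing \<beta> Y" if "Y \<in> VF" for Y
      unfolding \<beta>(2)[OF that] using that by (auto simp: pairing_def der_def fun_eq_iff)
    then show "\<gamma> = \<beta>" using \<gamma> \<beta>(1) by (blast intro: one_form_eqI)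
  qed
  then show "lie_form A X \<alpha> \<in> OF" "Y \<in> VF \<Longrightarrow>
      pairing (lie_form A X \<alpha>) Y = der X (pairing \<alpha> Y) - pairing \<alpha> (lie_bracket X Y)"
    using \<beta> by auto
qed

lemma lie_form_add:
  assumes "X \<in> VF" "\<alpha> \<in> OF" "\<beta> \<in> OF"
  shows "lie_form A X (\<alpha> + \<beta>) = lie_form A X \<alpha> + lie_form A X \<beta>"
  using assms by (intro one_form_eqI)
    (auto simp: one_form_add one_form_smul lie_form_form vector_field_add vector_field_smul differential_form pairing_lie_form pairing_add der_add pairing_smooth algebra_simps intro: lie_form_form one_form_add)

lemma lie_form_smul:
  assumes "X \<in> VF" "\<alpha> \<in> OF" "a \<in> SF"
  shows "lie_form A X (smul a \<alpha>) = smul (der X a) \<alpha> + smul a (lie_form A X \<alpha>)"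
  using assms by (intro one_form_eqI)
    (auto simp: one_form_add one_form_smul lie_form_form vector_field_add vector_field_smul differential_form pairing_lie_form pairing_add pairing_smul der_mult pairing_smooth algebra_simps
      intro: lie_form_form one_form_add one_form_smul der_smooth)

lemma lie_form_differential:
  assumes "X \<in> VF" "f \<in> SF"
  shows "lie_form A X (d f) = d (der X f)"
  using assms by (intro one_form_eqI)
    (auto simp: one_form_add one_form_smul lie_form_form vector_field_add vector_field_smul differential_form pairing_lie_form pairing_differential der_lie_bracket lie_bracket_field differential_form
      intro: lie_form_form differential_form der_smooth)

lemma lie_form_field_add:
  assumes "X \<in> VF" "Y \<in> VF" "\<alpha> \<in> OF"
  shows "lie_form A (X + Y) \<alpha> = lie_form A X \<alpha> + lie_form A Y \<alpha>"
  using assms by (intro one_form_eqI)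
    (auto simp: one_form_add one_form_smul lie_form_form vector_field_add vector_field_smul differential_form pairing_lie_form pairing_add pairing_field_add der_field_add lie_bracket_add_left
      lie_bracket_field vector_field_add algebra_simps intro: lie_form_form one_form_add)

lemma lie_form_field_smul:
  assumes "X \<in> VF" "\<alpha> \<in> OF" "a \<in> SF"
  shows "lie_form A (smul a X) \<alpha> = smul a (lie_form A X \<alpha>) + smul (pairing \<alpha> X) (d a)"
  using assms by (intro one_form_eqI)
    (auto simp: one_form_add one_form_smul lie_form_form vector_field_add vector_field_smul differential_form pairing_lie_form pairing_add pairing_smul pairing_field_add pairing_field_smul der_smul
      lie_bracket_smul_left pairing_differential smooth_minus der_smooth
      lie_bracket_field vector_field_smul algebra_simps
      intro: lie_form_form one_form_add one_form_smul pairing_smooth differential_form)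

end

section \<open>Multivector fields\<close>

context smooth_algebra
begin

lemma multivectorsD:
  assumes "D \<in> multivectors A k p"
  shows multivectors_outside: "\<not> (length \<xi>s = k \<and> set \<xi>s \<subseteq> CS p) \<Longrightarrow> D \<xi>s = 0"
    and multivectors_linear: "length \<xi>s = k \<Longrightarrow> set \<xi>s \<subseteq> CS p \<Longrightarrow> i < k \<Longrightarrow> \<eta> \<in> CS p \<Longrightarrow> \<zeta> \<in> CS p \<Longrightarrow>
      D (\<xi>s[i := (\<lambda>v. a * \<eta> v + b * \<zeta> v)]) = a * D (\<xi>s[i := \<eta>]) + b * D (\<xi>s[i := \<zeta>])"
    and multivectors_alternating: "length \<xi>s = k \<Longrightarrow> set \<xi>s \<subseteq> CS p \<Longrightarrow> i < k \<Longrightarrow> j < k \<Longrightarrow> i \<noteq> j \<Longrightarrow>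
      \<xi>s ! i = \<xi>s ! j \<Longrightarrow> D \<xi>s = 0"
  using assms unfolding multivectors_def by blast+

text \<open>Polarisation: the form vanishes when both slots are filled with the sum of the two entries.\<close>

lemma multivectors_swap:
  assumes D: "D \<in> multivectors A k p" and \<xi>s: "length \<xi>s = k" "set \<xi>s \<subseteq> CS p" and ij: "i < k" "j < k" "i \<noteq> j"
  shows "D (\<xi>s[i := \<xi>s ! j, j := \<xi>s ! i]) = - D \<xi>s"
proof -
  let ?x = "\<xi>s ! i" and ?y = "\<xi>s ! j"
  \<comment> \<open>The factors \<open>1\<close> keep the sum in the shape required by multilinearity.\<close>
  let ?s = "\<lambda>v. 1 * ?x v + 1 * ?y v"
  have x: "?x \<in> CS p" and y: "?y \<in> CS p" using \<xi>s ij by (auto intro: nth_mem subsetD)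
  have s: "?s \<in> CS p" by (rule cotangent_space_lincomb[OF x y])
  have sub: "set (\<xi>s[i := u]) \<subseteq> CS p" "set (\<xi>s[i := u, j := w]) \<subseteq> CS p" if "u \<in> CS p" "w \<in> CS p" for u w
    using \<xi>s(2) that by (auto dest!: set_update_subset_insert[THEN subsetD])
  have e: "D (\<xi>s[i := u, j := ?s]) = D (\<xi>s[i := u, j := ?x]) + D (\<xi>s[i := u, j := ?y])" if "u \<in> CS p" for u
    using multivectors_linear[OF D, of "\<xi>s[i := u]" j ?x ?y 1 1] \<xi>s ij x y sub that by simp
  have e': "D (\<xi>s[i := ?s, j := u]) = D (\<xi>s[i := ?x, j := u]) + D (\<xi>s[i := ?y, j := u])" if "u \<in> CS p" for u
  proof -
    have "D (\<xi>s[j := u, i := ?s]) = 1 * D (\<xi>s[j := u, i := ?x]) + 1 * D (\<xi>s[j := u, i := ?y])"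
      by (rule multivectors_linear[OF D]) (use \<xi>s ij x y that in \<open>simp_all add: set_update_subsetI\<close>)
    then show ?thesis by (simp only: list_update_swap[OF ij(3)] mult_1)
  qed
  have z: "D (\<xi>s[i := u, j := u]) = 0" if "u \<in> CS p" for u
    by (rule multivectors_alternating[OF D, of _ i j]) (use \<xi>s ij sub that in auto)
  have "\<xi>s[i := ?x, j := ?y] = \<xi>s" by simp
  then show ?thesis using e[OF s] e'[OF x] e'[OF y] z[OF s] z[OF x] z[OF y] by simp
qed

lemma multivector_swap2:
  assumes "D \<in> multivectors A 2 p" "\<xi> \<in> CS p" "\<eta> \<in> CS p"
  shows "D [\<eta>, \<xi>] = - D [\<xi>, \<eta>]"
  using multivectors_swap[OF assms(1), of "[\<xi>, \<eta>]" 0 1] assms by simp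

lemma multivector_swap3:
  assumes "D \<in> multivectors A 3 p" "\<xi> \<in> CS p" "\<eta> \<in> CS p" "\<zeta> \<in> CS p"
  shows "D [\<eta>, \<xi>, \<zeta>] = - D [\<xi>, \<eta>, \<zeta>]" "D [\<xi>, \<zeta>, \<eta>] = - D [\<xi>, \<eta>, \<zeta>]"
    "D [\<zeta>, \<eta>, \<xi>] = - D [\<xi>, \<eta>, \<zeta>]"
  using multivectors_swap[OF assms(1), of "[\<xi>, \<eta>, \<zeta>]" 0 1]
    multivectors_swap[OF assms(1), of "[\<xi>, \<eta>, \<zeta>]" 1 2]
    multivectors_swap[OF assms(1), of "[\<xi>, \<eta>, \<zeta>]" 0 2] assms
  by (simp_all add: numeral_2_eq_2)

lemma multivector_linear2:
  assumes "D \<in> multivectors A 2 p" "\<xi> \<in> CS p" "\<eta> \<in> CS p" "\<zeta> \<in> CS p"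
  shows "D [\<lambda>v. a * \<eta> v + b * \<zeta> v, \<xi>] = a * D [\<eta>, \<xi>] + b * D [\<zeta>, \<xi>]"
    "D [\<xi>, \<lambda>v. a * \<eta> v + b * \<zeta> v] = a * D [\<xi>, \<eta>] + b * D [\<xi>, \<zeta>]"
  using multivectors_linear[OF assms(1), of "[\<xi>, \<xi>]" 0 \<eta> \<zeta> a b]
    multivectors_linear[OF assms(1), of "[\<xi>, \<xi>]" 1 \<eta> \<zeta> a b] assms by simp_all

lemma multivector_linear3:
  assumes "D \<in> multivectors A 3 p" "\<xi> \<in> CS p" "\<xi>' \<in> CS p" "\<eta> \<in> CS p" "\<zeta> \<in> CS p"
  shows "D [\<lambda>v. a * \<eta> v + b * \<zeta> v, \<xi>, \<xi>'] = a * D [\<eta>, \<xi>, \<xi>'] + b * D [\<zeta>, \<xi>, \<xi>']"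
    "D [\<xi>, \<lambda>v. a * \<eta> v + b * \<zeta> v, \<xi>'] = a * D [\<xi>, \<eta>, \<xi>'] + b * D [\<xi>, \<zeta>, \<xi>']"
    "D [\<xi>, \<xi>', \<lambda>v. a * \<eta> v + b * \<zeta> v] = a * D [\<xi>, \<xi>', \<eta>] + b * D [\<xi>, \<xi>', \<zeta>]"
  using multivectors_linear[OF assms(1), of "[\<xi>, \<xi>, \<xi>']" 0 \<eta> \<zeta> a b]
    multivectors_linear[OF assms(1), of "[\<xi>, \<xi>, \<xi>']" 1 \<eta> \<zeta> a b]
    multivectors_linear[OF assms(1), of "[\<xi>, \<xi>', \<xi>']" 2 \<eta> \<zeta> a b] assms
  by (simp_all add: numeral_2_eq_2)

lemma multivectors2I:
  assumes out: "\<And>\<xi>s. \<not> (length \<xi>s = 2 \<and> set \<xi>s \<subseteq> CS p) \<Longrightarrow> D \<xi>s = 0"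
    and lin: "\<And>\<eta> \<zeta> \<xi> a b. \<eta> \<in> CS p \<Longrightarrow> \<zeta> \<in> CS p \<Longrightarrow> \<xi> \<in> CS p \<Longrightarrow>
       D [\<lambda>v. a * \<eta> v + b * \<zeta> v, \<xi>] = a * D [\<eta>, \<xi>] + b * D [\<zeta>, \<xi>]"
    and swap: "\<And>\<xi> \<eta>. \<xi> \<in> CS p \<Longrightarrow> \<eta> \<in> CS p \<Longrightarrow> D [\<eta>, \<xi>] = - D [\<xi>, \<eta>]"
  shows "D \<in> multivectors A 2 p"
proof -
  have lin': "D [\<xi>, \<lambda>v. a * \<eta> v + b * \<zeta> v] = a * D [\<xi>, \<eta>] + b * D [\<xi>, \<zeta>]"
    if "\<eta> \<in> CS p" "\<zeta> \<in> CS p" "\<xi> \<in> CS p" for \<eta> \<zeta> \<xi> a b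
    using lin[OF that, of a b]
    unfolding swap[OF that(3,1)] swap[OF that(3,2)] swap[OF that(3) cotangent_space_lincomb[OF that(1,2)]]
      mult_minus_right by linarith
  have z: "D [\<xi>, \<xi>] = 0" if "\<xi> \<in> CS p" for \<xi> using swap[OF that that] by simp
  show ?thesis
    unfolding multivectors_def mem_Collect_eq
  proof (intro conjI allI impI ballI; (elim conjE)?)
    fix \<xi>s i \<eta> \<zeta> a b assume "length \<xi>s = 2" "set \<xi>s \<subseteq> CS p" and i: "i < (2::nat)" and *: "\<eta> \<in> CS p" "\<zeta> \<in> CS p"
    then obtain x y where "\<xi>s = [x, y]" "x \<in> CS p" "y \<in> CS p" by (auto simp: numeral_2_eq_2 length_Suc_conv)
    moreover have "i = 0 \<or> i = 1" using i by auto
    ultimately show "D (\<xi>s[i := \<lambda>v. a * \<eta> v + b * \<zeta> v]) = a * D (\<xi>s[i := \<eta>]) + b * D (\<xi>s[i := \<zeta>])"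
      using * by (auto simp: lin lin')
  next
    fix \<xi>s i j assume "length \<xi>s = 2" "set \<xi>s \<subseteq> CS p" and i: "i < (2::nat)" "j < (2::nat)" "i \<noteq> j" and *: "\<xi>s ! i = \<xi>s ! j"
    then obtain x y where "\<xi>s = [x, y]" "x \<in> CS p" "y \<in> CS p" by (auto simp: numeral_2_eq_2 length_Suc_conv)
    moreover have "i = 0 \<and> j = 1 \<or> i = 1 \<and> j = 0" using i by auto
    ultimately show "D \<xi>s = 0" using * z by auto
  qed (rule out, blast)
qed

lemma multivectors3I:
  assumes out: "\<And>\<xi>s. \<not> (length \<xi>s = 3 \<and> set \<xi>s \<subseteq> CS p) \<Longrightarrow> D \<xi>s = 0"
    and lin: "\<And>\<eta> \<zeta> \<xi> \<xi>' a b. \<eta> \<in> CS p \<Longrightarrow> \<zeta> \<in> CS p \<Longrightarrow> \<xi> \<in> CS p \<Longrightarrow> \<xi>' \<in> CS p \<Longrightarrow>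
       D [\<lambda>v. a * \<eta> v + b * \<zeta> v, \<xi>, \<xi>'] = a * D [\<eta>, \<xi>, \<xi>'] + b * D [\<zeta>, \<xi>, \<xi>']"
    and swap: "\<And>\<xi> \<eta> \<zeta>. \<xi> \<in> CS p \<Longrightarrow> \<eta> \<in> CS p \<Longrightarrow> \<zeta> \<in> CS p \<Longrightarrow> D [\<eta>, \<xi>, \<zeta>] = - D [\<xi>, \<eta>, \<zeta>]"
     "\<And>\<xi> \<eta> \<zeta>. \<xi> \<in> CS p \<Longrightarrow> \<eta> \<in> CS p \<Longrightarrow> \<zeta> \<in> CS p \<Longrightarrow> D [\<xi>, \<zeta>, \<eta>] = - D [\<xi>, \<eta>, \<zeta>]"
  shows "D \<in> multivectors A 3 p"
proof -
  have lin2: "D [\<xi>, \<lambda>v. a * \<eta> v + b * \<zeta> v, \<xi>'] = a * D [\<xi>, \<eta>, \<xi>'] + b * D [\<xi>, \<zeta>, \<xi>']"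
    if "\<eta> \<in> CS p" "\<zeta> \<in> CS p" "\<xi> \<in> CS p" "\<xi>' \<in> CS p" for \<eta> \<zeta> \<xi> \<xi>' a b
    using lin[OF that, of a b] unfolding swap(1)[OF that(3,1,4)] swap(1)[OF that(3,2,4)]
      swap(1)[OF that(3) cotangent_space_lincomb[OF that(1,2)] that(4)] mult_minus_right by linarith
  have lin3: "D [\<xi>, \<xi>', \<lambda>v. a * \<eta> v + b * \<zeta> v] = a * D [\<xi>, \<xi>', \<eta>] + b * D [\<xi>, \<xi>', \<zeta>]"
    if "\<eta> \<in> CS p" "\<zeta> \<in> CS p" "\<xi> \<in> CS p" "\<xi>' \<in> CS p" for \<eta> \<zeta> \<xi> \<xi>' a b
    using lin2[OF that, of a b] unfolding swap(2)[OF that(3,4,1)] swap(2)[OF that(3,4,2)]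
      swap(2)[OF that(3,4) cotangent_space_lincomb[OF that(1,2)]] mult_minus_right by linarith
  have z: "D [\<xi>, \<xi>, \<eta>] = 0" "D [\<eta>, \<xi>, \<xi>] = 0" "D [\<xi>, \<eta>, \<xi>] = 0" if "\<xi> \<in> CS p" "\<eta> \<in> CS p" for \<xi> \<eta>
    using swap(1)[OF that(1,1,2)] swap(2)[OF that(2,1,1)] swap(2)[OF that(1,1,2)] by simp_all
  show ?thesis
    unfolding multivectors_def mem_Collect_eq
  proof (intro conjI allI impI ballI; (elim conjE)?)
    fix \<xi>s i \<eta> \<zeta> a b assume "length \<xi>s = 3" "set \<xi>s \<subseteq> CS p" and i: "i < (3::nat)" and *: "\<eta> \<in> CS p" "\<zeta> \<in> CS p"
    then obtain x y z where "\<xi>s = [x, y, z]" "x \<in> CS p" "y \<in> CS p" "z \<in> CS p"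
      by (auto simp: numeral_3_eq_3 length_Suc_conv)
    moreover have "i = 0 \<or> i = 1 \<or> i = 2" using i by auto
    ultimately show "D (\<xi>s[i := \<lambda>v. a * \<eta> v + b * \<zeta> v]) = a * D (\<xi>s[i := \<eta>]) + b * D (\<xi>s[i := \<zeta>])"
      using * by (auto simp: lin lin2 lin3 numeral_2_eq_2)
  next
    fix \<xi>s i j assume "length \<xi>s = 3" "set \<xi>s \<subseteq> CS p" and i: "i < (3::nat)" "j < (3::nat)" "i \<noteq> j" and *: "\<xi>s ! i = \<xi>s ! j"
    then obtain x y z where "\<xi>s = [x, y, z]" "x \<in> CS p" "y \<in> CS p" "z \<in> CS p"
      by (auto simp: numeral_3_eq_3 length_Suc_conv)
    moreover have "i = 0 \<or> i = 1 \<or> i = 2" "j = 0 \<or> j = 1 \<or> j = 2" using i by auto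
    ultimately show "D \<xi>s = 0" using * z i by (elim disjE) (auto simp: numeral_2_eq_2)
  qed (rule out, blast)
qed

lemma multivector_fieldD:
  assumes "D \<in> MV k"
  shows multivector_field_at: "D p \<in> multivectors A k p"
    and mv_eval_smooth: "length \<alpha>s = k \<Longrightarrow> set \<alpha>s \<subseteq> OF \<Longrightarrow> mv_eval D \<alpha>s \<in> SF"
  using assms by (auto simp: multivector_fields_def)

lemma mv_eval2_smooth: "D \<in> MV 2 \<Longrightarrow> \<alpha> \<in> OF \<Longrightarrow> \<beta> \<in> OF \<Longrightarrow> mv_eval D [\<alpha>, \<beta>] \<in> SF"
  by (rule mv_eval_smooth[where k=2]) auto

lemma mv_eval3_smooth:
  "D \<in> MV 3 \<Longrightarrow> \<alpha> \<in> OF \<Longrightarrow> \<beta> \<in> OF \<Longrightarrow> \<gamma> \<in> OF \<Longrightarrow> mv_eval D [\<alpha>, \<beta>, \<gamma>] \<in> SF"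
  by (rule mv_eval_smooth[where k=3]) auto

lemma mv_eval2_swap:
  assumes "D \<in> MV 2" "\<alpha> \<in> OF" "\<beta> \<in> OF"
  shows "mv_eval D [\<beta>, \<alpha>] = - mv_eval D [\<alpha>, \<beta>]"
  using multivector_swap2[OF multivector_field_at[OF assms(1)] form_cotangent[OF assms(2)] form_cotangent[OF assms(3)]]
  by (auto simp: mv_eval_def)

lemma mv_eval3_swap:
  assumes "D \<in> MV 3" "\<alpha> \<in> OF" "\<beta> \<in> OF" "\<gamma> \<in> OF"
  shows "mv_eval D [\<beta>, \<alpha>, \<gamma>] = - mv_eval D [\<alpha>, \<beta>, \<gamma>]"
    "mv_eval D [\<alpha>, \<gamma>, \<beta>] = - mv_eval D [\<alpha>, \<beta>, \<gamma>]"
    "mv_eval D [\<gamma>, \<beta>, \<alpha>] = - mv_eval D [\<alpha>, \<beta>, \<gamma>]"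
  using multivector_swap3[OF multivector_field_at[OF assms(1)] form_cotangent[OF assms(2)]
      form_cotangent[OF assms(3)] form_cotangent[OF assms(4)]]
  by (auto simp: mv_eval_def)

lemma mv_eval2_add:
  assumes D: "D \<in> MV 2" and \<alpha>: "\<alpha> \<in> OF" and \<beta>: "\<beta> \<in> OF" and \<gamma>: "\<gamma> \<in> OF"
  shows "mv_eval D [\<alpha> + \<beta>, \<gamma>] = mv_eval D [\<alpha>, \<gamma>] + mv_eval D [\<beta>, \<gamma>]"
    "mv_eval D [\<gamma>, \<alpha> + \<beta>] = mv_eval D [\<gamma>, \<alpha>] + mv_eval D [\<gamma>, \<beta>]"
  using multivector_linear2[OF multivector_field_at[OF D] form_cotangent[OF \<gamma>] form_cotangent[OF \<alpha>] form_cotangent[OF \<beta>], where a=1 and b=1]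
  by (auto simp: mv_eval_def func_plus)

lemma mv_eval2_smul:
  assumes D: "D \<in> MV 2" and \<alpha>: "\<alpha> \<in> OF" and \<gamma>: "\<gamma> \<in> OF"
  shows "mv_eval D [smul a \<alpha>, \<gamma>] = a * mv_eval D [\<alpha>, \<gamma>]"
    "mv_eval D [\<gamma>, smul a \<alpha>] = a * mv_eval D [\<gamma>, \<alpha>]"
  using multivector_linear2[OF multivector_field_at[OF D] form_cotangent[OF \<gamma>] form_cotangent[OF \<alpha>] form_cotangent[OF \<alpha>], where a="a p" and b=0 for p]
  by (auto simp: mv_eval_def func_times smul_def)

lemma mv_eval3_add:
  assumes D: "D \<in> MV 3" and \<alpha>: "\<alpha> \<in> OF" and \<beta>: "\<beta> \<in> OF" and \<gamma>: "\<gamma> \<in> OF" and \<delta>: "\<delta> \<in> OF"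
  shows "mv_eval D [\<alpha> + \<beta>, \<gamma>, \<delta>] = mv_eval D [\<alpha>, \<gamma>, \<delta>] + mv_eval D [\<beta>, \<gamma>, \<delta>]"
    "mv_eval D [\<gamma>, \<alpha> + \<beta>, \<delta>] = mv_eval D [\<gamma>, \<alpha>, \<delta>] + mv_eval D [\<gamma>, \<beta>, \<delta>]"
    "mv_eval D [\<gamma>, \<delta>, \<alpha> + \<beta>] = mv_eval D [\<gamma>, \<delta>, \<alpha>] + mv_eval D [\<gamma>, \<delta>, \<beta>]"
  using multivector_linear3[OF multivector_field_at[OF D] form_cotangent[OF \<gamma>] form_cotangent[OF \<delta>] form_cotangent[OF \<alpha>] form_cotangent[OF \<beta>], where a=1 and b=1]
  by (auto simp: mv_eval_def func_plus)

lemma mv_eval3_smul: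
  assumes D: "D \<in> MV 3" and \<alpha>: "\<alpha> \<in> OF" and \<gamma>: "\<gamma> \<in> OF" and \<delta>: "\<delta> \<in> OF"
  shows "mv_eval D [smul a \<alpha>, \<gamma>, \<delta>] = a * mv_eval D [\<alpha>, \<gamma>, \<delta>]"
    "mv_eval D [\<gamma>, smul a \<alpha>, \<delta>] = a * mv_eval D [\<gamma>, \<alpha>, \<delta>]"
    "mv_eval D [\<gamma>, \<delta>, smul a \<alpha>] = a * mv_eval D [\<gamma>, \<delta>, \<alpha>]"
  using multivector_linear3[OF multivector_field_at[OF D] form_cotangent[OF \<gamma>] form_cotangent[OF \<delta>] form_cotangent[OF \<alpha>] form_cotangent[OF \<alpha>], where a="a p" and b=0 for p]
  by (auto simp: mv_eval_def func_times smul_def)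

lemma smul_minus_one: "smul (\<lambda>_. -1) \<alpha> = - \<alpha>"
  by (intro ext) (simp add: smul_def)

lemma one_form_minus: "\<alpha> \<in> OF \<Longrightarrow> - \<alpha> \<in> OF"
  using one_form_smul[OF _ smooth_const[of "-1"], of \<alpha>] by (simp add: smul_minus_one)

lemma mv_eval2_minus:
  assumes D: "D \<in> MV 2" and \<alpha>: "\<alpha> \<in> OF" and \<gamma>: "\<gamma> \<in> OF"
  shows "mv_eval D [- \<alpha>, \<gamma>] = - mv_eval D [\<alpha>, \<gamma>]" "mv_eval D [\<gamma>, - \<alpha>] = - mv_eval D [\<gamma>, \<alpha>]"
  using mv_eval2_smul[OF D \<alpha> \<gamma>, of "\<lambda>_. -1"] by (auto simp: smul_minus_one func_times)

lemma mv_eval3_minus: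
  assumes D: "D \<in> MV 3" and \<alpha>: "\<alpha> \<in> OF" and \<gamma>: "\<gamma> \<in> OF" and \<delta>: "\<delta> \<in> OF"
  shows "mv_eval D [- \<alpha>, \<gamma>, \<delta>] = - mv_eval D [\<alpha>, \<gamma>, \<delta>]" "mv_eval D [\<gamma>, - \<alpha>, \<delta>] = - mv_eval D [\<gamma>, \<alpha>, \<delta>]"
    "mv_eval D [\<gamma>, \<delta>, - \<alpha>] = - mv_eval D [\<gamma>, \<delta>, \<alpha>]"
  using mv_eval3_smul[OF D \<alpha> \<gamma> \<delta>, of "\<lambda>_. -1"] by (auto simp: smul_minus_one func_times)

lemma mv_eval3_diff:
  assumes D: "D \<in> MV 3" and \<alpha>: "\<alpha> \<in> OF" and \<beta>: "\<beta> \<in> OF" and \<gamma>: "\<gamma> \<in> OF" and \<delta>: "\<delta> \<in> OF"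
  shows "mv_eval D [\<alpha> - \<beta>, \<gamma>, \<delta>] = mv_eval D [\<alpha>, \<gamma>, \<delta>] - mv_eval D [\<beta>, \<gamma>, \<delta>]"
    "mv_eval D [\<gamma>, \<alpha> - \<beta>, \<delta>] = mv_eval D [\<gamma>, \<alpha>, \<delta>] - mv_eval D [\<gamma>, \<beta>, \<delta>]"
    "mv_eval D [\<gamma>, \<delta>, \<alpha> - \<beta>] = mv_eval D [\<gamma>, \<delta>, \<alpha>] - mv_eval D [\<gamma>, \<delta>, \<beta>]"
  using mv_eval3_add[OF D \<alpha> one_form_minus[OF \<beta>] \<gamma> \<delta>] mv_eval3_minus[OF D \<beta> \<gamma> \<delta>] by simp_all

text \<open>The convention of the interior product: \<open>\<alpha>\<close> fills the first slot.\<close>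

definition iota :: "('m \<Rightarrow> 'm covec) \<Rightarrow> ('m \<Rightarrow> 'm mvec) \<Rightarrow> 'm \<Rightarrow> 'm mvec" where
  "iota \<alpha> E = (\<lambda>p \<xi>s. E p (\<alpha> p # \<xi>s))"

lemma mv_eval_iota: "mv_eval (iota \<alpha> E) \<alpha>s = mv_eval E (\<alpha> # \<alpha>s)"
  by (simp add: mv_eval_def iota_def)

lemma iota_field:
  assumes E: "E \<in> MV (Suc k)" and \<alpha>: "\<alpha> \<in> OF"
  shows "iota \<alpha> E \<in> MV k"
proof -
  note M = multivector_field_at[OF E]
  have "iota \<alpha> E p \<in> multivectors A k p" for p
    unfolding multivectors_def mem_Collect_eq iota_def
  proof (intro conjI allI impI ballI; (elim conjE)?)
    fix \<xi>s assume "\<not> (length \<xi>s = k \<and> set \<xi>s \<subseteq> CS p)"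
    then show "E p (\<alpha> p # \<xi>s) = 0" by (intro multivectors_outside[OF M]) auto
  next
    fix \<xi>s i \<eta> \<zeta> a b assume *: "length \<xi>s = k" "set \<xi>s \<subseteq> CS p" "i < k" "\<eta> \<in> CS p" "\<zeta> \<in> CS p"
    then show "E p (\<alpha> p # \<xi>s[i := \<lambda>v. a * \<eta> v + b * \<zeta> v]) = a * E p (\<alpha> p # \<xi>s[i := \<eta>]) + b * E p (\<alpha> p # \<xi>s[i := \<zeta>])"
      using multivectors_linear[OF M, of "\<alpha> p # \<xi>s" p "Suc i" \<eta> \<zeta> a b] form_cotangent[OF \<alpha>] by simp
  next
    fix \<xi>s i j assume "length \<xi>s = k" "set \<xi>s \<subseteq> CS p" "i < k" "j < k" "i \<noteq> j" "\<xi>s ! i = \<xi>s ! j"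
    then show "E p (\<alpha> p # \<xi>s) = 0"
      using multivectors_alternating[OF M, of "\<alpha> p # \<xi>s" p "Suc i" "Suc j"] form_cotangent[OF \<alpha>] by simp
  qed
  moreover have "mv_eval (iota \<alpha> E) \<alpha>s \<in> SF" if "length \<alpha>s = k" "set \<alpha>s \<subseteq> OF" for \<alpha>s
    unfolding mv_eval_iota by (rule mv_eval_smooth[OF E]) (use that \<alpha> in auto)
  ultimately show ?thesis by (simp add: multivector_fields_def)
qed

lemma mv_fun_field: "f \<in> SF \<Longrightarrow> mv_fun f \<in> MV 0"
  by (auto simp: multivector_fields_def multivectors_def mv_fun_def mv_eval_def)

lemma mv_eval_vec: "\<alpha> \<in> OF \<Longrightarrow> mv_eval (mv_vec A X) [\<alpha>] = pairing \<alpha> X"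
  by (auto simp: mv_eval_def mv_vec_def pairing_def form_cotangent)

lemma mv_vec_field:
  assumes X: "X \<in> VF" shows "mv_vec A X \<in> MV 1"
proof -
  have "mv_vec A X p \<in> multivectors A 1 p" for p
    unfolding multivectors_def mem_Collect_eq
  proof (intro conjI allI impI ballI; (elim conjE)?)
    fix \<xi>s assume "\<not> (length \<xi>s = 1 \<and> set \<xi>s \<subseteq> CS p)"
    then show "mv_vec A X p \<xi>s = 0" by (auto simp: mv_vec_def split: list.split)
  next
    fix \<xi>s i \<eta> \<zeta> a b assume "length \<xi>s = 1" "set \<xi>s \<subseteq> CS p" "i < (1::nat)" and *: "\<eta> \<in> CS p" "\<zeta> \<in> CS p"
    then obtain \<xi> where "\<xi>s = [\<xi>]" "i = 0" by (auto simp: length_Suc_conv)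
    then show "mv_vec A X p (\<xi>s[i := \<lambda>v. a * \<eta> v + b * \<zeta> v]) =
        a * mv_vec A X p (\<xi>s[i := \<eta>]) + b * mv_vec A X p (\<xi>s[i := \<zeta>])"
      using * by (simp add: mv_vec_def cotangent_space_lincomb)
  qed auto
  moreover have "mv_eval (mv_vec A X) \<alpha>s \<in> SF" if "length \<alpha>s = 1" "set \<alpha>s \<subseteq> OF" for \<alpha>s
    using that X by (auto simp: length_Suc_conv mv_eval_vec pairing_smooth)
  ultimately show ?thesis by (simp add: multivector_fields_def)
qed

end

context framed_space
begin

lemma multivector_field_eqI:
  assumes D: "D \<in> MV k" and E: "E \<in> MV k"
    and eq: "\<And>\<alpha>s. length \<alpha>s = k \<Longrightarrow> set \<alpha>s \<subseteq> OF \<Longrightarrow> mv_eval D \<alpha>s = mv_eval E \<alpha>s"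
  shows "D = E"
proof (intro ext)
  fix p \<xi>s
  show "D p \<xi>s = E p \<xi>s"
  proof (cases "length \<xi>s = k \<and> set \<xi>s \<subseteq> CS p")
    case True
    have "\<exists>\<alpha>s. set \<alpha>s \<subseteq> OF \<and> map (\<lambda>\<alpha>. \<alpha> p) \<alpha>s = \<xi>s" if "set \<xi>s \<subseteq> CS p" for \<xi>s
      using that
    proof (induction \<xi>s)
      case (Cons \<xi> \<xi>s)
      then obtain \<alpha>s where "set \<alpha>s \<subseteq> OF" "map (\<lambda>\<alpha>. \<alpha> p) \<alpha>s = \<xi>s" by auto
      moreover obtain f where "f \<in> SF" "d f p = \<xi>" using covector_is_differential[of \<xi> p] Cons.prems by auto
      ultimately show ?case by (intro exI[of _ "d f # \<alpha>s"]) (simp add: differential_form)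
    qed simp
    then obtain \<alpha>s where "set \<alpha>s \<subseteq> OF" "map (\<lambda>\<alpha>. \<alpha> p) \<alpha>s = \<xi>s" using True by blast
    moreover from this have "length \<alpha>s = k" using True length_map by metis
    ultimately show ?thesis using fun_cong[OF eq, of \<alpha>s p] by (simp add: mv_eval_def)
  next
    case False
    then show ?thesis
      using multivectors_outside[OF multivector_field_at[OF D] False]
        multivectors_outside[OF multivector_field_at[OF E] False] by simp
  qed
qed

lemma sharp_spec:
  assumes P: "P \<in> MV 2" and \<xi>: "\<xi> \<in> CS p"
  shows sharp_tangent: "sharp A P p \<xi> \<in> TS p"
    and covector_sharp: "\<And>\<eta>. \<eta> \<in> CS p \<Longrightarrow> \<eta> (sharp A P p \<xi>) = P p [\<xi>, \<eta>]"
  unfolding sharp_def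
  using vector_of_spec[of p "\<lambda>\<eta>. P p [\<xi>, \<eta>]"] multivector_linear2(2)[OF multivector_field_at[OF P] \<xi>] by blast+

lemma sharp_field:
  assumes P: "P \<in> MV 2" and \<alpha>: "\<alpha> \<in> OF"
  shows "on_sections (sharp A P) \<alpha> \<in> VF"
    and der_sharp: "der (on_sections (sharp A P) \<alpha>) f = mv_eval P [\<alpha>, d f]"
    and pairing_sharp: "\<beta> \<in> OF \<Longrightarrow> pairing \<beta> (on_sections (sharp A P) \<alpha>) = mv_eval P [\<alpha>, \<beta>]"
proof -
  note \<alpha>p = form_cotangent[OF \<alpha>]
  have t: "on_sections (sharp A P) \<alpha> p \<in> TS p" for p
    by (simp add: on_sections_def sharp_tangent[OF P \<alpha>p])
  show 1: "der (on_sections (sharp A P) \<alpha>) f = mv_eval P [\<alpha>, d f]" for f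
    using covector_sharp[OF P \<alpha>p differential_cotangent] sharp_tangent[OF P \<alpha>p]
    by (intro ext) (simp add: der_def on_sections_def mv_eval_def differential_apply)
  show "on_sections (sharp A P) \<alpha> \<in> VF"
    using t 1 mv_eval2_smooth[OF P \<alpha> differential_form] by (simp add: vector_fields_def der_def)
  show "pairing \<beta> (on_sections (sharp A P) \<alpha>) = mv_eval P [\<alpha>, \<beta>]" if "\<beta> \<in> OF"
    using covector_sharp[OF P \<alpha>p form_cotangent[OF that]]
    by (intro ext) (simp add: pairing_def on_sections_def mv_eval_def)
qed

text \<open>For a bivector field this is the vector field $Q^\sharp\alpha$, so that the axioms of the Schouten
  bracket for vector fields apply to it.\<close>

lemma iota_bivector:
  assumes P: "P \<in> MV 2" and \<alpha>: "\<alpha> \<in> OF"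
  shows "iota \<alpha> P = mv_vec A (on_sections (sharp A P) \<alpha>)"
proof (rule multivector_field_eqI[of _ 1])
  show "iota \<alpha> P \<in> MV 1" using iota_field[of P 1 \<alpha>] assms by (simp add: numeral_2_eq_2)
  show "mv_vec A (on_sections (sharp A P) \<alpha>) \<in> MV 1" by (intro mv_vec_field sharp_field assms)
  fix \<alpha>s :: "('m \<Rightarrow> 'm covec) list" assume "length \<alpha>s = 1" "set \<alpha>s \<subseteq> OF"
  then show "mv_eval (iota \<alpha> P) \<alpha>s = mv_eval (mv_vec A (on_sections (sharp A P) \<alpha>)) \<alpha>s"
    by (auto simp: length_Suc_conv mv_eval_iota mv_eval_vec pairing_sharp[OF assms])
qed

lemma contract_spec:
  assumes D: "D \<in> MV 3" and \<alpha>: "\<alpha> \<in> OF" and \<beta>: "\<beta> \<in> OF"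
  shows contract_tangent: "contract A \<alpha> \<beta> D p \<in> TS p"
    and covector_contract: "\<xi> \<in> CS p \<Longrightarrow> \<xi> (contract A \<alpha> \<beta> D p) = D p [\<alpha> p, \<beta> p, \<xi>]"
  unfolding contract_def
  using vector_of_spec[of p "\<lambda>\<xi>. D p [\<alpha> p, \<beta> p, \<xi>]"]
    multivector_linear3(3)[OF multivector_field_at[OF D] form_cotangent[OF \<alpha>] form_cotangent[OF \<beta>]] by blast+

text \<open>Each slot depends on the value of the form at the point only, so a trivector at \<open>p\<close> is evaluated
  on covectors by extending them to one-forms.\<close>

lemma trivector_of_tensorial:
  assumes T: "\<And>\<beta> \<gamma>. \<beta> \<in> OF \<Longrightarrow> \<gamma> \<in> OF \<Longrightarrow> tensorial_on OF (\<lambda>\<alpha>. T \<alpha> \<beta> \<gamma>)"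
    and swap: "\<And>\<alpha> \<beta> \<gamma>. \<alpha> \<in> OF \<Longrightarrow> \<beta> \<in> OF \<Longrightarrow> \<gamma> \<in> OF \<Longrightarrow> T \<beta> \<alpha> \<gamma> = - T \<alpha> \<beta> \<gamma>"
       "\<And>\<alpha> \<beta> \<gamma>. \<alpha> \<in> OF \<Longrightarrow> \<beta> \<in> OF \<Longrightarrow> \<gamma> \<in> OF \<Longrightarrow> T \<alpha> \<gamma> \<beta> = - T \<alpha> \<beta> \<gamma>"
    and S: "\<And>\<alpha> \<beta> \<gamma>. \<alpha> \<in> OF \<Longrightarrow> \<beta> \<in> OF \<Longrightarrow> \<gamma> \<in> OF \<Longrightarrow> T \<alpha> \<beta> \<gamma> \<in> SF"
  obtains E where "E \<in> MV 3" "\<And>\<alpha> \<beta> \<gamma>. \<alpha> \<in> OF \<Longrightarrow> \<beta> \<in> OF \<Longrightarrow> \<gamma> \<in> OF \<Longrightarrow> mv_eval E [\<alpha>, \<beta>, \<gamma>] = T \<alpha> \<beta> \<gamma>"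
proof -
  have pt1: "T \<alpha> \<beta> \<gamma> p = T \<alpha>' \<beta> \<gamma> p"
    if "\<alpha> \<in> OF" "\<alpha>' \<in> OF" "\<beta> \<in> OF" "\<gamma> \<in> OF" "\<alpha> p = \<alpha>' p" for \<alpha> \<alpha>' \<beta> \<gamma> p
    using tensorial_forms_pointwise[OF T] that by blast
  have pt2: "T \<alpha> \<beta> \<gamma> p = T \<alpha> \<beta>' \<gamma> p"
    if "\<alpha> \<in> OF" "\<beta> \<in> OF" "\<beta>' \<in> OF" "\<gamma> \<in> OF" "\<beta> p = \<beta>' p" for \<alpha> \<beta> \<beta>' \<gamma> p
    using pt1[of \<beta> \<beta>' \<alpha> \<gamma> p] swap(1)[of \<beta> \<alpha> \<gamma>] swap(1)[of \<beta>' \<alpha> \<gamma>] that by simp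
  have pt3: "T \<alpha> \<beta> \<gamma> p = T \<alpha> \<beta> \<gamma>' p"
    if "\<alpha> \<in> OF" "\<beta> \<in> OF" "\<gamma>' \<in> OF" "\<gamma> \<in> OF" "\<gamma> p = \<gamma>' p" for \<alpha> \<beta> \<gamma> \<gamma>' p
    using pt2[of \<alpha> \<gamma> \<gamma>' \<beta> p] swap(2)[of \<alpha> \<gamma> \<beta>] swap(2)[of \<alpha> \<gamma>' \<beta>] that by simp
  have pt: "T \<alpha> \<beta> \<gamma> p = T \<alpha>' \<beta>' \<gamma>' p"
    if "\<alpha> \<in> OF" "\<alpha>' \<in> OF" "\<beta> \<in> OF" "\<beta>' \<in> OF" "\<gamma> \<in> OF" "\<gamma>' \<in> OF" "\<alpha> p = \<alpha>' p" "\<beta> p = \<beta>' p" "\<gamma> p = \<gamma>' p"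
    for \<alpha> \<alpha>' \<beta> \<beta>' \<gamma> \<gamma>' p
    using pt1[of \<alpha> \<alpha>' \<beta> \<gamma> p] pt2[of \<alpha>' \<beta> \<beta>' \<gamma> p] pt3[of \<alpha>' \<beta>' \<gamma>' \<gamma> p] that by simp
  define ext where "ext p \<xi> = (SOME \<alpha>. \<alpha> \<in> OF \<and> \<alpha> p = \<xi>)" for p and \<xi> :: "'m covec"
  have ext: "ext p \<xi> \<in> OF" "ext p \<xi> p = \<xi>" if "\<xi> \<in> CS p" for p \<xi>
    using someI_ex[of "\<lambda>\<alpha>. \<alpha> \<in> OF \<and> \<alpha> p = \<xi>"] covector_is_differential[OF that] differential_form
    unfolding ext_def by blast+
  define E where "E p \<xi>s = (if length \<xi>s = 3 \<and> set \<xi>s \<subseteq> CS p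
     then T (ext p (\<xi>s ! 0)) (ext p (\<xi>s ! 1)) (ext p (\<xi>s ! 2)) p else 0)" for p \<xi>s
  have E: "E p [\<xi>, \<eta>, \<zeta>] = T (ext p \<xi>) (ext p \<eta>) (ext p \<zeta>) p" if "\<xi> \<in> CS p" "\<eta> \<in> CS p" "\<zeta> \<in> CS p" for p \<xi> \<eta> \<zeta>
    using that by (simp add: E_def numeral_2_eq_2)
  have eval: "mv_eval E [\<alpha>, \<beta>, \<gamma>] = T \<alpha> \<beta> \<gamma>" if "\<alpha> \<in> OF" "\<beta> \<in> OF" "\<gamma> \<in> OF" for \<alpha> \<beta> \<gamma>
  proof
    fix p
    note c = form_cotangent[OF that(1), of p] form_cotangent[OF that(2), of p] form_cotangent[OF that(3), of p]
    show "mv_eval E [\<alpha>, \<beta>, \<gamma>] p = T \<alpha> \<beta> \<gamma> p"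
      using pt[of "ext p (\<alpha> p)" \<alpha> "ext p (\<beta> p)" \<beta> "ext p (\<gamma> p)" \<gamma> p] that c
      by (simp add: mv_eval_def E ext)
  qed
  have "E p \<in> multivectors A 3 p" for p
  proof (rule multivectors3I)
    fix \<eta> \<zeta> \<xi> \<xi>' a b assume *: "\<eta> \<in> CS p" "\<zeta> \<in> CS p" "\<xi> \<in> CS p" "\<xi>' \<in> CS p"
    let ?c = "\<lambda>v. a * \<eta> v + b * \<zeta> v"
    let ?\<alpha> = "smul (\<lambda>_. a) (ext p \<eta>) + smul (\<lambda>_. b) (ext p \<zeta>)"
    have c: "?c \<in> CS p" using * by (intro cotangent_space_lincomb)
    have "?\<alpha> \<in> OF" using * by (intro one_form_add one_form_smul ext smooth_const)
    moreover have "?\<alpha> p = ?c" using * by (auto simp: smul_def ext)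
    ultimately have "T (ext p ?c) (ext p \<xi>) (ext p \<xi>') p = T ?\<alpha> (ext p \<xi>) (ext p \<xi>') p"
      using c * by (intro pt1) (simp_all add: ext)
    also have "\<dots> = a * E p [\<eta>, \<xi>, \<xi>'] + b * E p [\<zeta>, \<xi>, \<xi>']"
      using T[of "ext p \<xi>" "ext p \<xi>'"] * by (simp add: E ext tensorial_on_def one_form_smul smooth_const)
    finally show "E p [?c, \<xi>, \<xi>'] = a * E p [\<eta>, \<xi>, \<xi>'] + b * E p [\<zeta>, \<xi>, \<xi>']" using c * by (simp add: E)
  next
    fix \<xi> \<eta> \<zeta> assume *: "\<xi> \<in> CS p" "\<eta> \<in> CS p" "\<zeta> \<in> CS p"
    show "E p [\<eta>, \<xi>, \<zeta>] = - E p [\<xi>, \<eta>, \<zeta>]" "E p [\<xi>, \<zeta>, \<eta>] = - E p [\<xi>, \<eta>, \<zeta>]"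
      using swap(1)[of "ext p \<xi>" "ext p \<eta>" "ext p \<zeta>"] swap(2)[of "ext p \<xi>" "ext p \<eta>" "ext p \<zeta>"] *
      by (simp_all add: E ext)
  qed (auto simp: E_def)
  moreover have "mv_eval E \<alpha>s \<in> SF" if "length \<alpha>s = 3" "set \<alpha>s \<subseteq> OF" for \<alpha>s
    using that eval S by (auto simp: numeral_3_eq_3 length_Suc_conv)
  ultimately have "E \<in> MV 3" by (simp add: multivector_fields_def)
  then show ?thesis using eval that by blast
qed

text \<open>Existence in the definite description of the Lie derivative; the derivatives of the coefficients
  cancel in the tensoriality of the defining formula.\<close>

lemma lie_mv_spec:
  assumes D: "D \<in> MV 3" and X: "X \<in> VF"
  shows lie_mv_field: "lie_mv A 3 X D \<in> MV 3"
    and mv_eval_lie_mv: "\<alpha> \<in> OF \<Longrightarrow> \<beta> \<in> OF \<Longrightarrow> \<gamma> \<in> OF \<Longrightarrow> mv_eval (lie_mv A 3 X D) [\<alpha>, \<beta>, \<gamma>] =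
      der X (mv_eval D [\<alpha>, \<beta>, \<gamma>]) - (mv_eval D [lie_form A X \<alpha>, \<beta>, \<gamma>]
        + mv_eval D [\<alpha>, lie_form A X \<beta>, \<gamma>] + mv_eval D [\<alpha>, \<beta>, lie_form A X \<gamma>])"
proof -
  let ?L = "lie_form A X"
  let ?T = "\<lambda>\<alpha> \<beta> \<gamma>. der X (mv_eval D [\<alpha>, \<beta>, \<gamma>]) - (mv_eval D [?L \<alpha>, \<beta>, \<gamma>]
        + mv_eval D [\<alpha>, ?L \<beta>, \<gamma>] + mv_eval D [\<alpha>, \<beta>, ?L \<gamma>])"
  note L = lie_form_form[OF X]
  note cl = L one_form_add one_form_smul mv_eval3_smooth[OF D] der_smooth[OF X]
  have T: "tensorial_on OF (\<lambda>\<alpha>. ?T \<alpha> \<beta> \<gamma>)" if "\<beta> \<in> OF" "\<gamma> \<in> OF" for \<beta> \<gamma>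
    unfolding tensorial_on_def using that
    by (auto simp: cl mv_eval3_add[OF D] mv_eval3_smul[OF D] lie_form_add[OF X] lie_form_smul[OF X] der_add[OF X] der_mult[OF X] algebra_simps)
  have s: "?T \<beta> \<alpha> \<gamma> = - ?T \<alpha> \<beta> \<gamma>" "?T \<alpha> \<gamma> \<beta> = - ?T \<alpha> \<beta> \<gamma>" if "\<alpha> \<in> OF" "\<beta> \<in> OF" "\<gamma> \<in> OF" for \<alpha> \<beta> \<gamma>
    using that mv_eval3_swap[OF D that] mv_eval3_swap[OF D L[OF that(1)] that(2,3)]
       mv_eval3_swap[OF D that(1) L[OF that(2)] that(3)] mv_eval3_swap[OF D that(1,2) L[OF that(3)]]
    by (simp_all add: der_minus[OF X] cl algebra_simps)
  have S: "?T \<alpha> \<beta> \<gamma> \<in> SF" if "\<alpha> \<in> OF" "\<beta> \<in> OF" "\<gamma> \<in> OF" for \<alpha> \<beta> \<gamma>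
    using that by (intro smooth_diff smooth_add cl)
  obtain E where E: "E \<in> MV 3" "\<And>\<alpha> \<beta> \<gamma>. \<alpha> \<in> OF \<Longrightarrow> \<beta> \<in> OF \<Longrightarrow> \<gamma> \<in> OF \<Longrightarrow> mv_eval E [\<alpha>, \<beta>, \<gamma>] = ?T \<alpha> \<beta> \<gamma>"
    using trivector_of_tensorial[of ?T, OF T s S] by blast
  have sum: "der X (mv_eval D \<alpha>s) p - (\<Sum>i<3. mv_eval D (\<alpha>s[i := ?L (\<alpha>s ! i)]) p) = ?T (\<alpha>s ! 0) (\<alpha>s ! 1) (\<alpha>s ! 2) p"
    if "length \<alpha>s = 3" for \<alpha>s p
    using that by (auto simp: numeral_3_eq_3 numeral_2_eq_2 length_Suc_conv)
  have list3: "mv_eval F \<alpha>s = mv_eval F [\<alpha>s ! 0, \<alpha>s ! 1, \<alpha>s ! 2] \<and> \<alpha>s ! 0 \<in> OF \<and> \<alpha>s ! 1 \<in> OF \<and> \<alpha>s ! 2 \<in> OF"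
    if "length \<alpha>s = 3" "set \<alpha>s \<subseteq> OF" for F \<alpha>s
    using that by (auto simp: numeral_3_eq_3 numeral_2_eq_2 length_Suc_conv)
  have "lie_mv A 3 X D = E"
    unfolding lie_mv_def
  proof (rule the_equality)
    show "E \<in> MV 3 \<and> (\<forall>\<alpha>s. length \<alpha>s = 3 \<and> set \<alpha>s \<subseteq> OF \<longrightarrow> (\<forall>p. mv_eval E \<alpha>s p =
           X p (mv_eval D \<alpha>s) - (\<Sum>i<3. mv_eval D (\<alpha>s[i := ?L (\<alpha>s ! i)]) p)))"
    proof (intro conjI allI impI E(1); elim conjE)
      fix \<alpha>s p assume *: "length \<alpha>s = 3" "set \<alpha>s \<subseteq> OF"
      have "mv_eval E \<alpha>s p = ?T (\<alpha>s ! 0) (\<alpha>s ! 1) (\<alpha>s ! 2) p"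
        using list3[OF *, of E] E(2) by simp
      then show "mv_eval E \<alpha>s p = X p (mv_eval D \<alpha>s) - (\<Sum>i<3. mv_eval D (\<alpha>s[i := ?L (\<alpha>s ! i)]) p)"
        unfolding sum[OF *(1), symmetric] by (simp add: der_def)
    qed
  next
    fix F assume F: "F \<in> MV 3 \<and> (\<forall>\<alpha>s. length \<alpha>s = 3 \<and> set \<alpha>s \<subseteq> OF \<longrightarrow> (\<forall>p. mv_eval F \<alpha>s p =
           X p (mv_eval D \<alpha>s) - (\<Sum>i<3. mv_eval D (\<alpha>s[i := ?L (\<alpha>s ! i)]) p)))"
    show "F = E"
    proof (rule multivector_field_eqI[OF conjunct1[OF F] E(1)])
      fix \<alpha>s assume *: "length \<alpha>s = 3" "set \<alpha>s \<subseteq> OF"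
      have "mv_eval F \<alpha>s p = der X (mv_eval D \<alpha>s) p - (\<Sum>i<3. mv_eval D (\<alpha>s[i := ?L (\<alpha>s ! i)]) p)" for p
        using F * by (simp add: der_def)
      then have "mv_eval F \<alpha>s = ?T (\<alpha>s ! 0) (\<alpha>s ! 1) (\<alpha>s ! 2)"
        unfolding sum[OF *(1)] by (rule ext)
      then show "mv_eval F \<alpha>s = mv_eval E \<alpha>s" using list3[OF *, of E] E(2) by simp
    qed
  qed
  then show "lie_mv A 3 X D \<in> MV 3" "\<alpha> \<in> OF \<Longrightarrow> \<beta> \<in> OF \<Longrightarrow> \<gamma> \<in> OF \<Longrightarrow> mv_eval (lie_mv A 3 X D) [\<alpha>, \<beta>, \<gamma>] = ?T \<alpha> \<beta> \<gamma>"
    using E by auto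
qed

lemma endomorphism_field_apply:
  assumes N: "N \<in> endomorphism_fields A"
  shows endo_tangent: "v \<in> TS p \<Longrightarrow> N p v \<in> TS p"
    and endo_lincomb: "v \<in> TS p \<Longrightarrow> w \<in> TS p \<Longrightarrow> N p (\<lambda>f. a * v f + b * w f) = (\<lambda>f. a * N p v f + b * N p w f)"
    and endo_field: "X \<in> VF \<Longrightarrow> on_sections N X \<in> VF"
  using assms unfolding endomorphism_fields_def on_sections_def by blast+

lemma endo_smul:
  assumes N: "N \<in> endomorphism_fields A" and X: "X \<in> VF"
  shows "on_sections N (smul a X) = smul a (on_sections N X)"
  using endo_lincomb[OF N field_tangent[OF X] field_tangent[OF X], where a = "a p" and b=0 for p]
  by (intro ext) (simp add: on_sections_def smul_def)

lemma endo_add: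
  assumes N: "N \<in> endomorphism_fields A" and X: "X \<in> VF" and Y: "Y \<in> VF"
  shows "on_sections N (X + Y) = on_sections N X + on_sections N Y"
  using endo_lincomb[OF N field_tangent[OF X] field_tangent[OF Y], where a=1 and b=1]
  by (intro ext) (simp add: on_sections_def func_plus)

lemma dual_map_cotangent:
  assumes N: "N \<in> endomorphism_fields A" and \<xi>: "\<xi> \<in> CS p"
  shows "dual_map A N p \<xi> \<in> CS p"
  unfolding cotangent_space_def dual_map_def
  by (simp add: tangent_space_lincomb endo_lincomb[OF N] covector_lincomb[OF \<xi> endo_tangent[OF N] endo_tangent[OF N]])

lemma pairing_dual:
  assumes X: "X \<in> VF"
  shows "pairing (on_sections (dual_map A N) \<alpha>) X = pairing \<alpha> (on_sections N X)"
  by (rule ext) (simp add: pairing_def on_sections_def dual_map_def field_tangent[OF X])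

lemma dual_form:
  assumes N: "N \<in> endomorphism_fields A" and \<alpha>: "\<alpha> \<in> OF"
  shows "on_sections (dual_map A N) \<alpha> \<in> OF"
  by (rule one_formI)
    (simp_all add: pairing_dual pairing_smooth[OF \<alpha> endo_field[OF N]],
      simp add: on_sections_def dual_map_cotangent[OF N form_cotangent[OF \<alpha>]])

lemma dual_add:
  "on_sections (dual_map A N) (\<alpha> + \<beta>) = on_sections (dual_map A N) \<alpha> + on_sections (dual_map A N) \<beta>"
  by (intro ext) (simp add: on_sections_def dual_map_def)

lemma dual_smul:
  "on_sections (dual_map A N) (smul a \<alpha>) = smul a (on_sections (dual_map A N) \<alpha>)"
  by (intro ext) (simp add: on_sections_def dual_map_def smul_def)

end

section \<open>Wedge products\<close>

definition alternating_sum :: "nat \<Rightarrow> ((nat \<Rightarrow> nat) \<Rightarrow> real) \<Rightarrow> real" where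
  "alternating_sum n F = (\<Sum>\<sigma> | \<sigma> permutes {..<n}. of_int (sign \<sigma>) * F \<sigma>)"

lemma alternating_sum_0: "alternating_sum 0 F = F id"
  by (simp add: alternating_sum_def sign_id)

text \<open>Expansion along the image of the last index: every permutation of \<open>n + 1\<close> indices is a unique
  transposition of \<open>n\<close> with some \<open>b \<le> n\<close> after a permutation of the first \<open>n\<close>.\<close>

lemma alternating_sum_Suc:
  "alternating_sum (Suc n) F = alternating_sum n F
     - (\<Sum>b<n. alternating_sum n (\<lambda>\<sigma>. F (Transposition.transpose n b \<circ> \<sigma>)))"
proof -
  have perm: "permutation \<sigma>" if "\<sigma> permutes {..<n}" for \<sigma>
    using that by (rule permutes_imp_permutation[OF finite_lessThan])
  have s: "(\<Sum>\<sigma> | \<sigma> permutes {..<n}. of_int (sign (Transposition.transpose n b \<circ> \<sigma>)) * F (Transposition.transpose n b \<circ> \<sigma>))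
      = (if b = n then 1 else - 1) * alternating_sum n (\<lambda>\<sigma>. F (Transposition.transpose n b \<circ> \<sigma>))" for b
    unfolding alternating_sum_def sum_distrib_left
    by (rule sum.cong) (auto simp: sign_compose perm permutation_swap_id sign_swap_id)
  have "alternating_sum (Suc n) F = (\<Sum>b\<in>insert n {..<n}. (if b = n then 1 else - 1) *
      alternating_sum n (\<lambda>\<sigma>. F (Transposition.transpose n b \<circ> \<sigma>)))"
    unfolding alternating_sum_def[of "Suc n"] lessThan_Suc
    by (subst sum_over_permutations_insert) (auto simp: s)
  also have "\<dots> = alternating_sum n F + (\<Sum>b<n. - alternating_sum n (\<lambda>\<sigma>. F (Transposition.transpose n b \<circ> \<sigma>)))"
    by (subst sum.insert) (auto intro!: sum.cong)
  finally show ?thesis by (simp add: sum_negf)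
qed

lemma alternating_sum_three:
  "alternating_sum 3 (\<lambda>\<sigma>. G (\<sigma> 0) (\<sigma> 1) (\<sigma> 2) (\<sigma> 3)) =
     G 0 1 2 3 - G 0 2 1 3 - G 1 0 2 3 + G 1 2 0 3 + G 2 0 1 3 - G 2 1 0 3"
  by (simp add: numeral_3_eq_3 numeral_2_eq_2 alternating_sum_Suc alternating_sum_0 Transposition.transpose_def)

text \<open>The wedge products of total degree four are the largest that occur. The formula for three is
  stated with a fourth argument so that it applies to each block of the expansion for four.\<close>

lemma alternating_sum_four:
  "alternating_sum 4 (\<lambda>\<sigma>. G (\<sigma> 0) (\<sigma> 1) (\<sigma> 2) (\<sigma> 3)) =
     G 0 1 2 3 - G 0 1 3 2 - G 0 2 1 3 + G 0 2 3 1 + G 0 3 1 2 - G 0 3 2 1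
      - G 1 0 2 3 + G 1 0 3 2 + G 1 2 0 3 - G 1 2 3 0 - G 1 3 0 2 + G 1 3 2 0
      + G 2 0 1 3 - G 2 0 3 1 - G 2 1 0 3 + G 2 1 3 0 + G 2 3 0 1 - G 2 3 1 0
      - G 3 0 1 2 + G 3 0 2 1 + G 3 1 0 2 - G 3 1 2 0 - G 3 2 0 1 + G 3 2 1 0"
proof -
  let ?t = "\<lambda>b. Transposition.transpose 3 b"
  have "alternating_sum (Suc 3) (\<lambda>\<sigma>. G (\<sigma> 0) (\<sigma> 1) (\<sigma> 2) (\<sigma> 3)) =
      alternating_sum 3 (\<lambda>\<sigma>. G (\<sigma> 0) (\<sigma> 1) (\<sigma> 2) (\<sigma> 3))
      - (\<Sum>b<3. alternating_sum 3 (\<lambda>\<sigma>. G (?t b (\<sigma> 0)) (?t b (\<sigma> 1)) (?t b (\<sigma> 2)) (?t b (\<sigma> 3))))"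
    by (simp only: alternating_sum_Suc o_apply)
  then show ?thesis
    unfolding alternating_sum_three[of G]
      alternating_sum_three[of "\<lambda>x y z w. G (?t b x) (?t b y) (?t b z) (?t b w)" for b]
    by (simp add: eval_nat_numeral Transposition.transpose_def)
qed

lemma mv_wedge_alternating_sum:
  "length \<xi>s = k + l \<Longrightarrow> mv_wedge k l D E p \<xi>s = alternating_sum (k + l) (\<lambda>\<sigma>.
     D p (map (\<lambda>i. \<xi>s ! \<sigma> i) [0..<k]) * E p (map (\<lambda>i. \<xi>s ! \<sigma> i) [k..<k + l])) / (fact k * fact l)"
  by (simp add: mv_wedge_def alternating_sum_def mult.assoc)

context smooth_algebra
begin

lemma multivectors_permute:
  assumes D: "D \<in> multivectors A k p" and \<xi>s: "length \<xi>s = k" "set \<xi>s \<subseteq> CS p" and \<sigma>: "\<sigma> permutes {..<k}"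
  shows "D (map (\<lambda>i. \<xi>s ! \<sigma> i) [0..<k]) = of_int (sign \<sigma>) * D \<xi>s"
  using finite_lessThan \<sigma>
proof (induction rule: permutes_rev_induct)
  case id
  then show ?case using \<xi>s by (simp add: sign_id map_nth flip: \<xi>s(1))
next
  case (swap a b \<sigma>)
  let ?\<eta>s = "map (\<lambda>i. \<xi>s ! \<sigma> i) [0..<k]"
  have "\<sigma> i < k" if "i < k" for i using permutes_in_image[OF swap(4), of i] that by simp
  then have \<eta>s: "length ?\<eta>s = k" "set ?\<eta>s \<subseteq> CS p" using \<xi>s by (auto dest: nth_mem)
  have "map (\<lambda>i. \<xi>s ! (\<sigma> \<circ> Transposition.transpose a b) i) [0..<k] = ?\<eta>s[a := ?\<eta>s ! b, b := ?\<eta>s ! a]"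
    using swap(1-3) by (intro nth_equalityI) (auto simp: nth_list_update Transposition.transpose_def)
  moreover have "sign (\<sigma> \<circ> Transposition.transpose a b) = - sign \<sigma>"
    using swap(3) permutes_imp_permutation[OF finite_lessThan swap(4)]
    by (simp add: sign_compose permutation_swap_id sign_swap_id)
  moreover have "a < k" "b < k" using swap(1,2) by auto
  ultimately show ?case using multivectors_swap[OF D \<eta>s _ _ swap(3)] swap(5)
    by (simp only: of_int_minus mult_minus_left)
qed

lemma mv_wedge_fun:
  assumes E: "E \<in> MV m" and \<xi>s: "length \<xi>s = m" "set \<xi>s \<subseteq> CS p"
  shows "mv_wedge 0 m (mv_fun f) E p \<xi>s = f p * E p \<xi>s"
proof -
  have "(\<Sum>\<sigma> | \<sigma> permutes {..<m}. of_int (sign \<sigma>) * f p * E p (map (\<lambda>i. \<xi>s ! \<sigma> i) [0..<m]))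
      = (\<Sum>\<sigma> | \<sigma> permutes {..<m}. f p * E p \<xi>s)"
    by (rule sum.cong) (auto simp: multivectors_permute[OF multivector_field_at[OF E] \<xi>s] sign_def)
  also have "\<dots> = fact m * (f p * E p \<xi>s)"
    by (simp add: card_permutations)
  finally show ?thesis using \<xi>s(1) by (simp add: mv_wedge_def mv_fun_def)
qed

lemma multivector_perm3:
  assumes "D \<in> multivectors A 3 p" "\<xi> \<in> CS p" "\<eta> \<in> CS p" "\<zeta> \<in> CS p"
  shows "D [\<eta>, \<xi>, \<zeta>] = - D [\<xi>, \<eta>, \<zeta>]" "D [\<xi>, \<zeta>, \<eta>] = - D [\<xi>, \<eta>, \<zeta>]"
    "D [\<zeta>, \<eta>, \<xi>] = - D [\<xi>, \<eta>, \<zeta>]" "D [\<eta>, \<zeta>, \<xi>] = D [\<xi>, \<eta>, \<zeta>]" "D [\<zeta>, \<xi>, \<eta>] = D [\<xi>, \<eta>, \<zeta>]"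
  using multivector_swap3[OF assms] multivector_swap3[OF assms(1,3,2,4)] multivector_swap3[OF assms(1,2,4,3)] by simp_all

lemma mv_wedge_1_1:
  "mv_wedge 1 1 D E p [\<alpha>, \<beta>] = D p [\<alpha>] * E p [\<beta>] - D p [\<beta>] * E p [\<alpha>]"
  by (subst mv_wedge_alternating_sum)
    (simp_all add: numeral_2_eq_2 alternating_sum_Suc alternating_sum_0 Transposition.transpose_def)

lemma mv_wedge_1_2:
  assumes E: "E \<in> MV 2" and \<alpha>: "\<alpha> \<in> CS p" and \<beta>: "\<beta> \<in> CS p" and \<gamma>: "\<gamma> \<in> CS p"
  shows "mv_wedge 1 2 D E p [\<alpha>, \<beta>, \<gamma>] = D p [\<alpha>] * E p [\<beta>, \<gamma>] - D p [\<beta>] * E p [\<alpha>, \<gamma>] + D p [\<gamma>] * E p [\<alpha>, \<beta>]"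
  by (subst mv_wedge_alternating_sum)
    (simp_all add: numeral_2_eq_2 numeral_3_eq_3 alternating_sum_Suc alternating_sum_0 Transposition.transpose_def
      multivector_swap2[OF multivector_field_at[OF E] \<alpha> \<beta>] multivector_swap2[OF multivector_field_at[OF E] \<alpha> \<gamma>] multivector_swap2[OF multivector_field_at[OF E] \<beta> \<gamma>] field_simps)

lemma mv_wedge_2_1:
  assumes D: "D \<in> MV 2" and \<alpha>: "\<alpha> \<in> CS p" and \<beta>: "\<beta> \<in> CS p" and \<gamma>: "\<gamma> \<in> CS p"
  shows "mv_wedge 2 1 D E p [\<alpha>, \<beta>, \<gamma>] = D p [\<alpha>, \<beta>] * E p [\<gamma>] - D p [\<alpha>, \<gamma>] * E p [\<beta>] + D p [\<beta>, \<gamma>] * E p [\<alpha>]"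
  by (subst mv_wedge_alternating_sum)
    (simp_all add: numeral_2_eq_2 numeral_3_eq_3 alternating_sum_Suc alternating_sum_0 Transposition.transpose_def
      multivector_swap2[OF multivector_field_at[OF D] \<alpha> \<beta>] multivector_swap2[OF multivector_field_at[OF D] \<alpha> \<gamma>] multivector_swap2[OF multivector_field_at[OF D] \<beta> \<gamma>] field_simps)

lemma mv_wedge_2_2:
  assumes D: "D \<in> MV 2" and E: "E \<in> MV 2"
    and \<alpha>: "\<alpha> \<in> CS p" and \<beta>: "\<beta> \<in> CS p" and \<gamma>: "\<gamma> \<in> CS p" and \<delta>: "\<delta> \<in> CS p"
  shows "mv_wedge 2 2 D E p [\<alpha>, \<beta>, \<gamma>, \<delta>] = D p [\<alpha>, \<beta>] * E p [\<gamma>, \<delta>] - D p [\<alpha>, \<gamma>] * E p [\<beta>, \<delta>]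
     + D p [\<alpha>, \<delta>] * E p [\<beta>, \<gamma>] + D p [\<beta>, \<gamma>] * E p [\<alpha>, \<delta>] - D p [\<beta>, \<delta>] * E p [\<alpha>, \<gamma>] + D p [\<gamma>, \<delta>] * E p [\<alpha>, \<beta>]"
proof -
  let ?\<xi> = "[\<alpha>, \<beta>, \<gamma>, \<delta>]"
  have "mv_wedge 2 2 D E p ?\<xi> = alternating_sum 4
      (\<lambda>\<sigma>. D p [?\<xi> ! \<sigma> 0, ?\<xi> ! \<sigma> 1] * E p [?\<xi> ! \<sigma> 2, ?\<xi> ! \<sigma> 3]) / 4"
    by (subst mv_wedge_alternating_sum) (simp_all add: upt_rec)
  then show ?thesis
    unfolding alternating_sum_four[of "\<lambda>i j k l. D p [?\<xi> ! i, ?\<xi> ! j] * E p [?\<xi> ! k, ?\<xi> ! l]"]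
    by (simp add:
      multivector_swap2[OF multivector_field_at[OF D] \<alpha> \<beta>] multivector_swap2[OF multivector_field_at[OF D] \<alpha> \<gamma>] multivector_swap2[OF multivector_field_at[OF D] \<beta> \<gamma>]
      multivector_swap2[OF multivector_field_at[OF D] \<alpha> \<delta>] multivector_swap2[OF multivector_field_at[OF D] \<beta> \<delta>] multivector_swap2[OF multivector_field_at[OF D] \<gamma> \<delta>]
      multivector_swap2[OF multivector_field_at[OF E] \<alpha> \<beta>] multivector_swap2[OF multivector_field_at[OF E] \<alpha> \<gamma>] multivector_swap2[OF multivector_field_at[OF E] \<beta> \<gamma>]
      multivector_swap2[OF multivector_field_at[OF E] \<alpha> \<delta>] multivector_swap2[OF multivector_field_at[OF E] \<beta> \<delta>] multivector_swap2[OF multivector_field_at[OF E] \<gamma> \<delta>])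
qed

lemma mv_wedge_1_3:
  assumes E: "E \<in> MV 3"
    and \<alpha>: "\<alpha> \<in> CS p" and \<beta>: "\<beta> \<in> CS p" and \<gamma>: "\<gamma> \<in> CS p" and \<delta>: "\<delta> \<in> CS p"
  shows "mv_wedge 1 3 D E p [\<alpha>, \<beta>, \<gamma>, \<delta>] = D p [\<alpha>] * E p [\<beta>, \<gamma>, \<delta>] - D p [\<beta>] * E p [\<alpha>, \<gamma>, \<delta>]
     + D p [\<gamma>] * E p [\<alpha>, \<beta>, \<delta>] - D p [\<delta>] * E p [\<alpha>, \<beta>, \<gamma>]"
proof -
  let ?\<xi> = "[\<alpha>, \<beta>, \<gamma>, \<delta>]"
  have "mv_wedge 1 3 D E p ?\<xi> = alternating_sum 4
      (\<lambda>\<sigma>. D p [?\<xi> ! \<sigma> 0] * E p [?\<xi> ! \<sigma> 1, ?\<xi> ! \<sigma> 2, ?\<xi> ! \<sigma> 3]) / 6"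
    by (subst mv_wedge_alternating_sum) (simp_all add: upt_rec fact_numeral, simp add: eval_nat_numeral)
  then show ?thesis
    unfolding alternating_sum_four[of "\<lambda>i j k l. D p [?\<xi> ! i] * E p [?\<xi> ! j, ?\<xi> ! k, ?\<xi> ! l]"]
    by (simp add:
      multivector_perm3[OF multivector_field_at[OF E] \<alpha> \<beta> \<gamma>] multivector_perm3[OF multivector_field_at[OF E] \<alpha> \<beta> \<delta>] multivector_perm3[OF multivector_field_at[OF E] \<alpha> \<gamma> \<delta>]
      multivector_perm3[OF multivector_field_at[OF E] \<beta> \<gamma> \<delta>])
qed

end

context smooth_algebra
begin

text \<open>If an entry is not a covector, then for every permutation it lands in one of the two factors, and
  that factor vanishes.\<close>

lemma mv_wedge_outside:
  assumes D: "D \<in> MV k" and E: "E \<in> MV l"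
    and out: "\<not> (length \<xi>s = k + l \<and> set \<xi>s \<subseteq> CS p)"
  shows "mv_wedge k l D E p \<xi>s = 0"
proof (cases "length \<xi>s = k + l")
  case True
  then obtain j where j: "j < k + l" "\<xi>s ! j \<notin> CS p" using out by (metis in_set_conv_nth subsetI)
  have "D p (map (\<lambda>i. \<xi>s ! \<sigma> i) [0..<k]) * E p (map (\<lambda>i. \<xi>s ! \<sigma> i) [k..<k + l]) = 0"
    if \<sigma>: "\<sigma> permutes {..<k + l}" for \<sigma>
  proof -
    obtain i where i: "i < k + l" "\<sigma> i = j"
      using permutes_image[OF \<sigma>] j(1) by (metis image_iff lessThan_iff)
    show ?thesis
    proof (cases "i < k")
      case True
      then have "D p (map (\<lambda>i. \<xi>s ! \<sigma> i) [0..<k]) = 0"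
        using i j(2) by (intro multivectors_outside[OF multivector_field_at[OF D]]) (auto simp: image_subset_iff)
      then show ?thesis by simp
    next
      case False
      then have "E p (map (\<lambda>i. \<xi>s ! \<sigma> i) [k..<k + l]) = 0"
        using i j(2) by (intro multivectors_outside[OF multivector_field_at[OF E]]) (auto simp: image_subset_iff)
      then show ?thesis by simp
    qed
  qed
  then have "alternating_sum (k + l) (\<lambda>\<sigma>. D p (map (\<lambda>i. \<xi>s ! \<sigma> i) [0..<k]) * E p (map (\<lambda>i. \<xi>s ! \<sigma> i) [k..<k + l])) = 0"
    unfolding alternating_sum_def by (intro sum.neutral ballI) (simp only: mem_Collect_eq mult_zero_right)
  then show ?thesis by (simp only: mv_wedge_alternating_sum[OF True] div_0)
qed (simp add: mv_wedge_def)

lemma mv_eval_sum: "mv_eval (\<Sum>i\<in>I. E i) \<alpha>s = (\<Sum>i\<in>I. mv_eval (E i) \<alpha>s)"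
  by (rule ext) (simp add: mv_eval_def sum_fun_apply)

lemma mv_eval_add: "mv_eval (D + E) \<alpha>s = mv_eval D \<alpha>s + mv_eval E \<alpha>s"
  by (rule ext) (simp add: mv_eval_def)

lemma mv_eval_smul: "mv_eval (smul f E) \<alpha>s = f * mv_eval E \<alpha>s"
  by (rule ext) (simp add: mv_eval_def smul_def)

lemma mv_scale_smul: "mv_scale c E = smul (\<lambda>_. c) E"
  by (intro ext) (simp add: mv_scale_def smul_def)

text \<open>With this, the Leibniz rule for a wedge product with a function is the Leibniz rule for multiplication
  by a function, which is what makes the Schouten bracket local.\<close>

lemma mv_wedge_fun_smul:
  assumes E: "E \<in> MV m" and f: "f \<in> SF"
  shows "mv_wedge 0 m (mv_fun f) E = smul f E"
proof (intro ext)
  fix p \<xi>s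
  show "mv_wedge 0 m (mv_fun f) E p \<xi>s = smul f E p \<xi>s"
  proof (cases "length \<xi>s = m \<and> set \<xi>s \<subseteq> CS p")
    case True
    then show ?thesis by (simp add: mv_wedge_fun[OF E] smul_def)
  next
    case False
    then have "mv_wedge 0 m (mv_fun f) E p \<xi>s = 0" using mv_wedge_outside[OF mv_fun_field[OF f] E] by simp
    then show ?thesis using multivectors_outside[OF multivector_field_at[OF E] False] by (simp add: smul_def)
  qed
qed

lemma multivector_field_smul:
  assumes "E \<in> MV k" "f \<in> SF" shows "smul f E \<in> MV k"
proof -
  have "smul f E p \<in> multivectors A k p" for p
    using multivector_field_at[OF assms(1), of p] unfolding multivectors_def smul_def by (auto simp: algebra_simps)
  moreover have "mv_eval (smul f E) \<alpha>s \<in> SF" if "length \<alpha>s = k" "set \<alpha>s \<subseteq> OF" for \<alpha>s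
    using mv_eval_smooth[OF assms(1) that] assms(2) by (simp add: mv_eval_smul smooth_mult)
  ultimately show ?thesis by (simp add: multivector_fields_def)
qed

lemma multivector_field_add:
  assumes "D \<in> MV k" "E \<in> MV k" shows "D + E \<in> MV k"
proof -
  have "(D + E) p \<in> multivectors A k p" for p
    using multivector_field_at[OF assms(1), of p] multivector_field_at[OF assms(2), of p]
    unfolding multivectors_def by (auto simp: algebra_simps)
  moreover have "mv_eval (D + E) \<alpha>s \<in> SF" if "length \<alpha>s = k" "set \<alpha>s \<subseteq> OF" for \<alpha>s
    using mv_eval_smooth[OF assms(1) that] mv_eval_smooth[OF assms(2) that] by (simp add: mv_eval_add smooth_add)
  ultimately show ?thesis by (simp add: multivector_fields_def)
qed

lemma multivector_field_0: "0 \<in> MV k"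
  using smooth_0 by (auto simp: multivector_fields_def multivectors_def mv_eval_def zero_fun_def)

lemma multivector_field_sum: "(\<And>i. i \<in> I \<Longrightarrow> E i \<in> MV k) \<Longrightarrow> (\<Sum>i\<in>I. E i) \<in> MV k"
  by (induction I rule: infinite_finite_induct) (auto intro: multivector_field_0 multivector_field_add)

lemma mv_eval_wedge_1_0:
  "mv_eval (mv_wedge 1 0 D (mv_fun f)) [\<alpha>] = f * mv_eval D [\<alpha>]"
  by (rule ext) (simp add: mv_eval_def mv_wedge_alternating_sum alternating_sum_Suc alternating_sum_0 mv_fun_def)

lemma mv_eval_wedge_1_1:
  "mv_eval (mv_wedge 1 1 D E) [\<alpha>, \<beta>] = mv_eval D [\<alpha>] * mv_eval E [\<beta>] - mv_eval D [\<beta>] * mv_eval E [\<alpha>]"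
  by (rule ext) (simp add: mv_eval_def mv_wedge_1_1[simplified])

lemma mv_eval_wedge_1_2:
  assumes "E \<in> MV 2" "\<alpha> \<in> OF" "\<beta> \<in> OF" "\<gamma> \<in> OF"
  shows "mv_eval (mv_wedge 1 2 D E) [\<alpha>, \<beta>, \<gamma>] = mv_eval D [\<alpha>] * mv_eval E [\<beta>, \<gamma>]
     - mv_eval D [\<beta>] * mv_eval E [\<alpha>, \<gamma>] + mv_eval D [\<gamma>] * mv_eval E [\<alpha>, \<beta>]"
  using mv_wedge_1_2[OF assms(1) form_cotangent[OF assms(2)]
    form_cotangent[OF assms(3)] form_cotangent[OF assms(4)], of D]
  by (intro ext) (simp add: mv_eval_def)

lemma mv_eval_wedge_2_1:
  assumes "D \<in> MV 2" "\<alpha> \<in> OF" "\<beta> \<in> OF" "\<gamma> \<in> OF"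
  shows "mv_eval (mv_wedge 2 1 D E) [\<alpha>, \<beta>, \<gamma>] = mv_eval D [\<alpha>, \<beta>] * mv_eval E [\<gamma>]
     - mv_eval D [\<alpha>, \<gamma>] * mv_eval E [\<beta>] + mv_eval D [\<beta>, \<gamma>] * mv_eval E [\<alpha>]"
  using mv_wedge_2_1[OF assms(1) form_cotangent[OF assms(2)]
    form_cotangent[OF assms(3)] form_cotangent[OF assms(4)], of E]
  by (intro ext) (simp add: mv_eval_def)

lemma mv_eval_wedge_2_2:
  assumes "D \<in> MV 2" "E \<in> MV 2" "\<alpha> \<in> OF" "\<beta> \<in> OF" "\<gamma> \<in> OF" "\<delta> \<in> OF"
  shows "mv_eval (mv_wedge 2 2 D E) [\<alpha>, \<beta>, \<gamma>, \<delta>] =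
     mv_eval D [\<alpha>, \<beta>] * mv_eval E [\<gamma>, \<delta>] - mv_eval D [\<alpha>, \<gamma>] * mv_eval E [\<beta>, \<delta>]
     + mv_eval D [\<alpha>, \<delta>] * mv_eval E [\<beta>, \<gamma>] + mv_eval D [\<beta>, \<gamma>] * mv_eval E [\<alpha>, \<delta>]
     - mv_eval D [\<beta>, \<delta>] * mv_eval E [\<alpha>, \<gamma>] + mv_eval D [\<gamma>, \<delta>] * mv_eval E [\<alpha>, \<beta>]"
  using mv_wedge_2_2[OF assms(1,2) form_cotangent[OF assms(3)]
    form_cotangent[OF assms(4)] form_cotangent[OF assms(5)] form_cotangent[OF assms(6)]]
  by (intro ext) (simp add: mv_eval_def)

lemma mv_eval_wedge_1_3:
  assumes "E \<in> MV 3" "\<alpha> \<in> OF" "\<beta> \<in> OF" "\<gamma> \<in> OF" "\<delta> \<in> OF"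
  shows "mv_eval (mv_wedge 1 3 D E) [\<alpha>, \<beta>, \<gamma>, \<delta>] = mv_eval D [\<alpha>] * mv_eval E [\<beta>, \<gamma>, \<delta>]
     - mv_eval D [\<beta>] * mv_eval E [\<alpha>, \<gamma>, \<delta>] + mv_eval D [\<gamma>] * mv_eval E [\<alpha>, \<beta>, \<delta>]
     - mv_eval D [\<delta>] * mv_eval E [\<alpha>, \<beta>, \<gamma>]"
  using mv_wedge_1_3[OF assms(1) form_cotangent[OF assms(2)]
    form_cotangent[OF assms(3)] form_cotangent[OF assms(4)] form_cotangent[OF assms(5)], of D]
  by (intro ext) (simp add: mv_eval_def)

lemma multivector_linear1:
  assumes "D \<in> multivectors A 1 p" "\<eta> \<in> CS p" "\<zeta> \<in> CS p"
  shows "D [\<lambda>v. a * \<eta> v + b * \<zeta> v] = a * D [\<eta>] + b * D [\<zeta>]"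
  using multivectors_linear[OF assms(1), of "[\<eta>]" 0 \<eta> \<zeta> a b] assms by simp

lemma mv_wedge_1_1_field:
  assumes D: "D \<in> MV 1" and E: "E \<in> MV 1"
  shows "mv_wedge 1 1 D E \<in> MV 2"
proof -
  note Dp = multivector_field_at[OF D] and Ep = multivector_field_at[OF E]
  have "mv_wedge 1 1 D E p \<in> multivectors A 2 p" for p
  proof (rule multivectors2I)
    show "mv_wedge 1 1 D E p \<xi>s = 0" if "\<not> (length \<xi>s = 2 \<and> set \<xi>s \<subseteq> CS p)" for \<xi>s
      by (rule mv_wedge_outside[OF D E]) (use that in simp)
  qed (simp_all only: mv_wedge_1_1 multivector_linear1[OF Dp] multivector_linear1[OF Ep], simp_all add: algebra_simps)
  moreover have "mv_eval (mv_wedge 1 1 D E) \<alpha>s \<in> SF" if len: "length \<alpha>s = 2" and "set \<alpha>s \<subseteq> OF" for \<alpha>s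
  proof -
    obtain \<alpha> \<beta> where "\<alpha>s = [\<alpha>, \<beta>]" using len by (auto simp: numeral_2_eq_2 length_Suc_conv)
    then show ?thesis using that(2) unfolding \<open>\<alpha>s = _\<close> mv_eval_wedge_1_1
      by (intro smooth_diff smooth_mult mv_eval_smooth[OF D] mv_eval_smooth[OF E]) auto
  qed
  ultimately show ?thesis by (simp add: multivector_fields_def)
qed

lemma mv_wedge_1_2_field:
  assumes D: "D \<in> MV 1" and E: "E \<in> MV 2"
  shows "mv_wedge 1 2 D E \<in> MV 3"
proof -
  note Dp = multivector_field_at[OF D] and Ep = multivector_field_at[OF E]
  have "mv_wedge 1 2 D E p \<in> multivectors A 3 p" for p
  proof (rule multivectors3I)
    show "mv_wedge 1 2 D E p \<xi>s = 0" if "\<not> (length \<xi>s = 3 \<and> set \<xi>s \<subseteq> CS p)" for \<xi>s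
      by (rule mv_wedge_outside[OF D E]) (use that in simp)
  next
    fix \<eta> \<zeta> \<xi> \<xi>' a b assume *: "\<eta> \<in> CS p" "\<zeta> \<in> CS p" "\<xi> \<in> CS p" "\<xi>' \<in> CS p"
    show "mv_wedge 1 2 D E p [\<lambda>v. a * \<eta> v + b * \<zeta> v, \<xi>, \<xi>'] =
       a * mv_wedge 1 2 D E p [\<eta>, \<xi>, \<xi>'] + b * mv_wedge 1 2 D E p [\<zeta>, \<xi>, \<xi>']"
      unfolding mv_wedge_1_2[OF E cotangent_space_lincomb[OF *(1,2)] *(3,4)] mv_wedge_1_2[OF E *(1,3,4)]
        mv_wedge_1_2[OF E *(2,3,4)] multivector_linear1[OF Dp *(1,2)]
        multivector_linear2[OF Ep *(3,1,2)] multivector_linear2[OF Ep *(4,1,2)]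
      by (simp add: algebra_simps)
  next
    fix \<xi> \<eta> \<zeta> assume *: "\<xi> \<in> CS p" "\<eta> \<in> CS p" "\<zeta> \<in> CS p"
    show "mv_wedge 1 2 D E p [\<eta>, \<xi>, \<zeta>] = - mv_wedge 1 2 D E p [\<xi>, \<eta>, \<zeta>]"
      "mv_wedge 1 2 D E p [\<xi>, \<zeta>, \<eta>] = - mv_wedge 1 2 D E p [\<xi>, \<eta>, \<zeta>]"
      unfolding mv_wedge_1_2[OF E *] mv_wedge_1_2[OF E *(2,1,3)] mv_wedge_1_2[OF E *(1,3,2)]
      using multivector_swap2[OF Ep *(1,2)] multivector_swap2[OF Ep *(2,3)] by (simp_all add: algebra_simps)
  qed
  moreover have "mv_eval (mv_wedge 1 2 D E) \<alpha>s \<in> SF" if len: "length \<alpha>s = 3" and "set \<alpha>s \<subseteq> OF" for \<alpha>s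
  proof -
    obtain \<alpha> \<beta> \<gamma> where \<alpha>s: "\<alpha>s = [\<alpha>, \<beta>, \<gamma>]" using len by (auto simp: numeral_3_eq_3 length_Suc_conv)
    then have *: "\<alpha> \<in> OF" "\<beta> \<in> OF" "\<gamma> \<in> OF" using that(2) by auto
    show ?thesis unfolding \<alpha>s mv_eval_wedge_1_2[OF E *]
      by (intro smooth_add smooth_diff smooth_mult mv_eval_smooth[OF D] mv_eval_smooth[OF E]) (use * in auto)
  qed
  ultimately show ?thesis by (simp add: multivector_fields_def)
qed

lemma multivectors_sum:
  assumes D: "D \<in> multivectors A (Suc k) p" and r: "length r = k" "set r \<subseteq> CS p"
  shows "(\<And>i. i \<in> I \<Longrightarrow> V i \<in> CS p) \<Longrightarrow> D ((\<lambda>v. \<Sum>i\<in>I. c i * V i v) # r) = (\<Sum>i\<in>I. c i * D (V i # r))"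
proof (induction I rule: infinite_finite_induct)
  case (insert i I)
  let ?s = "\<lambda>v. \<Sum>i\<in>I. c i * V i v"
  have s: "?s \<in> CS p" using insert by (intro cotangent_space_sum) auto
  have "D ((\<lambda>v. c i * V i v + 1 * ?s v) # r) = c i * D (V i # r) + 1 * D (?s # r)"
    using multivectors_linear[OF D, of "V i # r" 0 "V i" ?s "c i" 1] insert.prems r s by simp
  then show ?case using insert by simp
qed (use multivectors_linear[OF D, of "(\<lambda>_. 0) # r" 0 "\<lambda>_. 0" "\<lambda>_. 0" 0 0] r in \<open>simp_all add: cotangent_space_0\<close>)

end

context framed_space
begin

text \<open>This is the expansion of \<open>\<alpha>\<close> in the frame, inserted into the first slot.\<close>

lemma local_frame_contract:
  assumes F: "local_frame A p I \<rho> x e" and E: "E \<in> MV (Suc k)" and \<alpha>: "\<alpha> \<in> OF"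
    and \<beta>s: "length \<beta>s = k" "set \<beta>s \<subseteq> OF"
  shows "(\<Sum>i\<in>I. pairing \<alpha> (e i) * mv_eval E (d (x i) # \<beta>s)) = \<rho> * mv_eval E (\<alpha> # \<beta>s)"
proof
  fix q
  let ?r = "map (\<lambda>\<alpha>. \<alpha> q) \<beta>s"
  note Eq = multivector_field_at[OF E, of q] and \<alpha>q = form_cotangent[OF \<alpha>, of q]
  have r: "length ?r = k" "set ?r \<subseteq> CS q" using \<beta>s form_cotangent by auto
  have "E q ((\<lambda>v. \<rho> q * \<alpha> q v + 0 * \<alpha> q v) # ?r) = \<rho> q * E q (\<alpha> q # ?r) + 0 * E q (\<alpha> q # ?r)"
    using multivectors_linear[OF Eq, of "\<alpha> q # ?r" 0 "\<alpha> q" "\<alpha> q" "\<rho> q" 0] r \<alpha>q by simp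
  then show "(\<Sum>i\<in>I. pairing \<alpha> (e i) * mv_eval E (d (x i) # \<beta>s)) q = (\<rho> * mv_eval E (\<alpha> # \<beta>s)) q"
    using multivectors_sum[OF Eq r, of I "\<lambda>i. d (x i) q" "\<lambda>i. \<alpha> q (e i q)"] local_frame_covector[OF F \<alpha>q]
    by (simp add: sum_fun_apply mv_eval_def pairing_def differential_cotangent)
qed

text \<open>Contraction followed by the wedge product counts degrees: $\sum_i e_i \wedge \iota_{dx_i} Q$ is
  $k$ times $\rho Q$ for \<open>Q\<close> of degree $k$. This avoids coefficient functions and reduces the
  degree by one at a time. The factor is written as a sum of copies of \<open>\<rho>\<close> to stay inside the algebra
  operations.\<close>

lemma local_frame_bivector:
  assumes F: "local_frame A p I \<rho> x e" and Q: "Q \<in> MV 2"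
  shows "smul (\<rho> + \<rho>) Q = (\<Sum>i\<in>I. mv_wedge 1 1 (mv_vec A (e i)) (iota (d (x i)) Q))"
    and "i \<in> I \<Longrightarrow> mv_wedge 1 1 (mv_vec A (e i)) (iota (d (x i)) Q) \<in> MV 2"
proof -
  note D = local_frameD[OF F]
  have Q': "Q \<in> MV (Suc 1)" using Q by (simp add: numeral_2_eq_2)
  show m: "i \<in> I \<Longrightarrow> mv_wedge 1 1 (mv_vec A (e i)) (iota (d (x i)) Q) \<in> MV 2" for i
    by (intro mv_wedge_1_1_field mv_vec_field iota_field[OF Q'] D differential_form)
  show "smul (\<rho> + \<rho>) Q = (\<Sum>i\<in>I. mv_wedge 1 1 (mv_vec A (e i)) (iota (d (x i)) Q))"
  proof (rule multivector_field_eqI)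
    show "smul (\<rho> + \<rho>) Q \<in> MV 2" by (intro multivector_field_smul Q smooth_add D)
    show "(\<Sum>i\<in>I. mv_wedge 1 1 (mv_vec A (e i)) (iota (d (x i)) Q)) \<in> MV 2" by (intro multivector_field_sum m)
    fix \<alpha>s :: "('m \<Rightarrow> 'm covec) list" assume "length \<alpha>s = 2" "set \<alpha>s \<subseteq> OF"
    then obtain \<alpha> \<beta> where \<alpha>s: "\<alpha>s = [\<alpha>, \<beta>]" and *: "\<alpha> \<in> OF" "\<beta> \<in> OF" by (auto simp: numeral_2_eq_2 length_Suc_conv)
    show "mv_eval (smul (\<rho> + \<rho>) Q) \<alpha>s = mv_eval (\<Sum>i\<in>I. mv_wedge 1 1 (mv_vec A (e i)) (iota (d (x i)) Q)) \<alpha>s"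
      unfolding \<alpha>s mv_eval_sum mv_eval_wedge_1_1 mv_eval_smul mv_eval_iota mv_eval_vec[OF *(1)] mv_eval_vec[OF *(2)] sum_subtractf
      using local_frame_contract[OF F Q' *(1), of "[\<beta>]"] local_frame_contract[OF F Q' *(2), of "[\<alpha>]"] mv_eval2_swap[OF Q *] *
      by (simp add: algebra_simps)
  qed
qed

lemma local_frame_trivector:
  assumes F: "local_frame A p I \<rho> x e" and Q: "Q \<in> MV 3"
  shows "smul (\<rho> + \<rho> + \<rho>) Q = (\<Sum>i\<in>I. mv_wedge 1 2 (mv_vec A (e i)) (iota (d (x i)) Q))"
    and "i \<in> I \<Longrightarrow> mv_wedge 1 2 (mv_vec A (e i)) (iota (d (x i)) Q) \<in> MV 3"
proof -
  note D = local_frameD[OF F]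
  have Q': "Q \<in> MV (Suc 2)" using Q by (simp add: numeral_3_eq_3)
  note io = iota_field[OF Q' differential_form[OF D(4)]]
  show m: "i \<in> I \<Longrightarrow> mv_wedge 1 2 (mv_vec A (e i)) (iota (d (x i)) Q) \<in> MV 3" for i
    by (intro mv_wedge_1_2_field mv_vec_field D io)
  show "smul (\<rho> + \<rho> + \<rho>) Q = (\<Sum>i\<in>I. mv_wedge 1 2 (mv_vec A (e i)) (iota (d (x i)) Q))"
  proof (rule multivector_field_eqI)
    show "smul (\<rho> + \<rho> + \<rho>) Q \<in> MV 3" by (intro multivector_field_smul Q smooth_add D)
    show "(\<Sum>i\<in>I. mv_wedge 1 2 (mv_vec A (e i)) (iota (d (x i)) Q)) \<in> MV 3" by (intro multivector_field_sum m)
    fix \<alpha>s :: "('m \<Rightarrow> 'm covec) list" assume "length \<alpha>s = 3" "set \<alpha>s \<subseteq> OF"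
    then obtain \<alpha> \<beta> \<gamma> where \<alpha>s: "\<alpha>s = [\<alpha>, \<beta>, \<gamma>]" and *: "\<alpha> \<in> OF" "\<beta> \<in> OF" "\<gamma> \<in> OF"
      by (auto simp: numeral_3_eq_3 length_Suc_conv)
    have "mv_eval (\<Sum>i\<in>I. mv_wedge 1 2 (mv_vec A (e i)) (iota (d (x i)) Q)) \<alpha>s =
       (\<Sum>i\<in>I. pairing \<alpha> (e i) * mv_eval Q [d (x i), \<beta>, \<gamma>] - pairing \<beta> (e i) * mv_eval Q [d (x i), \<alpha>, \<gamma>]
          + pairing \<gamma> (e i) * mv_eval Q [d (x i), \<alpha>, \<beta>])"
      unfolding \<alpha>s mv_eval_sum
      by (rule sum.cong) (simp_all add: mv_eval_wedge_1_2[OF io *] mv_eval_iota mv_eval_vec * del: One_nat_def)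
    then show "mv_eval (smul (\<rho> + \<rho> + \<rho>) Q) \<alpha>s = mv_eval (\<Sum>i\<in>I. mv_wedge 1 2 (mv_vec A (e i)) (iota (d (x i)) Q)) \<alpha>s"
      using local_frame_contract[OF F Q' *(1), of "[\<beta>, \<gamma>]"] local_frame_contract[OF F Q' *(2), of "[\<alpha>, \<gamma>]"]
        local_frame_contract[OF F Q' *(3), of "[\<alpha>, \<beta>]"] mv_eval3_swap(1)[OF Q *] mv_eval3_swap(1)[OF Q *(1,3,2)]
        mv_eval3_swap(2)[OF Q *] *
      by (simp add: \<alpha>s mv_eval_smul sum.distrib sum_subtractf algebra_simps)
  qed
qed

end

section \<open>The Schouten bracket with a bivector field as a coboundary\<close>

context smooth_algebra
begin

text \<open>The almost Poisson bracket of \<open>P\<close>; it satisfies the Jacobi identity only up to $\frac12[P,P]$.\<close>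

definition poisson :: "('m \<Rightarrow> 'm mvec) \<Rightarrow> ('m \<Rightarrow> real) \<Rightarrow> ('m \<Rightarrow> real) \<Rightarrow> 'm \<Rightarrow> real" where
  "poisson P f g = mv_eval P [d f, d g]"

definition triple :: "('m \<Rightarrow> 'm mvec) \<Rightarrow> ('m \<Rightarrow> real) \<Rightarrow> ('m \<Rightarrow> real) \<Rightarrow> ('m \<Rightarrow> real) \<Rightarrow> 'm \<Rightarrow> real" where
  "triple E f g h = mv_eval E [d f, d g, d h]"

lemma poisson_smooth: "P \<in> MV 2 \<Longrightarrow> f \<in> SF \<Longrightarrow> g \<in> SF \<Longrightarrow> poisson P f g \<in> SF"
  by (simp add: poisson_def mv_eval2_smooth differential_form)

lemma triple_smooth: "E \<in> MV 3 \<Longrightarrow> f \<in> SF \<Longrightarrow> g \<in> SF \<Longrightarrow> h \<in> SF \<Longrightarrow> triple E f g h \<in> SF"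
  by (simp add: triple_def mv_eval3_smooth differential_form)

context
  fixes P assumes P: "P \<in> MV 2"
begin

lemma poisson_add: "f \<in> SF \<Longrightarrow> g \<in> SF \<Longrightarrow> h \<in> SF \<Longrightarrow> poisson P f (g + h) = poisson P f g + poisson P f h"
  by (simp add: poisson_def differential_add mv_eval2_add[OF P] differential_form)

lemma poisson_mult: "f \<in> SF \<Longrightarrow> g \<in> SF \<Longrightarrow> h \<in> SF \<Longrightarrow> poisson P f (g * h) = g * poisson P f h + h * poisson P f g"
  by (simp add: poisson_def differential_mult mv_eval2_add[OF P] mv_eval2_smul[OF P] differential_form one_form_smul)

lemma poisson_minus: "f \<in> SF \<Longrightarrow> g \<in> SF \<Longrightarrow> poisson P f (- g) = - poisson P f g"
  by (simp add: poisson_def differential_minus mv_eval2_minus[OF P] differential_form)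

lemma poisson_diff: "f \<in> SF \<Longrightarrow> g \<in> SF \<Longrightarrow> h \<in> SF \<Longrightarrow> poisson P f (g - h) = poisson P f g - poisson P f h"
  using poisson_add[of f g "- h"] poisson_minus[of f h] by (simp add: smooth_minus)

lemma poisson_0: "f \<in> SF \<Longrightarrow> poisson P f 0 = 0"
  using poisson_diff[of f 0 0] by (simp add: smooth_0)

lemma poisson_sum:
  "f \<in> SF \<Longrightarrow> (\<And>i. i \<in> I \<Longrightarrow> F i \<in> SF) \<Longrightarrow> poisson P f (\<Sum>i\<in>I. F i) = (\<Sum>i\<in>I. poisson P f (F i))"
  by (induction I rule: infinite_finite_induct) (auto simp: poisson_0 poisson_add smooth_sum)

lemma poisson_swap: "f \<in> SF \<Longrightarrow> g \<in> SF \<Longrightarrow> poisson P g f = - poisson P f g"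
  unfolding poisson_def by (intro mv_eval2_swap P differential_form)

end

text \<open>The Chevalley--Eilenberg differential of the skew bracket \<open>poisson P\<close> on cochains of degree one,
  two and three. Its square does not vanish without the Jacobi identity.\<close>

definition coboundary1 :: "('m \<Rightarrow> 'm mvec) \<Rightarrow> (('m \<Rightarrow> real) \<Rightarrow> 'm \<Rightarrow> real) \<Rightarrow> ('m \<Rightarrow> real) \<Rightarrow> ('m \<Rightarrow> real) \<Rightarrow> 'm \<Rightarrow> real" where
  "coboundary1 P B f g = poisson P f (B g) - poisson P g (B f) - B (poisson P f g)"

definition coboundary2 where
  "coboundary2 P B f g h = poisson P f (B g h) - poisson P g (B f h) + poisson P h (B f g)
     - B (poisson P f g) h + B (poisson P f h) g - B (poisson P g h) f"

definition coboundary3 where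
  "coboundary3 P B f g h k = poisson P f (B g h k) - poisson P g (B f h k) + poisson P h (B f g k) - poisson P k (B f g h)
     - B (poisson P f g) h k + B (poisson P f h) g k - B (poisson P f k) g h - B (poisson P g h) f k + B (poisson P g k) f h - B (poisson P h k) f g"

end

locale schouten_space = framed_space A
  for A :: "('m::topological_space, 'e::euclidean_space) atlas" +
  fixes br :: "('m \<Rightarrow> 'm mvec) \<Rightarrow> ('m \<Rightarrow> 'm mvec) \<Rightarrow> 'm \<Rightarrow> 'm mvec"
  assumes schouten: "schouten_bracket A br"
begin

lemmas schouten_axioms = schouten[unfolded schouten_bracket_def]

lemma br_field: "D \<in> MV k \<Longrightarrow> E \<in> MV l \<Longrightarrow> br D E \<in> MV (k + l - 1)"
  using schouten_axioms[THEN conjunct1] by blast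

lemma br_linear:
  "D \<in> MV k \<Longrightarrow> E \<in> MV l \<Longrightarrow> E' \<in> MV l \<Longrightarrow> br D (mv_scale a E + mv_scale b E') = mv_scale a (br D E) + mv_scale b (br D E')"
  using schouten_axioms[THEN conjunct2, THEN conjunct1] by blast

lemma br_fun_fun: "f \<in> SF \<Longrightarrow> g \<in> SF \<Longrightarrow> br (mv_fun f) (mv_fun g) = 0"
  using schouten_axioms[THEN conjunct2, THEN conjunct2, THEN conjunct1] by blast

lemma br_vec_fun: "X \<in> VF \<Longrightarrow> f \<in> SF \<Longrightarrow> br (mv_vec A X) (mv_fun f) = mv_fun (der X f)"
  using schouten_axioms[THEN conjunct2, THEN conjunct2, THEN conjunct2, THEN conjunct1]
  by (simp add: der_def)

lemma br_vec_vec: "X \<in> VF \<Longrightarrow> Y \<in> VF \<Longrightarrow> br (mv_vec A X) (mv_vec A Y) = mv_vec A (lie_bracket X Y)"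
  using schouten_axioms[THEN conjunct2, THEN conjunct2, THEN conjunct2, THEN conjunct2, THEN conjunct1] by blast

lemma br_wedge: "D \<in> MV k \<Longrightarrow> E \<in> MV l \<Longrightarrow> F \<in> MV m \<Longrightarrow> br D (mv_wedge l m E F) =
    mv_wedge (k + l - 1) m (br D E) F + mv_scale ((-1) ^ ((k + 1) * l)) (mv_wedge l (k + m - 1) E (br D F))"
  using schouten_axioms[THEN conjunct2, THEN conjunct2, THEN conjunct2, THEN conjunct2, THEN conjunct2, THEN conjunct1] by blast

lemma br_skew: "D \<in> MV k \<Longrightarrow> E \<in> MV l \<Longrightarrow> br D E = mv_scale (- ((-1) ^ ((k + 1) * (l + 1)))) (br E D)"
  using schouten_axioms[THEN conjunct2, THEN conjunct2, THEN conjunct2, THEN conjunct2, THEN conjunct2, THEN conjunct2] by blast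

lemma br_add: "D \<in> MV k \<Longrightarrow> E \<in> MV l \<Longrightarrow> E' \<in> MV l \<Longrightarrow> br D (E + E') = br D E + br D E'"
  using br_linear[of D k E l E' 1 1] by (simp add: mv_scale_def)

lemma br_0: "D \<in> MV k \<Longrightarrow> br D 0 = 0"
  using br_linear[of D k 0 0 0 0 0] multivector_field_0[of 0] by (simp add: mv_scale_def func_plus func_zero)

lemma br_sum:
  assumes D: "D \<in> MV k"
  shows "(\<And>i. i \<in> I \<Longrightarrow> E i \<in> MV l) \<Longrightarrow> br D (\<Sum>i\<in>I. E i) = (\<Sum>i\<in>I. br D (E i))"
proof (induction I rule: infinite_finite_induct)
  case (insert i I)
  have "br D (E i + (\<Sum>i\<in>I. E i)) = br D (E i) + br D (\<Sum>i\<in>I. E i)"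
    using insert.prems by (intro br_add[OF D] multivector_field_sum) auto
  moreover have "br D (\<Sum>i\<in>I. E i) = (\<Sum>i\<in>I. br D (E i))"
    using insert.prems by (intro insert.IH) auto
  ultimately show ?case by (simp only: sum.insert[OF insert.hyps])
qed (simp_all add: br_0[OF D])

text \<open>Here and below the degree \<open>k - 1\<close> is that of the bracket with a function.\<close>

lemma br_smul:
  assumes D: "D \<in> MV k" and E: "E \<in> MV m" and f: "f \<in> SF"
  shows "br D (smul f E) = mv_wedge (k - 1) m (br D (mv_fun f)) E + mv_wedge 0 (k + m - 1) (mv_fun f) (br D E)"
  using br_wedge[OF D mv_fun_field[OF f] E] by (simp add: mv_wedge_fun_smul[OF E f] mv_scale_def)

lemma br_fun_vec:
  assumes "f \<in> SF" "X \<in> VF" shows "br (mv_fun f) (mv_vec A X) = mv_fun (- der X f)"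
  using br_skew[OF mv_fun_field[OF assms(1)] mv_vec_field[OF assms(2)]] br_vec_fun[OF assms(2,1)]
  by (intro ext) (simp add: mv_scale_def mv_fun_def)

text \<open>The bracket is known on the right-hand side once it is known on vector fields, and on the left-hand
  side it can be isolated at a point where \<open>\<rho>\<close> is \<open>1\<close>. The remaining term, with the bracket of the bump
  factor, is known from functions.\<close>

lemma br_bivector_frame:
  assumes D: "D \<in> MV k" and Q: "Q \<in> MV 2" and F: "local_frame A p I \<rho> x e"
  shows "mv_wedge (k - 1) 2 (br D (mv_fun (\<rho> + \<rho>))) Q + mv_wedge 0 (k + 1) (mv_fun (\<rho> + \<rho>)) (br D Q) =
    (\<Sum>i\<in>I. mv_wedge k 1 (br D (mv_vec A (e i))) (iota (d (x i)) Q) +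
        mv_scale ((-1) ^ (k + 1)) (mv_wedge 1 k (mv_vec A (e i)) (br D (iota (d (x i)) Q))))"
proof -
  note FD = local_frameD[OF F]
  have Q': "Q \<in> MV (Suc 1)" using Q by (simp add: numeral_2_eq_2)
  have "br D (smul (\<rho> + \<rho>) Q) = (\<Sum>i\<in>I. br D (mv_wedge 1 1 (mv_vec A (e i)) (iota (d (x i)) Q)))"
    unfolding local_frame_bivector(1)[OF F Q] by (rule br_sum[OF D local_frame_bivector(2)[OF F Q]])
  also have "\<dots> = (\<Sum>i\<in>I. mv_wedge k 1 (br D (mv_vec A (e i))) (iota (d (x i)) Q) +
        mv_scale ((-1) ^ (k + 1)) (mv_wedge 1 k (mv_vec A (e i)) (br D (iota (d (x i)) Q))))"
    using br_wedge[OF D mv_vec_field iota_field[OF Q' differential_form]] FD by (intro sum.cong) auto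
  finally show ?thesis using br_smul[OF D Q smooth_add[OF FD(2,2)]] by simp
qed

lemma br_trivector_frame:
  assumes D: "D \<in> MV k" and Q: "Q \<in> MV 3" and F: "local_frame A p I \<rho> x e"
  shows "mv_wedge (k - 1) 3 (br D (mv_fun (\<rho> + \<rho> + \<rho>))) Q + mv_wedge 0 (k + 2) (mv_fun (\<rho> + \<rho> + \<rho>)) (br D Q) =
    (\<Sum>i\<in>I. mv_wedge k 2 (br D (mv_vec A (e i))) (iota (d (x i)) Q) +
        mv_scale ((-1) ^ (k + 1)) (mv_wedge 1 (k + 1) (mv_vec A (e i)) (br D (iota (d (x i)) Q))))"
proof -
  note FD = local_frameD[OF F]
  have Q': "Q \<in> MV (Suc 2)" using Q by (simp add: numeral_3_eq_3)
  have "br D (smul (\<rho> + \<rho> + \<rho>) Q) = (\<Sum>i\<in>I. br D (mv_wedge 1 2 (mv_vec A (e i)) (iota (d (x i)) Q)))"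
    unfolding local_frame_trivector(1)[OF F Q] by (rule br_sum[OF D local_frame_trivector(2)[OF F Q]])
  also have "\<dots> = (\<Sum>i\<in>I. mv_wedge k 2 (br D (mv_vec A (e i))) (iota (d (x i)) Q) +
        mv_scale ((-1) ^ (k + 1)) (mv_wedge 1 (k + 1) (mv_vec A (e i)) (br D (iota (d (x i)) Q))))"
    using br_wedge[OF D mv_vec_field iota_field[OF Q' differential_form]] FD by (intro sum.cong) auto
  finally show ?thesis using br_smul[OF D Q smooth_add[OF smooth_add[OF FD(2,2)] FD(2)]] by simp
qed

lemma mv_eval_scale: "mv_eval (mv_scale c E) \<alpha>s = (\<lambda>_. c) * mv_eval E \<alpha>s"
  by (simp add: mv_scale_smul mv_eval_smul)

lemma iota_differential_bivector:
  assumes Q: "Q \<in> MV 2" and f: "f \<in> SF"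
  obtains q where "q \<in> VF" "iota (d f) Q = mv_vec A q" "\<And>g. der q g = poisson Q f g"
    "\<And>\<beta>. \<beta> \<in> OF \<Longrightarrow> pairing \<beta> q = mv_eval Q [d f, \<beta>]"
proof (rule that)
  show "on_sections (sharp A Q) (d f) \<in> VF" by (rule sharp_field[OF Q differential_form[OF f]])
  show "iota (d f) Q = mv_vec A (on_sections (sharp A Q) (d f))"
    by (rule iota_bivector[OF Q differential_form[OF f]])
  show "der (on_sections (sharp A Q) (d f)) g = poisson Q f g" for g
    unfolding poisson_def by (rule der_sharp[OF Q differential_form[OF f]])
  show "pairing \<beta> (on_sections (sharp A Q) (d f)) = mv_eval Q [d f, \<beta>]" if "\<beta> \<in> OF" for \<beta>
    by (rule pairing_sharp[OF Q differential_form[OF f] that])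
qed

lemma mv_wedge_zero_left: "mv_wedge k l 0 E = 0"
  by (intro ext) (simp add: mv_wedge_def)

lemma br_fun_bivector:
  assumes g: "g \<in> SF" and Q: "Q \<in> MV 2" and \<alpha>: "\<alpha> \<in> OF"
  shows "mv_eval (br (mv_fun g) Q) [\<alpha>] = - mv_eval Q [d g, \<alpha>]"
proof
  fix p
  obtain I \<rho> x e where F: "local_frame A p I \<rho> x e" by (rule frameE)
  note FD = local_frameD[OF F]
  have Q': "Q \<in> MV (Suc 1)" using Q by (simp add: numeral_2_eq_2)
  note G = mv_fun_field[OF g] and dg = differential_form[OF g]
  have B: "br (mv_fun g) Q \<in> MV 1" using br_field[OF G Q] by simp
  define r where "r = \<rho> + \<rho>"
  have rr: "r \<in> SF" unfolding r_def by (intro smooth_add FD)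
  have i: "mv_eval (mv_wedge 0 1 (br (mv_fun g) (mv_vec A (e i))) (iota (d (x i)) Q) +
        mv_scale ((-1) ^ (0 + 1)) (mv_wedge 1 0 (mv_vec A (e i)) (br (mv_fun g) (iota (d (x i)) Q)))) [\<alpha>]
      = pairing \<alpha> (e i) * mv_eval Q [d (x i), d g] - pairing (d g) (e i) * mv_eval Q [d (x i), \<alpha>]"
    if i: "i \<in> I" for i
  proof -
    obtain q where q: "q \<in> VF" "iota (d (x i)) Q = mv_vec A q" "\<And>g. der q g = poisson Q (x i) g"
      "\<And>\<beta>. \<beta> \<in> OF \<Longrightarrow> pairing \<beta> q = mv_eval Q [d (x i), \<beta>]"
      using iota_differential_bivector[OF Q FD(4)[OF i]] by blast
    note ei = FD(5)[OF i]
    have "mv_wedge 0 1 (mv_fun (- der (e i) g)) (mv_vec A q) = smul (- der (e i) g) (mv_vec A q)"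
      by (rule mv_wedge_fun_smul[OF mv_vec_field[OF q(1)] smooth_minus[OF der_smooth[OF ei g]]])
    then show ?thesis
      unfolding q(2) br_fun_vec[OF g ei] br_fun_vec[OF g q(1)]
      by (simp add: mv_eval_add mv_eval_scale mv_eval_smul mv_eval_wedge_1_0[simplified] mv_eval_vec[OF \<alpha>] q(3,4) \<alpha>
        pairing_differential[OF ei] poisson_def) (simp add: fun_eq_iff algebra_simps)
  qed
  have "r * mv_eval (br (mv_fun g) Q) [\<alpha>] =
     (\<Sum>i\<in>I. pairing \<alpha> (e i) * mv_eval Q [d (x i), d g] - pairing (d g) (e i) * mv_eval Q [d (x i), \<alpha>])"
    using arg_cong[OF br_bivector_frame[OF G Q F, folded r_def], of "\<lambda>E. mv_eval E [\<alpha>]"] i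
    by (simp add: br_fun_fun[OF g rr] mv_wedge_zero_left mv_wedge_fun_smul[OF B[simplified] rr] mv_eval_sum mv_eval_smul)
  also have "\<dots> = \<rho> * mv_eval Q [\<alpha>, d g] - \<rho> * mv_eval Q [d g, \<alpha>]"
    using local_frame_contract[OF F Q' \<alpha>, of "[d g]"] local_frame_contract[OF F Q' dg, of "[\<alpha>]"] \<alpha> dg
    by (simp add: sum_subtractf)
  finally have "(r * mv_eval (br (mv_fun g) Q) [\<alpha>]) p = (\<rho> * mv_eval Q [\<alpha>, d g] - \<rho> * mv_eval Q [d g, \<alpha>]) p"
    by (rule fun_cong)
  then show "mv_eval (br (mv_fun g) Q) [\<alpha>] p = (- mv_eval Q [d g, \<alpha>]) p"
    using mv_eval2_swap[OF Q \<alpha> dg] FD(3) by (simp add: r_def)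
qed

lemma br_bivector_fun:
  assumes "P \<in> MV 2" "f \<in> SF" "\<alpha> \<in> OF"
  shows "mv_eval (br P (mv_fun f)) [\<alpha>] = - mv_eval P [d f, \<alpha>]"
  using br_skew[OF assms(1) mv_fun_field[OF assms(2)]] br_fun_bivector[OF assms(2,1,3)] by (simp add: mv_scale_def)

text \<open>The Lie derivative formula on exact forms. Both it and the bracket satisfy the Leibniz rule over the
  wedge products of the frame decomposition, and they agree on vector fields.\<close>

lemma br_vec_bivector:
  assumes X: "X \<in> VF" and Q: "Q \<in> MV 2" and f: "f \<in> SF" and g: "g \<in> SF"
  shows "mv_eval (br (mv_vec A X) Q) [d f, d g] = der X (poisson Q f g) - poisson Q (der X f) g - poisson Q f (der X g)"
proof
  fix p
  obtain I \<rho> x e where F: "local_frame A p I \<rho> x e" by (rule frameE)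
  note FD = local_frameD[OF F]
  have Q': "Q \<in> MV (Suc 1)" using Q by (simp add: numeral_2_eq_2)
  note G = mv_vec_field[OF X] and df = differential_form[OF f] and dg = differential_form[OF g]
  have B: "br (mv_vec A X) Q \<in> MV 2" using br_field[OF G Q] by (simp add: numeral_2_eq_2)
  define r where "r = \<rho> + \<rho>"
  have rr: "r \<in> SF" unfolding r_def by (intro smooth_add FD)
  have con: "(\<Sum>i\<in>I. der (e i) f * poisson Q (x i) g) = \<rho> * poisson Q f g" if "f \<in> SF" "g \<in> SF" for f g
  proof -
    have "(\<Sum>i\<in>I. der (e i) f * poisson Q (x i) g) = (\<Sum>i\<in>I. pairing (d f) (e i) * mv_eval Q [d (x i), d g])"
      using FD by (intro sum.cong) (simp_all add: pairing_differential poisson_def)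
    also have "\<dots> = \<rho> * poisson Q f g"
      using local_frame_contract[OF F Q' differential_form[OF that(1)], of "[d g]"] that by (simp add: differential_form poisson_def)
    finally show ?thesis .
  qed
  \<comment> \<open>The Lie derivative of one of the two tensor products that make up the \<open>i\<close>-th wedge product.\<close>
  define T where "T f g i = der X (der (e i) f * poisson Q (x i) g) - der (e i) (der X f) * poisson Q (x i) g
     - der (e i) f * poisson Q (x i) (der X g)" for f g i
  have i: "mv_eval (mv_wedge 1 1 (br (mv_vec A X) (mv_vec A (e i))) (iota (d (x i)) Q) +
        mv_scale ((-1) ^ (1 + 1)) (mv_wedge 1 1 (mv_vec A (e i)) (br (mv_vec A X) (iota (d (x i)) Q)))) [d f, d g]
      = T f g i - T g f i"
    if i: "i \<in> I" for i
  proof -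
    obtain q where q: "q \<in> VF" "iota (d (x i)) Q = mv_vec A q" "\<And>g. der q g = poisson Q (x i) g"
      using iota_differential_bivector[OF Q FD(4)[OF i]] by metis
    note ei = FD(5)[OF i]
    note L = lie_bracket_field[OF X ei] lie_bracket_field[OF X q(1)]
    have T: "T f g i = der X (der (e i) f * der q g) - der (e i) (der X f) * der q g - der (e i) f * der q (der X g)"
      for f g by (simp add: T_def q(3))
    have one: "(\<lambda>_. (-1) ^ (1 + 1)) = (1 :: 'm \<Rightarrow> real)" by (simp add: func_one)
    show ?thesis
      unfolding q(2) br_vec_vec[OF X ei] br_vec_vec[OF X q(1)] mv_eval_add mv_eval_scale mv_eval_wedge_1_1
        mv_eval_vec[OF df] mv_eval_vec[OF dg] T one
        pairing_differential[OF ei] pairing_differential[OF q(1)] pairing_differential[OF L(1)] pairing_differential[OF L(2)]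
        der_lie_bracket der_mult[OF X der_smooth[OF ei f] der_smooth[OF q(1) g]]
        der_mult[OF X der_smooth[OF ei g] der_smooth[OF q(1) f]]
      by (simp add: algebra_simps)
  qed
  have "mv_wedge 0 2 (br (mv_vec A X) (mv_fun r)) Q = smul (der X r) Q"
    unfolding br_vec_fun[OF X rr] by (rule mv_wedge_fun_smul[OF Q der_smooth[OF X rr]])
  then have "der X r * poisson Q f g + r * mv_eval (br (mv_vec A X) Q) [d f, d g] =
     (\<Sum>i\<in>I. T f g i - T g f i)"
    using arg_cong[OF br_bivector_frame[OF G Q F, folded r_def], of "\<lambda>E. mv_eval E [d f, d g]"] i
      mv_wedge_fun_smul[OF B rr]
    by (simp add: mv_eval_sum mv_eval_smul mv_eval_add poisson_def numeral_2_eq_2)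
  also have "\<dots> = (\<Sum>i\<in>I. T f g i) - (\<Sum>i\<in>I. T g f i)" by (rule sum_subtractf)
  also have T: "(\<Sum>i\<in>I. T f g i) = der X (\<rho> * poisson Q f g) - \<rho> * poisson Q (der X f) g - \<rho> * poisson Q f (der X g)"
    if "f \<in> SF" "g \<in> SF" for f g
  proof -
    have "(\<Sum>i\<in>I. T f g i) = der X (\<Sum>i\<in>I. der (e i) f * poisson Q (x i) g) - (\<Sum>i\<in>I. der (e i) (der X f) * poisson Q (x i) g)
       - (\<Sum>i\<in>I. der (e i) f * poisson Q (x i) (der X g))"
      using that X FD Q by (simp add: T_def sum_subtractf der_sum smooth_mult der_smooth poisson_smooth)
    then show ?thesis using that X by (simp add: con der_smooth)
  qed
  note T[OF f g]
  also note T[OF g f]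
  finally have "(der X r * poisson Q f g + r * mv_eval (br (mv_vec A X) Q) [d f, d g]) p =
     (der X (\<rho> * poisson Q f g) - \<rho> * poisson Q (der X f) g - \<rho> * poisson Q f (der X g) -
     (der X (\<rho> * poisson Q g f) - \<rho> * poisson Q (der X g) f - \<rho> * poisson Q g (der X f))) p" by (rule fun_cong)
  moreover have r': "der X r = der X \<rho> + der X \<rho>" unfolding r_def by (rule der_add[OF X FD(2,2)])
  moreover have rp: "r p = 2" using FD(3) by (simp add: r_def)
  ultimately show "mv_eval (br (mv_vec A X) Q) [d f, d g] p = (der X (poisson Q f g) - poisson Q (der X f) g - poisson Q f (der X g)) p"
    unfolding r'
    using FD(2,3) X Q f g rp
    by (simp add: smooth_mult poisson_swap[OF Q f g] poisson_swap[OF Q f der_smooth[OF X g]] poisson_swap[OF Q der_smooth[OF X f] g]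
        der_mult der_add der_minus poisson_smooth algebra_simps)
qed

lemma br_bivector_vec:
  assumes P: "P \<in> MV 2" and X: "X \<in> VF" and f: "f \<in> SF" and g: "g \<in> SF"
  shows "mv_eval (br P (mv_vec A X)) [d f, d g] = coboundary1 P (der X) f g"
proof -
  have "br P (mv_vec A X) = mv_scale (- 1) (br (mv_vec A X) P)"
    using br_skew[OF P mv_vec_field[OF X]] by simp
  then show ?thesis
    using poisson_swap[OF P g der_smooth[OF X f]]
    by (simp add: mv_eval_scale br_vec_bivector[OF X P f g] coboundary1_def) (simp add: fun_eq_iff)
qed

end

context framed_space
begin

lemma local_frame_contract_bivector:
  assumes F: "local_frame A p I \<rho> x e" and Q: "Q \<in> MV 2" and f: "f \<in> SF" and g: "g \<in> SF"
  shows "(\<Sum>i\<in>I. der (e i) f * poisson Q (x i) g) = \<rho> * poisson Q f g"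
proof -
  have Q': "Q \<in> MV (Suc 1)" using Q by (simp add: numeral_2_eq_2)
  have "(\<Sum>i\<in>I. der (e i) f * poisson Q (x i) g) = (\<Sum>i\<in>I. pairing (d f) (e i) * mv_eval Q [d (x i), d g])"
    using local_frameD[OF F] by (intro sum.cong) (simp_all add: pairing_differential poisson_def)
  also have "\<dots> = \<rho> * poisson Q f g"
    using local_frame_contract[OF F Q' differential_form[OF f], of "[d g]"] g by (simp add: differential_form poisson_def)
  finally show ?thesis .
qed

lemma local_frame_contract_trivector:
  assumes F: "local_frame A p I \<rho> x e" and Q: "Q \<in> MV 3" and f: "f \<in> SF" and g: "g \<in> SF" and h: "h \<in> SF"
  shows "(\<Sum>i\<in>I. der (e i) f * triple Q (x i) g h) = \<rho> * triple Q f g h"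
proof -
  have Q': "Q \<in> MV (Suc 2)" using Q by (simp add: numeral_3_eq_3)
  have "(\<Sum>i\<in>I. der (e i) f * triple Q (x i) g h) = (\<Sum>i\<in>I. pairing (d f) (e i) * mv_eval Q [d (x i), d g, d h])"
    using local_frameD[OF F] by (intro sum.cong) (simp_all add: pairing_differential triple_def)
  also have "\<dots> = \<rho> * triple Q f g h"
    using local_frame_contract[OF F Q' differential_form[OF f], of "[d g, d h]"] g h by (simp add: differential_form triple_def)
  finally show ?thesis .
qed

lemma triple_swap:
  assumes "E \<in> MV 3" "f \<in> SF" "g \<in> SF" "h \<in> SF"
  shows "triple E g f h = - triple E f g h" "triple E f h g = - triple E f g h" "triple E h g f = - triple E f g h"
  unfolding triple_def using mv_eval3_swap[OF assms(1) differential_form differential_form differential_form] assms by blast+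

end

context schouten_space
begin

text \<open>The coboundary is a derivation for the wedge product of two vector fields, and it satisfies the
  same Leibniz rule for the multiplication by \<open>r\<close>. Hence it agrees with the bracket on each summand of
  the frame decomposition and the terms with derivatives of \<open>r\<close> cancel.\<close>

lemma br_bivector_bivector:
  assumes P: "P \<in> MV 2" and Q: "Q \<in> MV 2" and f: "f \<in> SF" and g: "g \<in> SF" and h: "h \<in> SF"
  shows "mv_eval (br P Q) [d f, d g, d h] = coboundary2 P (poisson Q) f g h"
proof
  fix p
  obtain I \<rho> x e where F: "local_frame A p I \<rho> x e" by (rule frameE)
  note FD = local_frameD[OF F]
  note df = differential_form[OF f] and dg = differential_form[OF g] and dh = differential_form[OF h]
  have B: "br P Q \<in> MV (2 + 1)" using br_field[OF P Q] by simp
  define r where "r = \<rho> + \<rho>"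
  have rr: "r \<in> SF" unfolding r_def by (intro smooth_add FD)
  \<comment> \<open>The \<open>i\<close>-th summand of the frame decomposition of \<open>r Q\<close>, evaluated on differentials.\<close>
  define W where "W i f g = der (e i) f * poisson Q (x i) g - der (e i) g * poisson Q (x i) f" for i f g
  have Ws: "W i f g \<in> SF" if "i \<in> I" "f \<in> SF" "g \<in> SF" for i f g
    unfolding W_def using that by (intro smooth_diff smooth_mult der_smooth poisson_smooth FD Q)
  have W: "(\<Sum>i\<in>I. W i f g) = r * poisson Q f g" if "f \<in> SF" "g \<in> SF" for f g
    unfolding W_def sum_subtractf local_frame_contract_bivector[OF F Q that]
      local_frame_contract_bivector[OF F Q that(2,1)] poisson_swap[OF Q that] r_def by (simp add: algebra_simps)
  have i: "mv_eval (mv_wedge 2 1 (br P (mv_vec A (e i))) (iota (d (x i)) Q) +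
        mv_scale ((-1) ^ (2 + 1)) (mv_wedge 1 2 (mv_vec A (e i)) (br P (iota (d (x i)) Q)))) [d f, d g, d h]
      = coboundary2 P (W i) f g h"
    if i: "i \<in> I" for i
  proof -
    obtain q where q: "q \<in> VF" "iota (d (x i)) Q = mv_vec A q" "\<And>g. der q g = poisson Q (x i) g"
      using iota_differential_bivector[OF Q FD(4)[OF i]] by metis
    note ei = FD(5)[OF i]
    have Bq: "br P (mv_vec A q) \<in> MV 2" and Be: "br P (mv_vec A (e i)) \<in> MV 2"
      using br_field[OF P mv_vec_field[OF q(1)]] br_field[OF P mv_vec_field[OF ei]] by simp_all
    have W: "W i = (\<lambda>f g. der (e i) f * der q g - der (e i) g * der q f)"
      by (intro ext) (simp add: W_def q(3))
    have one: "(\<lambda>_. (-1) ^ (2 + 1)) = - (1 :: 'm \<Rightarrow> real)" by (simp add: fun_eq_iff)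
    note s = der_smooth[OF ei] der_smooth[OF q(1)] poisson_smooth[OF P] smooth_mult
    show ?thesis
      unfolding q(2) mv_eval_add mv_eval_scale mv_eval_wedge_2_1[OF Be df dg dh] mv_eval_wedge_1_2[OF Bq df dg dh]
        mv_eval_vec[OF df] mv_eval_vec[OF dg] mv_eval_vec[OF dh] one W
        br_bivector_vec[OF P q(1) f g] br_bivector_vec[OF P q(1) f h] br_bivector_vec[OF P q(1) g h]
        br_bivector_vec[OF P ei f g] br_bivector_vec[OF P ei f h] br_bivector_vec[OF P ei g h]
        pairing_differential[OF ei] pairing_differential[OF q(1)] coboundary1_def coboundary2_def
      using f g h by (simp add: poisson_diff[OF P] poisson_mult[OF P] s) (simp add: algebra_simps)
  qed
  have lhs: "mv_eval (mv_wedge (2 - 1) 2 (br P (mv_fun r)) Q + mv_wedge 0 (2 + 1) (mv_fun r) (br P Q)) [d f, d g, d h] =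
      - poisson P r f * poisson Q g h + poisson P r g * poisson Q f h - poisson P r h * poisson Q f g + r * mv_eval (br P Q) [d f, d g, d h]"
    unfolding mv_wedge_fun_smul[OF B rr] mv_eval_add mv_eval_smul
    using mv_eval_wedge_1_2[OF Q df dg dh, of "br P (mv_fun r)"]
    by (simp add: br_bivector_fun[OF P rr df] br_bivector_fun[OF P rr dg] br_bivector_fun[OF P rr dh] poisson_def)
  have "- poisson P r f * poisson Q g h + poisson P r g * poisson Q f h - poisson P r h * poisson Q f g + r * mv_eval (br P Q) [d f, d g, d h]
     = (\<Sum>i\<in>I. coboundary2 P (W i) f g h)"
    unfolding lhs[symmetric] br_bivector_frame[OF P Q F, folded r_def] mv_eval_sum by (rule sum.cong[OF refl i])
  also have "\<dots> = poisson P f (\<Sum>i\<in>I. W i g h) - poisson P g (\<Sum>i\<in>I. W i f h) + poisson P h (\<Sum>i\<in>I. W i f g)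
     - (\<Sum>i\<in>I. W i (poisson P f g) h) + (\<Sum>i\<in>I. W i (poisson P f h) g) - (\<Sum>i\<in>I. W i (poisson P g h) f)"
    unfolding coboundary2_def using f g h by (simp add: poisson_sum[OF P] Ws sum.distrib sum_subtractf)
  also have "\<dots> = coboundary2 P (\<lambda>f g. r * poisson Q f g) f g h"
    unfolding coboundary2_def using f g h by (simp add: W poisson_smooth[OF P])
  also have "\<dots> = r * coboundary2 P (poisson Q) f g h + poisson P f r * poisson Q g h - poisson P g r * poisson Q f h + poisson P h r * poisson Q f g"
    unfolding coboundary2_def using f g h rr by (simp add: poisson_mult[OF P] poisson_smooth[OF Q]) (simp add: algebra_simps)
  finally have "r * mv_eval (br P Q) [d f, d g, d h] = r * coboundary2 P (poisson Q) f g h"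
    unfolding poisson_swap[OF P f rr] poisson_swap[OF P g rr] poisson_swap[OF P h rr] by (simp add: algebra_simps)
  then have "(r * mv_eval (br P Q) [d f, d g, d h]) p = (r * coboundary2 P (poisson Q) f g h) p" by (rule fun_cong)
  moreover have "r p = 2" using FD(3) by (simp add: r_def)
  ultimately show "mv_eval (br P Q) [d f, d g, d h] p = coboundary2 P (poisson Q) f g h p" by simp
qed

text \<open>The same argument one degree higher, with the previous lemma for the contractions of \<open>Q\<close>.\<close>

lemma br_bivector_trivector:
  assumes P: "P \<in> MV 2" and Q: "Q \<in> MV 3" and f: "f \<in> SF" and g: "g \<in> SF" and h: "h \<in> SF" and k: "k \<in> SF"
  shows "mv_eval (br P Q) [d f, d g, d h, d k] = coboundary3 P (triple Q) f g h k"
proof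
  fix p
  obtain I \<rho> x e where F: "local_frame A p I \<rho> x e" by (rule frameE)
  note FD = local_frameD[OF F]
  have Q': "Q \<in> MV (Suc 2)" using Q by (simp add: numeral_3_eq_3)
  note df = differential_form[OF f] and dg = differential_form[OF g] and dh = differential_form[OF h]
    and dk = differential_form[OF k]
  have B: "br P Q \<in> MV (2 + 2)" using br_field[OF P Q] by simp
  define r where "r = \<rho> + \<rho> + \<rho>"
  have rr: "r \<in> SF" unfolding r_def by (intro smooth_add FD)
  \<comment> \<open>The \<open>i\<close>-th summand of the frame decomposition of \<open>r Q\<close>, evaluated on differentials.\<close>
  define W where "W i f g h = der (e i) f * triple Q (x i) g h - der (e i) g * triple Q (x i) f h + der (e i) h * triple Q (x i) f g" for i f g h
  have Ws: "W i f g h \<in> SF" if "i \<in> I" "f \<in> SF" "g \<in> SF" "h \<in> SF" for i f g h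
    unfolding W_def using that by (intro smooth_add smooth_diff smooth_mult der_smooth triple_smooth FD Q)
  have W: "(\<Sum>i\<in>I. W i f g h) = r * triple Q f g h" if "f \<in> SF" "g \<in> SF" "h \<in> SF" for f g h
    unfolding W_def sum_subtractf sum.distrib local_frame_contract_trivector[OF F Q that]
      local_frame_contract_trivector[OF F Q that(2,1,3)] local_frame_contract_trivector[OF F Q that(3,1,2)]
      triple_swap(1)[OF Q that] triple_swap(1)[OF Q that(1,3,2)] triple_swap(2)[OF Q that] r_def by (simp add: algebra_simps)
  have i: "mv_eval (mv_wedge 2 2 (br P (mv_vec A (e i))) (iota (d (x i)) Q) +
        mv_scale ((-1) ^ (2 + 1)) (mv_wedge 1 (2 + 1) (mv_vec A (e i)) (br P (iota (d (x i)) Q)))) [d f, d g, d h, d k]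
      = coboundary3 P (W i) f g h k"
    if i: "i \<in> I" for i
  proof -
    define q where "q = iota (d (x i)) Q"
    have qf: "q \<in> MV 2" unfolding q_def by (rule iota_field[OF Q' differential_form[OF FD(4)[OF i]]])
    have qe: "poisson q f g = triple Q (x i) f g" for f g by (simp add: poisson_def triple_def q_def mv_eval_iota)
    note ei = FD(5)[OF i]
    have Bq: "br P q \<in> MV 3" and Be: "br P (mv_vec A (e i)) \<in> MV 2"
      using br_field[OF P qf] br_field[OF P mv_vec_field[OF ei]] by simp_all
    have W: "W i = (\<lambda>f g h. der (e i) f * poisson q g h - der (e i) g * poisson q f h + der (e i) h * poisson q f g)"
      by (intro ext) (simp add: W_def qe)
    have one: "(\<lambda>_. (-1) ^ (2 + 1)) = - (1 :: 'm \<Rightarrow> real)" by (simp add: fun_eq_iff)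
    have three: "(2::nat) + 1 = 3" by simp
    note s = der_smooth[OF ei] poisson_smooth[OF P] poisson_smooth[OF qf] smooth_mult smooth_diff
    have qv: "mv_eval q [d a, d b] = poisson q a b" for a b by (simp add: poisson_def)
    show ?thesis
      unfolding q_def[symmetric] mv_eval_add mv_eval_scale mv_eval_wedge_2_2[OF Be qf df dg dh dk]
        mv_eval_wedge_1_3[OF Bq df dg dh dk, folded three] qv
        mv_eval_vec[OF df] mv_eval_vec[OF dg] mv_eval_vec[OF dh] mv_eval_vec[OF dk] one W
        br_bivector_bivector[OF P qf f g h] br_bivector_bivector[OF P qf f g k]
        br_bivector_bivector[OF P qf f h k] br_bivector_bivector[OF P qf g h k]
        br_bivector_vec[OF P ei f g] br_bivector_vec[OF P ei f h] br_bivector_vec[OF P ei g h]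
        br_bivector_vec[OF P ei f k] br_bivector_vec[OF P ei g k] br_bivector_vec[OF P ei h k]
        pairing_differential[OF ei] coboundary1_def coboundary2_def coboundary3_def
      using f g h k by (simp add: poisson_diff[OF P] poisson_add[OF P] poisson_mult[OF P] s) (simp add: algebra_simps)
  qed
  have lhs: "mv_eval (mv_wedge (2 - 1) 3 (br P (mv_fun r)) Q + mv_wedge 0 (2 + 2) (mv_fun r) (br P Q)) [d f, d g, d h, d k] =
      - poisson P r f * triple Q g h k + poisson P r g * triple Q f h k - poisson P r h * triple Q f g k + poisson P r k * triple Q f g h
      + r * mv_eval (br P Q) [d f, d g, d h, d k]"
    unfolding mv_wedge_fun_smul[OF B rr] mv_eval_add mv_eval_smul
    using mv_eval_wedge_1_3[OF Q df dg dh dk, of "br P (mv_fun r)"]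
    by (simp add: br_bivector_fun[OF P rr df] br_bivector_fun[OF P rr dg] br_bivector_fun[OF P rr dh]
      br_bivector_fun[OF P rr dk] poisson_def triple_def)
  have "- poisson P r f * triple Q g h k + poisson P r g * triple Q f h k - poisson P r h * triple Q f g k + poisson P r k * triple Q f g h
      + r * mv_eval (br P Q) [d f, d g, d h, d k] = (\<Sum>i\<in>I. coboundary3 P (W i) f g h k)"
    unfolding lhs[symmetric] br_trivector_frame[OF P Q F, folded r_def] mv_eval_sum by (rule sum.cong[OF refl i])
  also have "\<dots> = poisson P f (\<Sum>i\<in>I. W i g h k) - poisson P g (\<Sum>i\<in>I. W i f h k) + poisson P h (\<Sum>i\<in>I. W i f g k)
     - poisson P k (\<Sum>i\<in>I. W i f g h)
     - (\<Sum>i\<in>I. W i (poisson P f g) h k) + (\<Sum>i\<in>I. W i (poisson P f h) g k) - (\<Sum>i\<in>I. W i (poisson P f k) g h)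
     - (\<Sum>i\<in>I. W i (poisson P g h) f k) + (\<Sum>i\<in>I. W i (poisson P g k) f h) - (\<Sum>i\<in>I. W i (poisson P h k) f g)"
    unfolding coboundary3_def using f g h k by (simp add: poisson_sum[OF P] Ws sum.distrib sum_subtractf)
  also have "\<dots> = coboundary3 P (\<lambda>f g h. r * triple Q f g h) f g h k"
    unfolding coboundary3_def using f g h k by (simp add: W poisson_smooth[OF P])
  also have "\<dots> = r * coboundary3 P (triple Q) f g h k + poisson P f r * triple Q g h k - poisson P g r * triple Q f h k
     + poisson P h r * triple Q f g k - poisson P k r * triple Q f g h"
    unfolding coboundary3_def using f g h k rr by (simp add: poisson_mult[OF P] triple_smooth[OF Q]) (simp add: algebra_simps)
  finally have "r * mv_eval (br P Q) [d f, d g, d h, d k] = r * coboundary3 P (triple Q) f g h k"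
    unfolding poisson_swap[OF P f rr] poisson_swap[OF P g rr] poisson_swap[OF P h rr] poisson_swap[OF P k rr] by (simp add: algebra_simps)
  then have "(r * mv_eval (br P Q) [d f, d g, d h, d k]) p = (r * coboundary3 P (triple Q) f g h k) p" by (rule fun_cong)
  moreover have "r p = 3" using FD(3) by (simp add: r_def)
  ultimately show "mv_eval (br P Q) [d f, d g, d h, d k] p = coboundary3 P (triple Q) f g h k p" by simp
qed

end

section \<open>The third condition\<close>

locale compatible_triple = schouten_space A br
  for A :: "('m::topological_space, 'e::euclidean_space) atlas" and br +
  fixes P \<Phi> :: "'m \<Rightarrow> 'm mvec" and N :: "'m \<Rightarrow> 'm tvec \<Rightarrow> 'm tvec"
  assumes P: "P \<in> multivector_fields A 2" and nondeg: "nondegenerate A P"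
    and N: "N \<in> endomorphism_fields A" and compat: "compatible A P N"
    and \<Phi>: "\<Phi> \<in> multivector_fields A 3"
    and closed: "br P \<Phi> = 0"
    and half: "\<And>\<alpha> \<beta>. \<alpha> \<in> one_forms A \<Longrightarrow> \<beta> \<in> one_forms A \<Longrightarrow>
      contract A \<alpha> \<beta> (mv_scale (1/2) (br P P)) = on_sections N (contract A \<alpha> \<beta> \<Phi>)"
begin

abbreviation "Psharp \<equiv> on_sections (sharp A P)"
abbreviation "NF \<equiv> on_sections N"
abbreviation "ND \<equiv> on_sections (dual_map A N)"
abbreviation "L \<equiv> lie_form A"

definition \<Psi> :: "'m \<Rightarrow> 'm mvec" where
  "\<Psi> = mv_scale (1/2) (br P P)"

lemma \<Psi>: "\<Psi> \<in> MV 3"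
  using multivector_field_smul[OF br_field[OF P P] smooth_const] by (simp add: \<Psi>_def mv_scale_smul)

lemma Psharp_field: "\<alpha> \<in> OF \<Longrightarrow> Psharp \<alpha> \<in> VF"
  by (rule sharp_field[OF P])

lemma NF_field: "X \<in> VF \<Longrightarrow> NF X \<in> VF"
  by (rule endo_field[OF N])

lemma ND_form: "\<alpha> \<in> OF \<Longrightarrow> ND \<alpha> \<in> OF"
  by (rule dual_form[OF N])

lemma eval_dual:
  assumes D: "D \<in> MV 3" and \<alpha>: "\<alpha> \<in> OF" and \<beta>: "\<beta> \<in> OF" and \<gamma>: "\<gamma> \<in> OF"
  shows "\<gamma> p (NF (contract A \<alpha> \<beta> D) p) = mv_eval D [\<alpha>, \<beta>, ND \<gamma>] p"
  using contract_tangent[OF D \<alpha> \<beta>, of p] covector_contract[OF D \<alpha> \<beta> form_cotangent[OF ND_form[OF \<gamma>]], of p]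
  by (simp add: on_sections_def dual_map_def mv_eval_def)

lemma \<Phi>_dual3:
  assumes \<alpha>: "\<alpha> \<in> OF" and \<beta>: "\<beta> \<in> OF" and \<gamma>: "\<gamma> \<in> OF"
  shows "mv_eval \<Phi> [\<alpha>, \<beta>, ND \<gamma>] = mv_eval \<Psi> [\<alpha>, \<beta>, \<gamma>]"
proof
  fix p
  have "mv_eval \<Psi> [\<alpha>, \<beta>, \<gamma>] p = \<gamma> p (contract A \<alpha> \<beta> \<Psi> p)"
    using covector_contract[OF \<Psi> \<alpha> \<beta> form_cotangent[OF \<gamma>], of p] by (simp add: mv_eval_def)
  also have "\<dots> = mv_eval \<Phi> [\<alpha>, \<beta>, ND \<gamma>] p"
    unfolding \<Psi>_def half[OF \<alpha> \<beta>] by (rule eval_dual[OF \<Phi> \<alpha> \<beta> \<gamma>])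
  finally show "mv_eval \<Phi> [\<alpha>, \<beta>, ND \<gamma>] p = mv_eval \<Psi> [\<alpha>, \<beta>, \<gamma>] p" by simp
qed

text \<open>The right-hand side of the previous lemma is alternating, hence so is the left-hand side, and \<open>N\<close>
  can be moved to the other slots.\<close>

lemma \<Phi>_dual2:
  assumes \<alpha>: "\<alpha> \<in> OF" and \<beta>: "\<beta> \<in> OF" and \<gamma>: "\<gamma> \<in> OF"
  shows "mv_eval \<Phi> [\<alpha>, ND \<beta>, \<gamma>] = mv_eval \<Psi> [\<alpha>, \<beta>, \<gamma>]"
  using mv_eval3_swap(2)[OF \<Phi> \<alpha> ND_form[OF \<beta>] \<gamma>] mv_eval3_swap(2)[OF \<Psi> \<alpha> \<beta> \<gamma>] \<Phi>_dual3[OF \<alpha> \<gamma> \<beta>] by simp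

lemma \<Phi>_dual1:
  assumes \<alpha>: "\<alpha> \<in> OF" and \<beta>: "\<beta> \<in> OF" and \<gamma>: "\<gamma> \<in> OF"
  shows "mv_eval \<Phi> [ND \<alpha>, \<beta>, \<gamma>] = mv_eval \<Psi> [\<alpha>, \<beta>, \<gamma>]"
  using mv_eval3_swap(1)[OF \<Phi> ND_form[OF \<alpha>] \<beta> \<gamma>] mv_eval3_swap(1)[OF \<Psi> \<alpha> \<beta> \<gamma>] \<Phi>_dual2[OF \<beta> \<alpha> \<gamma>] by simp

text \<open>Half of the coboundary of a bracket with itself: the six terms coincide in pairs.\<close>

lemma \<Psi>_jacobiator:
  assumes f: "f \<in> SF" and g: "g \<in> SF" and h: "h \<in> SF"
  shows "triple \<Psi> f g h = poisson P f (poisson P g h) - poisson P g (poisson P f h) + poisson P h (poisson P f g)"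
proof -
  note s = poisson_smooth[OF P]
  have "triple \<Psi> f g h = (\<lambda>_. 1/2) * coboundary2 P (poisson P) f g h"
    by (simp add: triple_def \<Psi>_def mv_eval_scale br_bivector_bivector[OF P P f g h])
  moreover have "coboundary2 P (poisson P) f g h = (\<lambda>_. 2) * (poisson P f (poisson P g h) - poisson P g (poisson P f h) + poisson P h (poisson P f g))"
    unfolding coboundary2_def poisson_swap[OF P h s[OF f g]] poisson_swap[OF P g s[OF f h]] poisson_swap[OF P f s[OF g h]]
    by (simp add: fun_eq_iff)
  ultimately have "triple \<Psi> f g h = (\<lambda>_. 1/2) * ((\<lambda>_. 2) * (poisson P f (poisson P g h) - poisson P g (poisson P f h) + poisson P h (poisson P f g)))"
    by simp
  also have "\<dots> = poisson P f (poisson P g h) - poisson P g (poisson P f h) + poisson P h (poisson P f g)" by (intro ext) simp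
  finally show ?thesis .
qed

text \<open>The graded Jacobi identity $[\pi,[\pi,\pi]] = 0$ in terms of iterated brackets of functions. It
  uses only that the bracket is bilinear and skew; all terms cancel after the nested brackets are
  moved to the right.\<close>

lemma coboundary_\<Psi>:
  assumes f: "f \<in> SF" and g: "g \<in> SF" and h: "h \<in> SF" and k: "k \<in> SF"
  shows "coboundary3 P (triple \<Psi>) f g h k = 0"
proof -
  note s = poisson_smooth[OF P]
  have sw: "poisson P (poisson P a b) c = - poisson P c (poisson P a b)" if "a \<in> SF" "b \<in> SF" "c \<in> SF" for a b c
    using that by (intro poisson_swap[OF P] s)
  have sw2: "poisson P c (poisson P (poisson P a b) e) = - poisson P c (poisson P e (poisson P a b))"
    if "a \<in> SF" "b \<in> SF" "c \<in> SF" "e \<in> SF" for a b c e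
    unfolding sw[OF that(1,2,4)] using that by (intro poisson_minus[OF P] s)
  show ?thesis
    unfolding coboundary3_def
    using f g h k
      sw[OF f g s[OF h k]] sw[OF f h s[OF g k]] sw[OF f k s[OF g h]]
    by (simp add: \<Psi>_jacobiator s smooth_add smooth_diff poisson_diff[OF P] poisson_add[OF P] sw2)
qed

lemma coboundary_\<Phi>:
  assumes f: "f \<in> SF" and g: "g \<in> SF" and h: "h \<in> SF" and k: "k \<in> SF"
  shows "coboundary3 P (triple \<Phi>) f g h k = 0"
  using br_bivector_trivector[OF P \<Phi> f g h k] by (simp add: closed mv_eval_def fun_eq_iff)

lemma NF_Psharp:
  assumes \<alpha>: "\<alpha> \<in> OF" shows "NF (Psharp \<alpha>) = Psharp (ND \<alpha>)"
  using compat form_cotangent[OF \<alpha>] by (intro ext) (simp add: on_sections_def compatible_def)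

lemma der_Psharp: "\<alpha> \<in> OF \<Longrightarrow> der (Psharp \<alpha>) f = mv_eval P [\<alpha>, d f]"
  by (rule der_sharp[OF P])

text \<open>The compatibility condition on \<open>d h\<close> and \<open>d f\<close>. For exact forms, two of the three terms of each
  bracket of forms are exact, and almost all of these cancel.\<close>

lemma lie_ND_exact:
  assumes h: "h \<in> SF" and f: "f \<in> SF"
  shows "L (Psharp (d h)) (ND (d f)) =
    ND (d (poisson P h f)) + L (Psharp (d f)) (ND (d h)) - d (pairing (ND (d h)) (Psharp (d f)))"
proof -
  note dh = differential_form[OF h] and df = differential_form[OF f]
  note Nh = ND_form[OF dh] and Nf = ND_form[OF df]
  let ?S = "\<lambda>p \<xi>. N p (sharp A P p \<xi>)"
  let ?u = "pairing (ND (d h)) (Psharp (d f))"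
  note HF = Psharp_field
  have S: "on_sections ?S \<alpha> = Psharp (ND \<alpha>)" if "\<alpha> \<in> OF" for \<alpha>
    using NF_Psharp[OF that] by (simp add: on_sections_def)
  have bf: "bracket_form A T \<alpha> \<beta> = L (on_sections T \<alpha>) \<beta> - L (on_sections T \<beta>) \<alpha> - d (pairing \<beta> (on_sections T \<alpha>))" for T \<alpha> \<beta>
    by (simp add: bracket_form_def pairing_def on_sections_def)
  \<comment> \<open>The commutation of \<open>N\<close> with $\pi^\sharp$ identifies the two ways in which \<open>?u\<close> arises from the brackets.\<close>
  have u: "?u = mv_eval P [ND (d f), d h]"
    using pairing_dual[OF HF[OF df], of N "d h"] NF_Psharp[OF df] pairing_sharp[OF P Nf dh] by simp
  have uh: "mv_eval P [d h, ND (d f)] = - ?u" unfolding u by (rule mv_eval2_swap[OF P Nf dh])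
  have us: "?u \<in> SF" unfolding u by (rule mv_eval2_smooth[OF P Nf dh])
  have "bracket_form A ?S (d h) (d f) = - d ?u"
    unfolding bf S[OF dh] S[OF df] u
    by (simp add: lie_form_differential[OF HF[OF Nh] f] lie_form_differential[OF HF[OF Nf] h]
       der_Psharp[OF Nh] der_Psharp[OF Nf] pairing_sharp[OF P Nh df])
  moreover have "bracket_form A (sharp A P) (ND (d h)) (d f) = - L (Psharp (d f)) (ND (d h))"
    unfolding bf
    by (simp add: lie_form_differential[OF HF[OF Nh] f] der_Psharp[OF Nh] pairing_sharp[OF P Nh df])
  moreover have "bracket_form A (sharp A P) (d h) (ND (d f)) = L (Psharp (d h)) (ND (d f))"
    unfolding bf
    by (simp add: lie_form_differential[OF HF[OF Nf] h] der_Psharp[OF Nf] pairing_sharp[OF P dh Nf]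
      uh differential_minus[OF us] flip: u)
  moreover have "bracket_form A (sharp A P) (d h) (d f) = d (poisson P h f)"
    unfolding bf
    by (simp add: lie_form_differential[OF HF[OF dh] f] lie_form_differential[OF HF[OF df] h]
       der_Psharp[OF dh] der_Psharp[OF df] pairing_sharp[OF P dh df] flip: poisson_def)
      (simp add: poisson_swap[OF P h f] differential_minus poisson_smooth[OF P h f])
  moreover have "bracket_form A ?S (d h) (d f) = bracket_form A (sharp A P) (ND (d h)) (d f)
      + bracket_form A (sharp A P) (d h) (ND (d f)) - ND (bracket_form A (sharp A P) (d h) (d f))"
    using conjunct2[OF compat[unfolded compatible_def]] dh df by blast
  ultimately have "- d ?u = - L (Psharp (d f)) (ND (d h)) + L (Psharp (d h)) (ND (d f)) - ND (d (poisson P h f))"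
    by (simp only:)
  then show ?thesis by (simp add: algebra_simps)
qed

lemma Psharp_add: "\<alpha> \<in> OF \<Longrightarrow> \<beta> \<in> OF \<Longrightarrow> Psharp (\<alpha> + \<beta>) = Psharp \<alpha> + Psharp \<beta>"
  by (rule vector_field_eqI)
   (auto simp: der_Psharp one_form_add der_field_add mv_eval2_add[OF P] differential_form
     intro: Psharp_field one_form_add vector_field_add)

lemma Psharp_smul: "\<alpha> \<in> OF \<Longrightarrow> a \<in> SF \<Longrightarrow> Psharp (smul a \<alpha>) = smul a (Psharp \<alpha>)"
  by (rule vector_field_eqI)
   (auto simp: der_Psharp one_form_smul der_smul mv_eval2_smul[OF P] differential_form
     intro: Psharp_field one_form_smul vector_field_smul)

text \<open>The equation $[\pi,\Phi](\theta,df,dg,dk) = 0$ for an arbitrary one-form $\theta$. The Lie derivatives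
  $\mathcal L_{\pi^\sharp df}\theta$ take the place of $d\{f,b\}$ when $\theta$ is not of the form $db$.\<close>

definition closedness :: "('m \<Rightarrow> real) \<Rightarrow> ('m \<Rightarrow> real) \<Rightarrow> ('m \<Rightarrow> real) \<Rightarrow> ('m \<Rightarrow> 'm covec) \<Rightarrow> 'm \<Rightarrow> real" where
  "closedness f g k \<theta> = der (Psharp \<theta>) (triple \<Phi> f g k) + mv_eval \<Phi> [L (Psharp (d f)) \<theta>, d g, d k]
      + mv_eval \<Phi> [d f, L (Psharp (d g)) \<theta>, d k] + mv_eval \<Phi> [d f, d g, L (Psharp (d k)) \<theta>]
      - der (Psharp (d f)) (mv_eval \<Phi> [\<theta>, d g, d k]) + der (Psharp (d g)) (mv_eval \<Phi> [\<theta>, d f, d k])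
      - der (Psharp (d k)) (mv_eval \<Phi> [\<theta>, d f, d g]) + mv_eval \<Phi> [\<theta>, d (poisson P f g), d k]
      - mv_eval \<Phi> [\<theta>, d (poisson P f k), d g] + mv_eval \<Phi> [\<theta>, d (poisson P g k), d f]"

text \<open>The terms $(\pi^\sharp df)(a)\,\Phi(\theta,dg,dk)$ that arise for $a\theta$ from the Lie derivative and
  from the derivative of $\Phi(a\theta,dg,dk)$ cancel, so the expression is tensorial in $\theta$; on exact
  forms it is the coboundary of \<open>\<Phi>\<close>.\<close>

lemma closedness_zero:
  assumes f: "f \<in> SF" and g: "g \<in> SF" and k: "k \<in> SF" and \<theta>: "\<theta> \<in> OF"
  shows "closedness f g k \<theta> = 0"
proof (rule tensorial_zero_on_exact[OF _ _ \<theta>])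
  note df = differential_form[OF f] and dg = differential_form[OF g] and dk = differential_form[OF k]
  note pbs = differential_form[OF poisson_smooth[OF P f g]] differential_form[OF poisson_smooth[OF P f k]] differential_form[OF poisson_smooth[OF P g k]]
  note H = Psharp_field[OF df] Psharp_field[OF dg] Psharp_field[OF dk]
  note Hs = H[THEN lie_form_form] H[THEN lie_form_add] H[THEN lie_form_smul] H[THEN der_add] H[THEN der_mult] H[THEN der_smooth]
  \<comment> \<open>All slots that contain \<open>\<theta>\<close> are moved to the front, so that one direction of linearity suffices.\<close>
  have sw1: "mv_eval \<Phi> [d f, s, d k] = - mv_eval \<Phi> [s, d f, d k]" "mv_eval \<Phi> [d f, d g, s] = mv_eval \<Phi> [s, d f, d g]" if "s \<in> OF" for s
    using mv_eval3_swap[OF \<Phi> that df dk] mv_eval3_swap(1)[OF \<Phi> that df dg] mv_eval3_swap(2)[OF \<Phi> df that dg] by simp_all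
  show "tensorial_on OF (closedness f g k)"
    unfolding tensorial_on_def closedness_def
    by (auto simp: sw1 Psharp_add Psharp_smul der_field_add der_smul Hs mv_eval3_add[OF \<Phi>] mv_eval3_smul[OF \<Phi>]
       mv_eval3_smooth[OF \<Phi>] one_form_add one_form_smul df dg dk pbs algebra_simps)
  fix b assume b: "b \<in> SF"
  note db = differential_form[OF b]
  note s = poisson_smooth[OF P]
  have lie: "L (Psharp (d a)) (d b) = d (poisson P a b)" if "a \<in> SF" for a
    using lie_form_differential[OF Psharp_field[OF differential_form[OF that]] b] der_Psharp[OF differential_form[OF that]]
    by (simp add: poisson_def)
  have dh: "der (Psharp (d a)) c = poisson P a c" if "a \<in> SF" for a c
    using der_Psharp[OF differential_form[OF that]] by (simp add: poisson_def)
  have m: "d (poisson P a b) = - d (poisson P b a)" if "a \<in> SF" for a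
    unfolding poisson_swap[OF P b that] by (rule differential_minus[OF s[OF b that]])
  have "closedness f g k (d b) = coboundary3 P (triple \<Phi>) b f g k"
    unfolding closedness_def lie[OF f] lie[OF g] lie[OF k] dh[OF f] dh[OF g] dh[OF k] dh[OF b] m[OF f] m[OF g] m[OF k]
      coboundary3_def sw1[OF one_form_minus[OF differential_form[OF s[OF b g]]]] sw1[OF one_form_minus[OF differential_form[OF s[OF b k]]]]
    using triple_swap(1)[OF \<Phi> s[OF f g] b k] triple_swap(1)[OF \<Phi> s[OF f k] b g] triple_swap(1)[OF \<Phi> s[OF g k] b f]
    by (simp add: triple_def mv_eval3_minus[OF \<Phi>] differential_form s b f g k df dg dk)
  then show "closedness f g k (d b) = 0" using coboundary_\<Phi>[OF b f g k] by simp
qed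

text \<open>Unlike the two Lie derivatives, their difference is linear over the functions in \<open>X\<close>: the
  contributions $\alpha(NX)\,da$ and $(N^*\alpha)(X)\,da$ cancel.\<close>

definition DN :: "('m \<Rightarrow> 'm tvec) \<Rightarrow> ('m \<Rightarrow> 'm covec) \<Rightarrow> 'm \<Rightarrow> 'm covec" where
  "DN X \<alpha> = L (NF X) \<alpha> - L X (ND \<alpha>)"

text \<open>The left-hand side of the conclusion paired with \<open>\<gamma>\<close>, rewritten so that it is visibly alternating in the
  three forms.\<close>

definition defect where
  "defect X \<alpha> \<beta> \<gamma> = der X (mv_eval \<Psi> [\<alpha>, \<beta>, \<gamma>]) - der (NF X) (mv_eval \<Phi> [\<alpha>, \<beta>, \<gamma>])
     + mv_eval \<Phi> [DN X \<alpha>, \<beta>, \<gamma>] + mv_eval \<Phi> [\<alpha>, DN X \<beta>, \<gamma>] + mv_eval \<Phi> [\<alpha>, \<beta>, DN X \<gamma>]"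

lemma DN_form: "X \<in> VF \<Longrightarrow> \<alpha> \<in> OF \<Longrightarrow> DN X \<alpha> \<in> OF"
  unfolding DN_def by (intro one_form_diff lie_form_form NF_field ND_form)

lemma DN_add: "X \<in> VF \<Longrightarrow> \<alpha> \<in> OF \<Longrightarrow> \<beta> \<in> OF \<Longrightarrow> DN X (\<alpha> + \<beta>) = DN X \<alpha> + DN X \<beta>"
  by (simp add: DN_def lie_form_add NF_field ND_form dual_add algebra_simps)

lemma DN_smul:
  assumes X: "X \<in> VF" and \<alpha>: "\<alpha> \<in> OF" and a: "a \<in> SF"
  shows "DN X (smul a \<alpha>) = smul (der (NF X) a) \<alpha> - smul (der X a) (ND \<alpha>) + smul a (DN X \<alpha>)"
  using assms
  by (simp add: DN_def lie_form_smul NF_field ND_form dual_smul) (auto simp: smul_def fun_eq_iff algebra_simps)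

lemma DN_field_add:
  "X \<in> VF \<Longrightarrow> Y \<in> VF \<Longrightarrow> \<alpha> \<in> OF \<Longrightarrow> DN (X + Y) \<alpha> = DN X \<alpha> + DN Y \<alpha>"
  by (simp add: DN_def lie_form_field_add NF_field ND_form endo_add[OF N] algebra_simps)

lemma DN_field_smul:
  assumes X: "X \<in> VF" and \<alpha>: "\<alpha> \<in> OF" and a: "a \<in> SF"
  shows "DN (smul a X) \<alpha> = smul a (DN X \<alpha>)"
  using assms pairing_dual[OF X, of N \<alpha>]
  by (simp add: DN_def lie_form_field_smul NF_field ND_form endo_smul[OF N]) (auto simp: smul_def fun_eq_iff algebra_simps)

text \<open>For \<open>smul a \<alpha>\<close> the derivative of \<open>a\<close> along \<open>X\<close> appears with \<open>\<Psi>\<close> and, from \<open>DN\<close>, with \<open>\<Phi>\<close> evaluated at the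
  dual of \<open>\<alpha>\<close>. These agree by the second hypothesis. The derivative along \<open>N X\<close> cancels by itself.\<close>

lemma defect_tensorial_form:
  assumes X: "X \<in> VF" and \<beta>: "\<beta> \<in> OF" and \<gamma>: "\<gamma> \<in> OF"
  shows "tensorial_on OF (\<lambda>\<alpha>. defect X \<alpha> \<beta> \<gamma>)"
proof -
  note NX = NF_field[OF X]
  note r = mv_eval3_add[OF \<Phi>] mv_eval3_smul[OF \<Phi>] mv_eval3_add[OF \<Psi>] mv_eval3_smul[OF \<Psi>] mv_eval3_diff[OF \<Phi>]
    mv_eval3_smooth[OF \<Phi>] mv_eval3_smooth[OF \<Psi>] one_form_add one_form_smul one_form_diff DN_form[OF X] ND_form
    der_add[OF X] der_add[OF NX] der_mult[OF X] der_mult[OF NX] der_smooth[OF X] der_smooth[OF NX] \<beta> \<gamma>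
  show ?thesis
    unfolding tensorial_on_def defect_def
    by (auto simp: DN_add[OF X] DN_smul[OF X] \<Phi>_dual1 r algebra_simps)
qed

lemma defect_tensorial_field:
  assumes \<alpha>: "\<alpha> \<in> OF" and \<beta>: "\<beta> \<in> OF" and \<gamma>: "\<gamma> \<in> OF"
  shows "tensorial_on VF (\<lambda>X. defect X \<alpha> \<beta> \<gamma>)"
  unfolding tensorial_on_def defect_def
  using assms
  by (auto simp: DN_field_add DN_field_smul mv_eval3_add[OF \<Phi>] mv_eval3_smul[OF \<Phi>] DN_form endo_add[OF N] endo_smul[OF N]
     der_field_add der_smul algebra_simps)

lemma defect_swap:
  assumes X: "X \<in> VF" and \<alpha>: "\<alpha> \<in> OF" and \<beta>: "\<beta> \<in> OF" and \<gamma>: "\<gamma> \<in> OF"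
  shows "defect X \<beta> \<alpha> \<gamma> = - defect X \<alpha> \<beta> \<gamma>" "defect X \<alpha> \<gamma> \<beta> = - defect X \<alpha> \<beta> \<gamma>"
  unfolding defect_def
  using mv_eval3_swap(1,2)[OF \<Psi> \<alpha> \<beta> \<gamma>] mv_eval3_swap(1,2)[OF \<Phi> \<alpha> \<beta> \<gamma>]
    mv_eval3_swap(1,2)[OF \<Phi> DN_form[OF X \<alpha>] \<beta> \<gamma>] mv_eval3_swap(1,2)[OF \<Phi> \<alpha> DN_form[OF X \<beta>] \<gamma>]
    mv_eval3_swap(1,2)[OF \<Phi> \<alpha> \<beta> DN_form[OF X \<gamma>]]
    der_minus[OF X mv_eval3_smooth[OF \<Psi> \<alpha> \<beta> \<gamma>]] der_minus[OF NF_field[OF X] mv_eval3_smooth[OF \<Phi> \<alpha> \<beta> \<gamma>]]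
  by simp_all

lemma DN_Psharp:
  assumes h: "h \<in> SF" and f: "f \<in> SF"
  shows "DN (Psharp (d h)) (d f) = - ND (d (poisson P h f)) - L (Psharp (d f)) (ND (d h))"
proof -
  note dh = differential_form[OF h] and df = differential_form[OF f]
  note Nh = ND_form[OF dh]
  have u: "pairing (ND (d h)) (Psharp (d f)) = mv_eval P [d f, ND (d h)]"
    by (rule pairing_sharp[OF P df Nh])
  have "L (NF (Psharp (d h))) (d f) = d (mv_eval P [ND (d h), d f])"
    unfolding NF_Psharp[OF dh] lie_form_differential[OF Psharp_field[OF Nh] f] der_Psharp[OF Nh] ..
  also have "\<dots> = - d (pairing (ND (d h)) (Psharp (d f)))"
    unfolding u mv_eval2_swap[OF P df Nh] by (rule differential_minus[OF mv_eval2_smooth[OF P df Nh]])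
  finally show ?thesis unfolding DN_def lie_ND_exact[OF h f] by simp
qed

text \<open>The terms with \<open>L\<close> are removed by \<open>closedness_zero\<close> for the one-form \<open>ND (d h)\<close>, and the dual map
  turns the remaining occurrences of \<open>\<Phi>\<close> into \<open>\<Psi>\<close>.\<close>

lemma defect_Psharp_exact:
  assumes h: "h \<in> SF" and f: "f \<in> SF" and g: "g \<in> SF" and k: "k \<in> SF"
  shows "defect (Psharp (d h)) (d f) (d g) (d k) = 0"
proof -
  note dh = differential_form[OF h] and df = differential_form[OF f] and dg = differential_form[OF g] and dk = differential_form[OF k]
  note Nh = ND_form[OF dh]
  note s = poisson_smooth[OF P]
  note ds = s[THEN differential_form]
  note Lf = lie_form_form[OF Psharp_field[OF df] Nh] lie_form_form[OF Psharp_field[OF dg] Nh] lie_form_form[OF Psharp_field[OF dk] Nh]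
  have dham: "der (Psharp (d a)) c = poisson P a c" if "a \<in> SF" for a c
    using der_Psharp[OF differential_form[OF that]] by (simp add: poisson_def)
  have e: "mv_eval \<Phi> [- ND \<alpha> - \<beta>, \<gamma>, \<delta>] = - mv_eval \<Psi> [\<alpha>, \<gamma>, \<delta>] - mv_eval \<Phi> [\<beta>, \<gamma>, \<delta>]"
    "mv_eval \<Phi> [\<gamma>, - ND \<alpha> - \<beta>, \<delta>] = - mv_eval \<Psi> [\<gamma>, \<alpha>, \<delta>] - mv_eval \<Phi> [\<gamma>, \<beta>, \<delta>]"
    "mv_eval \<Phi> [\<gamma>, \<delta>, - ND \<alpha> - \<beta>] = - mv_eval \<Psi> [\<gamma>, \<delta>, \<alpha>] - mv_eval \<Phi> [\<gamma>, \<delta>, \<beta>]"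
    if "\<alpha> \<in> OF" "\<beta> \<in> OF" "\<gamma> \<in> OF" "\<delta> \<in> OF" for \<alpha> \<beta> \<gamma> \<delta>
    using that by (simp_all add: mv_eval3_diff[OF \<Phi>] mv_eval3_minus[OF \<Phi>] one_form_minus ND_form \<Phi>_dual1 \<Phi>_dual2 \<Phi>_dual3)
  have "defect (Psharp (d h)) (d f) (d g) (d k) = poisson P h (triple \<Psi> f g k) - der (Psharp (ND (d h))) (triple \<Phi> f g k)
     - triple \<Psi> (poisson P h f) g k - triple \<Psi> f (poisson P h g) k - triple \<Psi> f g (poisson P h k)
     - mv_eval \<Phi> [L (Psharp (d f)) (ND (d h)), d g, d k] - mv_eval \<Phi> [d f, L (Psharp (d g)) (ND (d h)), d k]
     - mv_eval \<Phi> [d f, d g, L (Psharp (d k)) (ND (d h))]"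
    unfolding defect_def DN_Psharp[OF h f] DN_Psharp[OF h g] DN_Psharp[OF h k]
      e(1)[OF ds[OF h f] Lf(1) dg dk] e(2)[OF ds[OF h g] Lf(2) df dk] e(3)[OF ds[OF h k] Lf(3) df dg]
      dham[OF h] NF_Psharp[OF dh] triple_def
    by (simp add: algebra_simps)
  also have "\<dots> = coboundary3 P (triple \<Psi>) h f g k"
    using closedness_zero[OF f g k Nh, unfolded closedness_def] triple_swap(1)[OF \<Psi> f s[OF h g] k] triple_swap(1)[OF \<Psi> f s[OF h k] g]
      triple_swap(2)[OF \<Psi> f s[OF h k] g] triple_swap(1)[OF \<Psi> s[OF f g] h k] triple_swap(1)[OF \<Psi> s[OF f k] h g] triple_swap(1)[OF \<Psi> s[OF g k] h f]
    unfolding coboundary3_def \<Phi>_dual1[OF dh dg dk] \<Phi>_dual1[OF dh df dk] \<Phi>_dual1[OF dh df dg]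
      \<Phi>_dual1[OF dh ds[OF f g] dk] \<Phi>_dual1[OF dh ds[OF f k] dg] \<Phi>_dual1[OF dh ds[OF g k] df]
      dham[OF f] dham[OF g] dham[OF k]
    by (simp add: triple_def algebra_simps)
  finally show ?thesis using coboundary_\<Psi>[OF h f g k] by simp
qed

text \<open>The three forms are freed one at a time; since the defect is alternating, each of them can be moved
  to the first slot.\<close>

lemma defect_Psharp:
  assumes h: "h \<in> SF" and \<alpha>: "\<alpha> \<in> OF" and \<beta>: "\<beta> \<in> OF" and \<gamma>: "\<gamma> \<in> OF"
  shows "defect (Psharp (d h)) \<alpha> \<beta> \<gamma> = 0"
proof -
  let ?X = "Psharp (d h)"
  note X = Psharp_field[OF differential_form[OF h]]
  have 1: "defect ?X \<alpha> (d g) (d k) = 0" if "\<alpha> \<in> OF" "g \<in> SF" "k \<in> SF" for \<alpha> g k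
    by (rule tensorial_zero_on_exact[OF defect_tensorial_form[OF X] defect_Psharp_exact])
      (use that h differential_form in auto)
  have 2: "defect ?X \<beta> \<alpha> (d k) = 0" if "\<alpha> \<in> OF" "\<beta> \<in> OF" "k \<in> SF" for \<alpha> \<beta> k
  proof (rule tensorial_zero_on_exact[OF defect_tensorial_form[OF X that(1) differential_form[OF that(3)]] _ that(2)])
    fix g assume g: "g \<in> SF"
    show "defect ?X (d g) \<alpha> (d k) = 0"
      using defect_swap(1)[OF X that(1) differential_form[OF g] differential_form[OF that(3)]] 1[OF that(1) g that(3)] by simp
  qed
  show ?thesis
  proof (rule tensorial_zero_on_exact[OF defect_tensorial_form[OF X \<beta> \<gamma>] _ \<alpha>])
    fix k assume k: "k \<in> SF"
    note dk = differential_form[OF k]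
    show "defect ?X (d k) \<beta> \<gamma> = 0"
      using defect_swap(1)[OF X \<beta> dk \<gamma>] defect_swap(2)[OF X \<beta> \<gamma> dk] 2[OF \<gamma> \<beta> k] by simp
  qed
qed

text \<open>Nondegeneracy provides \<open>h\<close> such that \<open>X\<close> and the field of \<open>d h\<close> agree at \<open>p\<close>.\<close>

lemma defect_zero:
  assumes X: "X \<in> VF" and \<alpha>: "\<alpha> \<in> OF" and \<beta>: "\<beta> \<in> OF" and \<gamma>: "\<gamma> \<in> OF"
  shows "defect X \<alpha> \<beta> \<gamma> = 0"
proof
  fix p
  have "X p \<in> sharp A P p ` CS p"
    using nondeg field_tangent[OF X, of p] unfolding nondegenerate_def bij_betw_def by blast
  then obtain \<xi> where \<xi>: "\<xi> \<in> CS p" "X p = sharp A P p \<xi>" by blast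
  obtain h where h: "h \<in> SF" "d h p = \<xi>" using covector_is_differential[OF \<xi>(1)] by blast
  have "X p = Psharp (d h) p" by (simp add: on_sections_def h \<xi>)
  then show "defect X \<alpha> \<beta> \<gamma> p = 0 p"
    using tensorial_fields_pointwise[OF defect_tensorial_field[OF \<alpha> \<beta> \<gamma>] X Psharp_field[OF differential_form[OF h(1)]]]
      defect_Psharp[OF h(1) \<alpha> \<beta> \<gamma>] by simp
qed

lemma lie_dual_form: "X \<in> VF \<Longrightarrow> \<alpha> \<in> OF \<Longrightarrow> lie_dual A X N \<alpha> \<in> OF"
  unfolding lie_dual_def by (intro one_form_diff lie_form_form ND_form)

text \<open>All terms are tangent vectors at each point, so it suffices to apply the sum to smooth functions \<open>f\<close>,
  that is, to pair it with \<open>d f\<close>.\<close>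

lemma third_condition:
  assumes X: "X \<in> VF" and \<alpha>: "\<alpha> \<in> OF" and \<beta>: "\<beta> \<in> OF"
  shows "NF (contract A \<alpha> \<beta> (lie_mv A 3 X \<Phi>)) - contract A \<alpha> \<beta> (lie_mv A 3 (NF X) \<Phi>)
     - (contract A (lie_dual A X N \<alpha>) \<beta> \<Phi> + contract A \<alpha> (lie_dual A X N \<beta>) \<Phi>) = 0"
proof (intro ext)
  fix p f
  note NX = NF_field[OF X]
  note lX = lie_mv_field[OF \<Phi> X] and lN = lie_mv_field[OF \<Phi> NX]
  note da = lie_dual_form[OF X \<alpha>] and db = lie_dual_form[OF X \<beta>]
  have t: "NF (contract A \<alpha> \<beta> (lie_mv A 3 X \<Phi>)) p \<in> TS p" "contract A \<alpha> \<beta> (lie_mv A 3 (NF X) \<Phi>) p \<in> TS p"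
    "contract A (lie_dual A X N \<alpha>) \<beta> \<Phi> p \<in> TS p" "contract A \<alpha> (lie_dual A X N \<beta>) \<Phi> p \<in> TS p"
    using endo_tangent[OF N contract_tangent[OF lX \<alpha> \<beta>]] contract_tangent[OF lN \<alpha> \<beta>] contract_tangent[OF \<Phi> da \<beta>]
      contract_tangent[OF \<Phi> \<alpha> db] by (simp_all add: on_sections_def)
  show "(NF (contract A \<alpha> \<beta> (lie_mv A 3 X \<Phi>)) - contract A \<alpha> \<beta> (lie_mv A 3 (NF X) \<Phi>)
     - (contract A (lie_dual A X N \<alpha>) \<beta> \<Phi> + contract A \<alpha> (lie_dual A X N \<beta>) \<Phi>)) p f = 0 p f"
  proof (cases "f \<in> SF")
    case False
    then show ?thesis using t[THEN tangent_outside] by simp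
  next
    case True
    define \<gamma> where "\<gamma> = d f"
    have \<gamma>: "\<gamma> \<in> OF" unfolding \<gamma>_def by (rule differential_form[OF True])
    note c = \<alpha> \<beta> \<gamma>
    note LX = lie_form_form[OF X \<alpha>] lie_form_form[OF X \<beta>] lie_form_form[OF X \<gamma>]
    note LN = lie_form_form[OF NX \<alpha>] lie_form_form[OF NX \<beta>] lie_form_form[OF NX \<gamma>]
    note LD = lie_form_form[OF X ND_form[OF \<alpha>]] lie_form_form[OF X ND_form[OF \<beta>]] lie_form_form[OF X ND_form[OF \<gamma>]]
    have ev: "v f = \<gamma> p v" if "v \<in> TS p" for v using that by (simp add: \<gamma>_def differential_apply)
    have cc: "\<gamma> p (contract A \<alpha> \<beta> D p) = mv_eval D [\<alpha>, \<beta>, \<gamma>] p" if "D \<in> MV 3" "\<alpha> \<in> OF" "\<beta> \<in> OF" for D \<alpha> \<beta>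
      using covector_contract[OF that form_cotangent[OF \<gamma>]] by (simp add: mv_eval_def)
    have "mv_eval (lie_mv A 3 X \<Phi>) [\<alpha>, \<beta>, ND \<gamma>] - mv_eval (lie_mv A 3 (NF X) \<Phi>) [\<alpha>, \<beta>, \<gamma>]
       - (mv_eval \<Phi> [lie_dual A X N \<alpha>, \<beta>, \<gamma>] + mv_eval \<Phi> [\<alpha>, lie_dual A X N \<beta>, \<gamma>]) = defect X \<alpha> \<beta> \<gamma>"
      unfolding mv_eval_lie_mv[OF \<Phi> X \<alpha> \<beta> ND_form[OF \<gamma>]] mv_eval_lie_mv[OF \<Phi> NX c] defect_def lie_dual_def DN_def
        \<Phi>_dual3[OF c] \<Phi>_dual3[OF LX(1) \<beta> \<gamma>] \<Phi>_dual3[OF \<alpha> LX(2) \<gamma>]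
        mv_eval3_diff(1)[OF \<Phi> LD(1) ND_form[OF LX(1)] \<beta> \<gamma>] mv_eval3_diff(2)[OF \<Phi> LD(2) ND_form[OF LX(2)] \<alpha> \<gamma>]
        mv_eval3_diff(1)[OF \<Phi> LN(1) LD(1) \<beta> \<gamma>] mv_eval3_diff(2)[OF \<Phi> LN(2) LD(2) \<alpha> \<gamma>] mv_eval3_diff(3)[OF \<Phi> LN(3) LD(3) \<alpha> \<beta>]
        \<Phi>_dual1[OF LX(1) \<beta> \<gamma>] \<Phi>_dual2[OF \<alpha> LX(2) \<gamma>]
      by (simp add: algebra_simps)
    also have "\<dots> = 0" by (rule defect_zero[OF X c])
    finally have z: "(mv_eval (lie_mv A 3 X \<Phi>) [\<alpha>, \<beta>, ND \<gamma>] - mv_eval (lie_mv A 3 (NF X) \<Phi>) [\<alpha>, \<beta>, \<gamma>]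
       - (mv_eval \<Phi> [lie_dual A X N \<alpha>, \<beta>, \<gamma>] + mv_eval \<Phi> [\<alpha>, lie_dual A X N \<beta>, \<gamma>])) p = 0 p" by (rule fun_cong)
    show ?thesis
      using z by (simp add: ev[OF t(1)] ev[OF t(2)] ev[OF t(3)] ev[OF t(4)] eval_dual[OF lX c] cc[OF lN \<alpha> \<beta>] cc[OF \<Phi> da \<beta>] cc[OF \<Phi> \<alpha> db])
  qed
qed

end

theorem theorem5p1:
  fixes A :: "('m::{t2_space,second_countable_topology}, 'e::euclidean_space) atlas"
    and br :: "('m \<Rightarrow> 'm mvec) \<Rightarrow> ('m \<Rightarrow> 'm mvec) \<Rightarrow> 'm \<Rightarrow> 'm mvec"
    and P \<Phi> :: "'m \<Rightarrow> 'm mvec"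
    and N :: "'m \<Rightarrow> 'm tvec \<Rightarrow> 'm tvec"
  assumes "smooth_atlas A"
    and "schouten_bracket A br"
    and "P \<in> multivector_fields A 2" and "nondegenerate A P"
    and "nijenhuis A N" and "compatible A P N"
    and "\<Phi> \<in> multivector_fields A 3"
    and "br P \<Phi> = 0"
    and "\<And>\<alpha> \<beta>. \<alpha> \<in> one_forms A \<Longrightarrow> \<beta> \<in> one_forms A \<Longrightarrow>
      contract A \<alpha> \<beta> (mv_scale (1/2) (br P P)) = on_sections N (contract A \<alpha> \<beta> \<Phi>)"
  shows "pseudo_poisson_nijenhuis A br P N \<Phi>"
proof -
  interpret framed_space A by (rule smooth_atlas_framed_space[OF assms(1)])
  have N: "N \<in> endomorphism_fields A" using assms(5) by (simp add: nijenhuis_def)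
  interpret compatible_triple A br P \<Phi> N
    by unfold_locales (fact assms N)+
  show ?thesis
    unfolding pseudo_poisson_nijenhuis_def using assms third_condition by blast
qed

end
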